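(* Let $n$ be a positive integer and let $p_1,\dots,p_n$ be $n$ distinct prime numbers. Let $(X,r)$ be an indecomposable solution of the Yang–Baxter equation with $|X|=p_1\cdots p_n$. Then $(X,r)$ is a multipermutation solution. In particular, if $n>1$, then $(X,r)$ is not a simple solution.
   Context: A solution of the Yang–Baxter equation (YBE) is a pair $(X,r)$, where $X$ is a non-empty set and $r\colon X\times X\to X\times X$, written $r(x,y)=(\sigma_x(y),\gamma_y(x))$, satisfies: $r^2=\mathrm{id}$; all maps $\sigma_x,\gamma_y\colon X\to X$ are bijections; and $r_{12}r_{23}r_{12}=r_{23}r_{12}r_{23}$ as maps $X^3\to X^3$, where $r_{12}=r\times\mathrm{id}_X$ and $r_{23}=\mathrm{id}_X\times r$. (Then $\gamma_y(x)=\sigma^{-1}_{\sigma_x(y)}(x)$.) The permutation group of $(X,r)$ is $\mathcal G(X,r)=\langle \sigma_x : x\in X\rangle\le \mathrm{Sym}_X$. The solution is indecomposable if $\mathcal G(X,r)$ acts transitively on $X$. A homomorphism of solutions $f\colon(X,r)\to(Y,s)$ (with $s(t,z)=(\sigma'_t(z),\gamma'_z(t))$) is a map $f\colon X\to Y$ with $f(\sigma_x(y))=\sigma'_{f(x)}(f(y))$ for all $x,y\in X$; an epimorphism is a surjective homomorphism. A solution $(X,r)$ is simple if $|X|>1$ and every epimorphism of solutions $f\colon (X,r)\to (Y,s)$ is either an isomorphism or satisfies $|Y|=1$. The retract relation on $X$ is $x\sim y \iff \sigma_x=\sigma_y$; $r$ induces a solution $\bar r$ on $X/{\sim}$, and $\mathrm{Ret}(X,r)=(X/{\sim},\bar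 r)$. Set $\mathrm{Ret}^1=\mathrm{Ret}$ and $\mathrm{Ret}^{k}(X,r)=\mathrm{Ret}(\mathrm{Ret}^{k-1}(X,r))$. $(X,r)$ is a multipermutation solution if $|\mathrm{Ret}^k(X,r)|=1$ for some $k\ge1$; the least such $k$ is its multipermutation level. *)

theory Defs
  imports Main "HOL-Computational_Algebra.Primes"
begin

definition ybe_sigma :: "('a \<times> 'a \<Rightarrow> 'a \<times> 'a) \<Rightarrow> 'a \<Rightarrow> 'a \<Rightarrow> 'a" where
  "ybe_sigma r x y = fst (r (x, y))"

definition ybe_gamma :: "('a \<times> 'a \<Rightarrow> 'a \<times> 'a) \<Rightarrow> 'a \<Rightarrow> 'a \<Rightarrow> 'a" where
  "ybe_gamma r y x = snd (r (x, y))"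

definition r12 :: "('a \<times> 'a \<Rightarrow> 'a \<times> 'a) \<Rightarrow> 'a \<times> 'a \<times> 'a \<Rightarrow> 'a \<times> 'a \<times> 'a" where
  "r12 r t = (case t of (x, y, z) \<Rightarrow> (fst (r (x, y)), snd (r (x, y)), z))"

definition r23 :: "('a \<times> 'a \<Rightarrow> 'a \<times> 'a) \<Rightarrow> 'a \<times> 'a \<times> 'a \<Rightarrow> 'a \<times> 'a \<times> 'a" where
  "r23 r t = (case t of (x, y, z) \<Rightarrow> (x, fst (r (y, z)), snd (r (y, z))))"

definition ybe_solution :: "'a set \<Rightarrow> ('a \<times> 'a \<Rightarrow> 'a \<times> 'a) \<Rightarrow> bool" where
  "ybe_solution X r \<longleftrightarrow>
     X \<noteq> {} \<and>
     (\<forall>x\<in>X. \<forall>y\<in>X. r (x, y) \<in> X \<times> X) \<and>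
     (\<forall>x\<in>X. \<forall>y\<in>X. r (r (x, y)) = (x, y)) \<and>
     (\<forall>x\<in>X. bij_betw (ybe_sigma r x) X X) \<and>
     (\<forall>y\<in>X. bij_betw (ybe_gamma r y) X X) \<and>
     (\<forall>x\<in>X. \<forall>y\<in>X. \<forall>z\<in>X.
        r12 r (r23 r (r12 r (x, y, z))) = r23 r (r12 r (r23 r (x, y, z))))"

text \<open>Elements of the permutation group G(X,r) = <sigma_x : x in X> (as maps, relevant on X):
  all finite products of the sigma_x and their inverses.\<close>
inductive_set perm_group :: "'a set \<Rightarrow> ('a \<times> 'a \<Rightarrow> 'a \<times> 'a) \<Rightarrow> ('a \<Rightarrow> 'a) set"
  for X r where
  pg_id: "(\<lambda>z. z) \<in> perm_group X r"
| pg_sigma: "g \<in> perm_group X r \<Longrightarrow> x \<in> X \<Longrightarrow> ybe_sigma r x \<circ> g \<in> perm_group X r"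
| pg_inv: "g \<in> perm_group X r \<Longrightarrow> x \<in> X \<Longrightarrow>
             the_inv_into X (ybe_sigma r x) \<circ> g \<in> perm_group X r"

definition indecomposable :: "'a set \<Rightarrow> ('a \<times> 'a \<Rightarrow> 'a \<times> 'a) \<Rightarrow> bool" where
  "indecomposable X r \<longleftrightarrow> (\<forall>x\<in>X. \<forall>y\<in>X. \<exists>g\<in>perm_group X r. g x = y)"

definition ybe_hom ::
  "'a set \<Rightarrow> ('a \<times> 'a \<Rightarrow> 'a \<times> 'a) \<Rightarrow> 'b set \<Rightarrow> ('b \<times> 'b \<Rightarrow> 'b \<times> 'b) \<Rightarrow> ('a \<Rightarrow> 'b) \<Rightarrow> bool" where
  "ybe_hom X r Y s f \<longleftrightarrow> f ` X \<subseteq> Y \<and>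
     (\<forall>x\<in>X. \<forall>y\<in>X. f (ybe_sigma r x y) = ybe_sigma s (f x) (f y))"

definition ybe_epi ::
  "'a set \<Rightarrow> ('a \<times> 'a \<Rightarrow> 'a \<times> 'a) \<Rightarrow> 'b set \<Rightarrow> ('b \<times> 'b \<Rightarrow> 'b \<times> 'b) \<Rightarrow> ('a \<Rightarrow> 'b) \<Rightarrow> bool" where
  "ybe_epi X r Y s f \<longleftrightarrow> ybe_hom X r Y s f \<and> f ` X = Y"

text \<open>Simple solution. Targets of epimorphisms are taken as solutions on subsets of the
  same type 'a (every epimorphic image of X has cardinality at most |X|, so it is
  isomorphic to a solution on a subset of 'a when X \<subseteq> 'a).\<close>
definition simple_solution :: "'a set \<Rightarrow> ('a \<times> 'a \<Rightarrow> 'a \<times> 'a) \<Rightarrow> bool" where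
  "simple_solution X r \<longleftrightarrow>
     (\<exists>a\<in>X. \<exists>b\<in>X. a \<noteq> b) \<and>
     (\<forall>(Y :: 'a set) s f. ybe_solution Y s \<and> ybe_epi X r Y s f \<longrightarrow>
        bij_betw f X Y \<or> (\<exists>c. Y = {c}))"

text \<open>ret_eq X r k x y holds iff x and y have the same image in Ret^k(X,r)
  (the kernel of the canonical map X -> Ret^k(X,r)); ret_eq 0 is equality.\<close>
fun ret_eq :: "'a set \<Rightarrow> ('a \<times> 'a \<Rightarrow> 'a \<times> 'a) \<Rightarrow> nat \<Rightarrow> 'a \<Rightarrow> 'a \<Rightarrow> bool" where
  "ret_eq X r 0 x y = (x = y)"
| "ret_eq X r (Suc k) x y = (\<forall>z\<in>X. ret_eq X r k (ybe_sigma r x z) (ybe_sigma r y z))"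

definition multipermutation :: "'a set \<Rightarrow> ('a \<times> 'a \<Rightarrow> 'a \<times> 'a) \<Rightarrow> bool" where
  "multipermutation X r \<longleftrightarrow> (\<exists>k\<ge>1. \<forall>x\<in>X. \<forall>y\<in>X. ret_eq X r k x y)"

end

theory Submission
  imports Defs "HOL-Computational_Algebra.Squarefree" "HOL-Algebra.Sylow"
    "HOL-Algebra.Multiplicative_Group" "HOL-Combinatorics.Perm"
begin

text \<open>The retraction of an indecomposable solution is indecomposable and its cardinality divides \<open>|X|\<close>, so
  by induction it suffices that \<open>x \<mapsto> \<sigma>\<^sub>x\<close> is not injective when \<open>|X| > 1\<close>. The permutation group \<open>G\<close> is a
  left brace: the \<open>\<pi>\<close>-parts of its additive group are invariant under the \<open>\<lambda>\<close>-action, hence are Hall subgroups of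
  the multiplicative group. From these and the square-free degree one obtains, without any
  solvability theorem, a prime \<open>p\<close> such that the core \<open>K\<close> of the Sylow subgroup \<open>P\<close> is nontrivial. Let \<open>H\<close>
  be the \<open>p\<close>-complement. Then \<open>K\<close> acts trivially on \<open>H\<close>, and since \<open>p\<close> divides \<open>|X|\<close> only once, \<open>K\<close> and \<open>P\<close>
  have a common orbit of length \<open>p\<close> on \<open>X\<close>; so \<open>P\<close> fixes the \<open>H\<close>-component \<open>h\<close> of some \<open>\<sigma>\<^sub>x\<close>.
  The orbit of \<open>h\<close> is an indecomposable cycle set of smaller square-free cardinality, by induction a
  multipermutation one, and therefore generated by the single element \<open>h\<close>. As the fixed points of
  \<open>P\<close> in \<open>H\<close> form a sub-brace, \<open>P\<close> fixes all of \<open>H\<close>, which means that \<open>P\<close> is normal. Now all \<open>P\<close>-orbits on \<open>X\<close>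
  have length 1 or \<open>p\<close>, so \<open>P\<close> is abelian, and an element \<open>t \<noteq> 1\<close> of \<open>P\<close> fixed by the \<open>\<lambda>\<close>-action of \<open>P\<close> satisfies
  \<open>\<lambda>\<^sub>t = id\<close>; then \<open>\<sigma>\<close> is not injective, because \<open>t\<close> moves some \<open>x\<close> and \<open>\<sigma>\<close> takes the same value at \<open>x\<close> and \<open>t(x)\<close>.\<close>

text \<open>Hall subgroups for all sets of primes force solvability by Hall's theorem, but that
  theorem rests on Burnside's theorem for orders p^a q^b. Square-free orbit lengths allow an
  elementary substitute. They pass to normal subgroups and to Hall subgroups for up-sets of primes,
  which is why the two largest primes are singled out; and with two primes left they force the Sylow
  subgroup of the larger prime q to have order q, where counting conjugates is enough. The induction
  on cardinality serves two objects, the retraction and the orbit of h. The length of that orbit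
  divides |X| and is prime to p, so it is smaller than |X|. Both objects consist of permutations of
  X rather than of points, so they are copied back to subsets of X before the induction hypothesis
  applies. For the last claim, the retraction map of a simple solution is bijective or constant. A
  multipermutation solution with more than one point excludes the first. In the second case all
  sigma_x are one and the same cycle of length |X|, and reducing positions modulo a prime divisor of
  |X| is an epimorphism that simplicity forbids.\<close>

class group_mult = monoid_mult + inverse +
  assumes group_left_inverse [simp]: "inverse a * a = 1"
begin

lemma group_left_cancel [simp]: "a * b = a * c \<longleftrightarrow> b = c"
proof
  assume "a * b = a * c"
  then have "inverse a * (a * b) = inverse a * (a * c)" by simp
  then show "b = c" by (simp add: mult.assoc [symmetric])
qed simp

lemma group_right_inverse [simp]: "a * inverse a = 1"
  using group_left_cancel[of "inverse a" "a * inverse a" 1] by (simp add: mult.assoc [symmetric])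

lemma group_inverse_cancel [simp]: "inverse a * (a * b) = b" "a * (inverse a * b) = b"
  by (simp_all add: mult.assoc [symmetric])

lemma group_inverse_unique: "a * b = 1 \<Longrightarrow> inverse a = b"
  using group_left_cancel[of a b "inverse a"] by simp

lemma group_inverse_inverse [simp]: "inverse (inverse a) = a"
  by (rule group_inverse_unique) simp

lemma group_inverse_one [simp]: "inverse 1 = 1"
  by (rule group_inverse_unique) simp

lemma group_inverse_mult [simp]: "inverse (a * b) = inverse b * inverse a"
  by (rule group_inverse_unique) (simp add: mult.assoc)

lemma group_right_cancel [simp]: "b * a = c * a \<longleftrightarrow> b = c"
proof
  assume "b * a = c * a"
  then have "b * a * inverse a = c * a * inverse a" by simp
  then show "b = c" by (simp add: mult.assoc)
qed simp

end

subsection \<open>Numbers with prescribed prime divisors\<close>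

text \<open>The pi-numbers of Hall theory, with \<open>- S\<close> in the role of pi'. Positivity
  excludes 0, which would otherwise qualify when S contains all primes.\<close>

definition pi_num :: "nat set \<Rightarrow> nat \<Rightarrow> bool" where
  "pi_num S n \<longleftrightarrow> n > 0 \<and> (\<forall>p. prime p \<longrightarrow> p dvd n \<longrightarrow> p \<in> S)"

lemma pi_num_dvd: "pi_num S n \<Longrightarrow> m dvd n \<Longrightarrow> pi_num S m"
  by (auto simp: pi_num_def intro: dvd_trans dest: dvd_pos_nat)

lemma pi_num_mult: "pi_num S m \<Longrightarrow> pi_num S n \<Longrightarrow> pi_num S (m * n)"
  by (auto simp: pi_num_def prime_dvd_mult_iff)

lemma pi_num_mono: "pi_num S n \<Longrightarrow> S \<subseteq> T \<Longrightarrow> pi_num T n"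
  by (auto simp: pi_num_def)

lemma pi_num_1 [simp]: "pi_num S (Suc 0)"
  by (auto simp: pi_num_def)

lemma pi_num_disjoint: 
  assumes "pi_num S n" "pi_num T n" "S \<inter> T = {}" shows "n = 1"
proof (rule ccontr)
  assume "n \<noteq> 1"
  then obtain p where "prime p" "p dvd n" using prime_factor_nat by blast
  then show False using assms by (auto simp: pi_num_def)
qed

lemma pi_num_coprime:
  assumes "pi_num S m" "pi_num T n" "S \<inter> T = {}" shows "coprime m n"
proof -
  have "pi_num S (gcd m n)" "pi_num T (gcd m n)" using assms pi_num_dvd by auto
  then have "gcd m n = 1" using assms(3) pi_num_disjoint by blast
  then show ?thesis by (simp add: coprime_iff_gcd_eq_1)
qed

lemma pi_num_split: "n > 0 \<Longrightarrow> \<exists>u v. n = u * v \<and> pi_num S u \<and> pi_num (- S) v"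
proof (induction n rule: less_induct)
  case (less n)
  show ?case
  proof (cases "n = 1")
    case True then show ?thesis by (intro exI[of _ 1]) simp
  next
    case False
    then obtain p m where p: "prime p" and n: "n = p * m" using prime_factor_nat by (meson dvdE)
    then have "m < n" "m > 0" using less.prems prime_gt_1_nat[OF p] by auto
    then obtain u v where uv: "m = u * v" "pi_num S u" "pi_num (- S) v" using less.IH by blast
    have sp: "pi_num T p" if "p \<in> T" for T
      using p that by (auto simp: pi_num_def prime_gt_0_nat dest: primes_dvd_imp_eq)
    show ?thesis
    proof (cases "p \<in> S")
      case True
      then show ?thesis using uv n sp pi_num_mult by (intro exI[of _ "p * u"] exI[of _ v]) auto
    next
      case False
      then show ?thesis using uv n sp[of "- S"] pi_num_mult by (intro exI[of _ u] exI[of _ "p * v"]) auto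
    qed
  qed
qed

lemma pi_num_prime_power: "pi_num {p} n \<Longrightarrow> prime p \<Longrightarrow> \<exists>k. n = p ^ k"
proof (induction n rule: less_induct)
  case (less n)
  show ?case
  proof (cases "n = 1")
    case True then show ?thesis by (intro exI[of _ 0]) simp
  next
    case False
    then obtain q where q: "prime q" "q dvd n" using prime_factor_nat by blast
    then obtain m where n: "n = p * m" using less.prems by (auto simp: pi_num_def dvd_def)
    have "pi_num {p} m" using less.prems(1) n pi_num_dvd dvd_triv_right by blast
    moreover have "m < n" using n less.prems prime_gt_1_nat[of p] by (auto simp: pi_num_def)
    ultimately obtain k where "m = p ^ k" using less by blast
    then show ?thesis using n by (intro exI[of _ "Suc k"]) simp
  qed
qed

lemma pi_num_prime_dvd: "pi_num {p} n \<Longrightarrow> prime p \<Longrightarrow> n \<noteq> 1 \<Longrightarrow> p dvd n"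
  using pi_num_prime_power[of p n] by (metis dvd_power gr0I power_0)

lemma squarefree_prime_power: 
  assumes "squarefree n" "pi_num {p} n" "prime p" shows "n = 1 \<or> n = p"
proof -
  obtain k where k: "n = p ^ k" using assms pi_num_prime_power by blast
  have "k < 2"
  proof (rule ccontr)
    assume "\<not> k < 2"
    then have "p\<^sup>2 dvd n" using k by (simp add: le_imp_power_dvd)
    then have "p dvd 1" using assms(1) squarefreeD by blast
    then show False using assms(3) not_prime_unit by blast
  qed
  then have "k = 0 \<or> k = 1" by linarith
  then show ?thesis using k by auto
qed

lemma squarefree_prime_mult:
  assumes "squarefree n" "prime p" "p dvd n" obtains m where "n = p * m" "\<not> p dvd m"
proof -
  obtain m where m: "n = p * m" using assms(3) by (auto simp: dvd_def)
  have "\<not> p dvd m"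
  proof
    assume "p dvd m"
    then have "p\<^sup>2 dvd n" using m by (simp add: power2_eq_square mult_dvd_mono)
    then have "p dvd 1" using assms(1) squarefreeD by blast
    then show False using assms(2) not_prime_unit by blast
  qed
  with m that show ?thesis by blast
qed

subsection \<open>Finite subgroups and actions\<close>

definition subgrp :: "'g::group_mult set \<Rightarrow> bool" where
  "subgrp H \<longleftrightarrow> 1 \<in> H \<and> (\<forall>a\<in>H. \<forall>b\<in>H. a * b \<in> H) \<and> (\<forall>a\<in>H. inverse a \<in> H)"

lemma subgrpD [intro]:
  assumes "subgrp H" shows "1 \<in> H" "\<And>a b. a \<in> H \<Longrightarrow> b \<in> H \<Longrightarrow> a * b \<in> H" "\<And>a. a \<in> H \<Longrightarrow> inverse a \<in> H"
  using assms by (auto simp: subgrp_def)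

lemma subgrpI: "1 \<in> H \<Longrightarrow> (\<And>a b. a \<in> H \<Longrightarrow> b \<in> H \<Longrightarrow> a * b \<in> H) \<Longrightarrow> (\<And>a. a \<in> H \<Longrightarrow> inverse a \<in> H) \<Longrightarrow> subgrp H"
  by (auto simp: subgrp_def)

lemma subgrp_Int: "subgrp H \<Longrightarrow> subgrp K \<Longrightarrow> subgrp (H \<inter> K)"
  by (auto simp: subgrp_def)

lemma subgrp_finiteI:
  assumes "finite H" "1 \<in> H" "\<And>a b. a \<in> H \<Longrightarrow> b \<in> H \<Longrightarrow> a * b \<in> H"
  shows "subgrp H"
proof (rule subgrpI)
  fix a assume a: "a \<in> H"
  have "(*) a ` H = H"
    using assms a by (intro card_subset_eq) (auto simp: card_image inj_on_def)
  then obtain b where "b \<in> H" "a * b = 1" using assms(2) by (metis imageE)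
  then show "inverse a \<in> H" by (metis group_inverse_unique)
qed (use assms in auto)

lemma subgrp_card_pos: "subgrp H \<Longrightarrow> finite H \<Longrightarrow> card H > 0"
  by (auto simp: card_gt_0_iff)

lemma subgrp_card_eq_1: "subgrp H \<Longrightarrow> card H = 1 \<longleftrightarrow> H = {1}"
  by (auto simp: card_1_singleton_iff subgrp_def)

text \<open>Common source of Lagrange's theorem, the product formula, the orbit-stabiliser formula
  and the count of conjugates: the fibres of \<open>\<phi>\<close> are the left cosets of K in
  H.\<close>

lemma card_fibres:
  fixes H :: "'g::group_mult set"
  assumes "finite H" "subgrp H" "subgrp K" "K \<subseteq> H"
    and \<phi>: "\<And>g h. g \<in> H \<Longrightarrow> h \<in> H \<Longrightarrow> \<phi> g = \<phi> h \<longleftrightarrow> inverse g * h \<in> K"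
  shows "card H = card (\<phi> ` H) * card K"
proof -
  have "card {h \<in> H. \<phi> h = \<phi> g} = card K" if g: "g \<in> H" for g
  proof -
    have "{h \<in> H. \<phi> h = \<phi> g} = (*) g ` K"
    proof (intro equalityI subsetI)
      fix h assume "h \<in> {h \<in> H. \<phi> h = \<phi> g}"
      then have "inverse g * h \<in> K" using \<phi> [OF g, of h] by auto
      then show "h \<in> (*) g ` K" by (intro image_eqI[of _ _ "inverse g * h"]) auto
    next
      fix h assume "h \<in> (*) g ` K"
      then obtain k where k: "k \<in> K" "h = g * k" by auto
      then have "h \<in> H" using g assms by blast
      then show "h \<in> {h \<in> H. \<phi> h = \<phi> g}" using \<phi> [OF g, of h] k by auto
    qed
    then show ?thesis by (simp add: card_image inj_on_def)
  qed
  then have "(\<Sum>y\<in>\<phi> ` H. card {h \<in> H. \<phi> h = y}) = card (\<phi> ` H) * card K"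
    by (subst sum.cong [where h = "\<lambda>_. card K"]) auto
  moreover have "card H = (\<Sum>y\<in>\<phi> ` H. card {h \<in> H. \<phi> h = y})"
    using sum.image_gen[OF assms(1), of "\<lambda>_. 1::nat" \<phi>] by simp
  ultimately show ?thesis by simp
qed

definition lcos :: "'g::group_mult \<Rightarrow> 'g set \<Rightarrow> 'g set" where
  "lcos g K = (*) g ` K"

lemma lcos_one [simp]: "lcos 1 K = K" by (auto simp: lcos_def)
lemma lcos_mult: "lcos (g * h) K = lcos g (lcos h K)" by (auto simp: lcos_def image_image mult.assoc)
lemma card_lcos [simp]: "card (lcos g K) = card K" by (simp add: lcos_def card_image inj_on_def)
lemma mem_lcos: "h \<in> lcos g K \<longleftrightarrow> inverse g * h \<in> K"
  by (auto simp: lcos_def image_iff intro: bexI[of _ "inverse g * h"])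

lemma lcos_eq_iff:
  assumes "subgrp K" shows "lcos g K = lcos h K \<longleftrightarrow> inverse g * h \<in> K"
proof
  assume "lcos g K = lcos h K"
  moreover have "h \<in> lcos h K" using assms by (simp add: mem_lcos subgrpD(1))
  ultimately have "h \<in> lcos g K" by simp
  then show "inverse g * h \<in> K" by (simp only: mem_lcos)
next
  assume *: "inverse g * h \<in> K"
  show "lcos g K = lcos h K"
  proof (rule Set.set_eqI)
    fix x
    have "inverse h * x = inverse (inverse g * h) * (inverse g * x)" "inverse g * x = (inverse g * h) * (inverse h * x)"
      by (simp_all add: mult.assoc)
    then show "x \<in> lcos g K \<longleftrightarrow> x \<in> lcos h K" unfolding mem_lcos using * assms by (metis subgrpD(2,3))
  qed
qed

lemma card_cosets:
  assumes "finite H" "subgrp H" "subgrp K" "K \<subseteq> H"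
  shows "card H = card ((\<lambda>g. lcos g K) ` H) * card K"
  by (rule card_fibres[OF assms]) (rule lcos_eq_iff[OF assms(3)])

lemma subgrp_card_dvd:
  assumes "finite H" "subgrp H" "subgrp K" "K \<subseteq> H" shows "card K dvd card H"
  using card_cosets[OF assms] by simp

lemma subgrp_prime_index:
  assumes N: "finite N" "subgrp N" and H: "subgrp H" "H \<subseteq> K" and K: "subgrp K" "K \<subseteq> N"
    and "card N = q * card H" "prime q"
  shows "K = H \<or> K = N"
proof -
  have fK: "finite K" using K(2) N(1) finite_subset by blast
  obtain i where i: "card N = card K * i" using subgrp_card_dvd[OF N K] by (auto simp: dvd_def)
  obtain j where j: "card K = card H * j" using subgrp_card_dvd[OF fK K(1) H] by (auto simp: dvd_def)
  have "card H * q = card H * (j * i)" using assms(7) i j by (auto simp: ac_simps)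
  moreover have "card H > 0" using subgrp_card_pos[OF H(1)] H(2) fK finite_subset by blast
  ultimately have "q = j * i" by (simp only: mult_cancel1) auto
  then have "j = 1 \<or> i = 1" using assms(8) prime_product[of j i] by auto
  then show ?thesis using i j card_subset_eq[OF fK H(2)] card_subset_eq[OF N(1) K(2)] by auto
qed

lemma card_times:
  assumes "finite H" "finite K" "subgrp H" "subgrp K"
  shows "card {h * k | h k. h \<in> H \<and> k \<in> K} * card (H \<inter> K) = card H * card K"
proof -
  let ?C = "(\<lambda>g. lcos g K) ` H"
  have eq: "{h * k | h k. h \<in> H \<and> k \<in> K} = \<Union>?C" by (auto simp: lcos_def)
  have 1: "card H = card ?C * card (H \<inter> K)"
  proof (rule card_fibres[OF assms(1,3) subgrp_Int[OF assms(3,4)]])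
    fix g h assume "g \<in> H" "h \<in> H"
    then have "inverse g * h \<in> H" using assms(3) by blast
    then show "lcos g K = lcos h K \<longleftrightarrow> inverse g * h \<in> H \<inter> K" by (simp add: lcos_eq_iff[OF assms(4)])
  qed simp
  have "card (\<Union>?C) = (\<Sum>c\<in>?C. card c)"
  proof (rule card_Union_disjoint)
    show "pairwise disjnt ?C"
    proof (rule pairwiseI)
      fix c d assume "c \<in> ?C" "d \<in> ?C" "c \<noteq> d"
      then obtain g h where gh: "c = lcos g K" "d = lcos h K" by auto
      show "disjnt c d" unfolding disjnt_iff
      proof (intro allI notI, elim conjE)
        fix x assume "x \<in> c" "x \<in> d"
        then have "lcos g K = lcos x K" "lcos h K = lcos x K"
          using gh lcos_eq_iff[OF assms(4)] by (auto simp: mem_lcos)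
        then show False using gh \<open>c \<noteq> d\<close> by simp
      qed
    qed
  qed (use assms in \<open>auto simp: lcos_def\<close>)
  also have "\<dots> = card ?C * card K" by (subst sum.cong [where h = "\<lambda>_. card K"]) auto
  finally show ?thesis using 1 eq by simp
qed

section \<open>Actions, orbits and fixed points\<close>

definition acts :: "'g::group_mult set \<Rightarrow> 'x set \<Rightarrow> ('g \<Rightarrow> 'x \<Rightarrow> 'x) \<Rightarrow> bool" where
  "acts N X f \<longleftrightarrow> (\<forall>x\<in>X. f 1 x = x \<and> (\<forall>g\<in>N. f g x \<in> X) \<and> (\<forall>g\<in>N. \<forall>h\<in>N. f (g * h) x = f g (f h x)))"

definition orb :: "('g \<Rightarrow> 'x \<Rightarrow> 'x) \<Rightarrow> 'g set \<Rightarrow> 'x \<Rightarrow> 'x set" where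
  "orb f N x = (\<lambda>g. f g x) ` N"

definition stb :: "('g \<Rightarrow> 'x \<Rightarrow> 'x) \<Rightarrow> 'g set \<Rightarrow> 'x \<Rightarrow> 'g set" where
  "stb f N x = {g \<in> N. f g x = x}"

lemma actsD:
  assumes "acts N X f" "x \<in> X"
  shows "f 1 x = x" "\<And>g. g \<in> N \<Longrightarrow> f g x \<in> X" "\<And>g h. g \<in> N \<Longrightarrow> h \<in> N \<Longrightarrow> f (g * h) x = f g (f h x)"
  using assms by (auto simp: acts_def)

lemma acts_subset: "acts N X f \<Longrightarrow> H \<subseteq> N \<Longrightarrow> acts H X f"
  by (auto simp: acts_def subset_iff)

lemma acts_inverse:
  assumes "acts N X f" "subgrp N" "x \<in> X" "g \<in> N"
  shows "f (inverse g) (f g x) = x" "f g (f (inverse g) x) = x"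
  using actsD[OF assms(1,3)] assms(2,4) by (metis group_left_inverse group_right_inverse subgrpD(3))+

lemma acts_eq_iff:
  assumes "acts N X f" "subgrp N" "x \<in> X" "g \<in> N" "h \<in> N"
  shows "f g x = f h x \<longleftrightarrow> f (inverse g * h) x = x"
proof -
  have "f (inverse g * h) x = f (inverse g) (f h x)"
    using assms by (intro actsD(3)) auto
  then show ?thesis using acts_inverse[OF assms(1,2)] assms actsD(2)[OF assms(1)] by metis
qed

lemma subgrp_stb: "acts N X f \<Longrightarrow> subgrp N \<Longrightarrow> x \<in> X \<Longrightarrow> subgrp (stb f N x)"
  unfolding stb_def using acts_inverse(1)[of N X f x] actsD[of N X f x]
  by (intro subgrpI) (auto, metis)

lemma orb_self: "acts N X f \<Longrightarrow> subgrp N \<Longrightarrow> x \<in> X \<Longrightarrow> x \<in> orb f N x"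
  unfolding orb_def using actsD(1) by (metis imageI subgrpD(1))

lemma orb_subset: "acts N X f \<Longrightarrow> x \<in> X \<Longrightarrow> orb f N x \<subseteq> X"
  by (auto simp: orb_def acts_def)

lemma orb_mono: "H \<subseteq> N \<Longrightarrow> orb f H x \<subseteq> orb f N x"
  by (auto simp: orb_def)

lemma orb_eq:
  assumes "acts N X f" "subgrp N" "x \<in> X" "y \<in> orb f N x"
  shows "orb f N y = orb f N x"
proof -
  obtain g where g: "g \<in> N" "y = f g x" using assms(4) by (auto simp: orb_def)
  show ?thesis
  proof (intro equalityI subsetI)
    fix z assume "z \<in> orb f N y"
    then obtain h where "h \<in> N" "z = f h (f g x)" using g by (auto simp: orb_def)
    then have "z = f (h * g) x" "h * g \<in> N" using actsD(3)[OF assms(1,3)] g assms(2) by auto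
    then show "z \<in> orb f N x" by (auto simp: orb_def)
  next
    fix z assume "z \<in> orb f N x"
    then obtain h where h: "h \<in> N" "z = f h x" by (auto simp: orb_def)
    then have "z = f (h * inverse g) y"
      using g assms actsD(2)[OF assms(1)] actsD(3)[OF assms(1)] acts_inverse(1)[OF assms(1,2)] by (metis subgrpD(3))
    then show "z \<in> orb f N y" using h g assms(2) by (auto simp: orb_def)
  qed
qed

lemma acts_orb:
  assumes "acts N X f" "subgrp N" "x \<in> X" shows "acts N (orb f N x) f"
  unfolding acts_def
proof (intro ballI conjI)
  fix y g h assume y: "y \<in> orb f N x" and g: "g \<in> N"
  then have "f g y \<in> orb f N y" by (auto simp: orb_def)
  then show "f g y \<in> orb f N x" using orb_eq[OF assms y] by simp
  assume "h \<in> N"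
  then show "f (g * h) y = f g (f h y)"
    using actsD(3)[OF assms(1)] orb_subset[OF assms(1,3)] y g by blast
qed (use actsD(1)[OF assms(1)] orb_subset[OF assms(1,3)] in blast)

lemma orbit_stabilizer:
  assumes "acts N X f" "subgrp N" "finite N" "x \<in> X"
  shows "card N = card (orb f N x) * card (stb f N x)"
  unfolding orb_def
proof (rule card_fibres[OF assms(3,2)])
  fix g h assume "g \<in> N" "h \<in> N"
  then show "f g x = f h x \<longleftrightarrow> inverse g * h \<in> stb f N x"
    using acts_eq_iff[OF assms(1,2,4)] assms(2) by (auto simp: stb_def)
qed (use assms subgrp_stb in \<open>auto simp: stb_def\<close>)

lemma card_orb_dvd:
  assumes "acts N X f" "subgrp N" "finite N" "x \<in> X" shows "card (orb f N x) dvd card N"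
  using orbit_stabilizer[OF assms] by simp

text \<open>An invariant set is a disjoint union of orbits.\<close>

lemma dvd_card_invariant:
  assumes "acts N X f" "subgrp N" "Y \<subseteq> X" "finite Y" "\<And>g y. g \<in> N \<Longrightarrow> y \<in> Y \<Longrightarrow> f g y \<in> Y"
    and "\<And>y. y \<in> Y \<Longrightarrow> k dvd card (orb f N y)"
  shows "k dvd card Y"
proof -
  have Y: "acts N Y f" using assms(1,3,5) by (auto simp: acts_def)
  have "Y = \<Union>(orb f N ` Y)" using orb_self[OF Y assms(2)] orb_subset[OF Y] by auto
  moreover have "k dvd card (\<Union>(orb f N ` Y))"
  proof (rule dvd_partition)
    show "finite (\<Union>(orb f N ` Y))" using assms(4) calculation by simp
    show "\<forall>c1\<in>orb f N ` Y. \<forall>c2\<in>orb f N ` Y. c1 \<noteq> c2 \<longrightarrow> c1 \<inter> c2 = {}"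
      using orb_eq[OF Y assms(2)] by blast
  qed (use assms(6) in auto)
  ultimately show ?thesis by simp
qed

lemma card_orb_eq_1_iff:
  assumes "acts N X f" "subgrp N" "x \<in> X"
  shows "card (orb f N x) = 1 \<longleftrightarrow> (\<forall>g\<in>N. f g x = x)"
proof
  assume "card (orb f N x) = 1"
  then obtain y where "orb f N x = {y}" by (auto simp: card_1_singleton_iff)
  then have "orb f N x = {x}" using orb_self[OF assms] by auto
  then show "\<forall>g\<in>N. f g x = x" by (auto simp: orb_def)
next
  assume "\<forall>g\<in>N. f g x = x"
  then have "orb f N x = {x}" using assms(2) by (auto simp: orb_def)
  then show "card (orb f N x) = 1" by simp
qed

text \<open>The points that are not fixed form an invariant set, and each of their orbits has length
  a nontrivial power of p.\<close>

lemma p_group_fixed_points: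
  assumes "acts N X f" "subgrp N" "finite N" "finite X" "prime p" "pi_num {p} (card N)"
  shows "card X mod p = card {x \<in> X. \<forall>g\<in>N. f g x = x} mod p"
proof -
  let ?F = "{x \<in> X. \<forall>g\<in>N. f g x = x}"
  have "p dvd card (X - ?F)"
  proof (rule dvd_card_invariant[OF assms(1,2)])
    fix g y assume g: "g \<in> N" and y: "y \<in> X - ?F"
    have "f g y \<notin> ?F"
    proof
      assume F: "f g y \<in> ?F"
      then have "f (inverse g) (f g y) = f g y" using g assms(2) by auto
      then have "y = f g y" using acts_inverse(1)[OF assms(1,2) _ g] y by auto
      with F y show False by auto
    qed
    then show "f g y \<in> X - ?F" using actsD(2)[OF assms(1)] g y by auto
  next
    fix y assume y: "y \<in> X - ?F"
    then have "card (orb f N y) \<noteq> 1" using card_orb_eq_1_iff[OF assms(1,2)] by auto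
    moreover have "pi_num {p} (card (orb f N y))"
      using pi_num_dvd[OF assms(6)] card_orb_dvd[OF assms(1-3)] y by auto
    ultimately show "p dvd card (orb f N y)" using pi_num_prime_dvd assms(5) by blast
  qed (use assms(4) in auto)
  moreover have "card X = card (X - ?F) + card ?F"
    using assms(4) card_mono[of X ?F] by (simp add: card_Diff_subset)
  ultimately show ?thesis using mod_add_left_eq[of "card (X - ?F)" p "card ?F"] by (simp add: dvd_eq_mod_eq_0)
qed

text \<open>If no orbit had length p, every orbit length would be a power of p with exponent at
  least 2, and p^2 would divide \<open>card X\<close>.\<close>

lemma exists_orbit_of_size_p:
  assumes "acts P X f" "subgrp P" "finite P" "finite X" "prime p" "pi_num {p} (card P)" "squarefree (card X)"
    and "\<And>x. x \<in> X \<Longrightarrow> card (orb f P x) \<noteq> 1"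
  shows "\<exists>x\<in>X. card (orb f P x) = p"
proof (rule ccontr)
  assume no: "\<not> ?thesis"
  have "p\<^sup>2 dvd card X"
  proof (rule dvd_card_invariant[OF assms(1,2) subset_refl assms(4)])
    fix x assume x: "x \<in> X"
    obtain k where k: "card (orb f P x) = p ^ k"
      using pi_num_prime_power[OF pi_num_dvd[OF assms(6) card_orb_dvd[OF assms(1-3) x]] assms(5)] by blast
    then have "k \<noteq> 0" "k \<noteq> 1" using assms(8)[OF x] no x by (auto intro!: notI)
    then show "p\<^sup>2 dvd card (orb f P x)" using k by (simp add: le_imp_power_dvd)
  qed (use actsD(2)[OF assms(1)] in blast)
  then show False using squarefreeD[OF assms(7)] assms(5) not_prime_unit by blast
qed

lemma acts_lcos:
  assumes "subgrp N" shows "acts N ((\<lambda>g. lcos g K) ` N) lcos"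
  using assms by (auto simp: acts_def lcos_mult [symmetric])

section \<open>Normal subgroups, cores and products of subgroups\<close>

definition normal_in :: "'g::group_mult set \<Rightarrow> 'g set \<Rightarrow> bool" where
  "normal_in C N \<longleftrightarrow> subgrp C \<and> C \<subseteq> N \<and> (\<forall>g\<in>N. \<forall>c\<in>C. g * c * inverse g \<in> C)"

definition core :: "'g::group_mult set \<Rightarrow> 'g set \<Rightarrow> 'g set" where
  "core N H = {k \<in> N. \<forall>g\<in>N. g * k * inverse g \<in> H}"

definition prodset :: "'g::group_mult set \<Rightarrow> 'g set \<Rightarrow> 'g set" where
  "prodset H K = {h * k | h k. h \<in> H \<and> k \<in> K}"

lemma prodsetI: "h \<in> H \<Longrightarrow> k \<in> K \<Longrightarrow> h * k \<in> prodset H K"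
  by (auto simp: prodset_def)

lemma prodset_subset: "subgrp N \<Longrightarrow> H \<subseteq> N \<Longrightarrow> K \<subseteq> N \<Longrightarrow> prodset H K \<subseteq> N"
  by (auto simp: prodset_def)

lemma prodset_sup1: "subgrp K \<Longrightarrow> H \<subseteq> prodset H K"
  using prodsetI[of _ H 1 K] by auto

lemma prodset_sup2: "subgrp H \<Longrightarrow> K \<subseteq> prodset H K"
  using prodsetI[of 1 H _ K] by auto

lemma finite_prodset: "finite H \<Longrightarrow> finite K \<Longrightarrow> finite (prodset H K)"
  unfolding prodset_def by (rule finite_subset[of _ "(\<lambda>(h, k). h * k) ` (H \<times> K)"]) auto

lemma card_prodset:
  assumes "finite H" "finite K" "subgrp H" "subgrp K"
  shows "card (prodset H K) * card (H \<inter> K) = card H * card K"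
  unfolding prodset_def by (rule card_times[OF assms])

lemma subgrp_prodset:
  assumes "finite H" "finite K" "subgrp H" "subgrp K"
    and "\<And>h k. h \<in> H \<Longrightarrow> k \<in> K \<Longrightarrow> k * h \<in> prodset H K"
  shows "subgrp (prodset H K)"
proof (rule subgrp_finiteI)
  fix a b assume "a \<in> prodset H K" "b \<in> prodset H K"
  then obtain h k h' k' where *: "a = h * k" "b = h' * k'" "h \<in> H" "k \<in> K" "h' \<in> H" "k' \<in> K"
    by (auto simp: prodset_def)
  then obtain h'' k'' where **: "k * h' = h'' * k''" "h'' \<in> H" "k'' \<in> K"
    using assms(5)[of h' k] by (auto simp: prodset_def)
  have "a * b = h * (k * h') * k'" using * by (simp add: mult.assoc)
  also have "\<dots> = (h * h'') * (k'' * k')" using ** by (simp add: mult.assoc)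
  finally show "a * b \<in> prodset H K" using * ** assms(3,4) by (auto intro: prodsetI)
next
  show "1 \<in> prodset H K" using assms(3,4) prodset_sup1 by blast
qed (use assms finite_prodset in auto)

lemma normal_inD:
  assumes "normal_in C N" 
  shows "subgrp C" "C \<subseteq> N" "\<And>g c. g \<in> N \<Longrightarrow> c \<in> C \<Longrightarrow> g * c * inverse g \<in> C"
  using assms by (auto simp: normal_in_def)

lemma normal_in_conj:
  assumes "normal_in C N" "subgrp N" "g \<in> N" "c \<in> C" shows "inverse g * c * g \<in> C"
  using normal_inD(3)[OF assms(1), of "inverse g" c] assms by auto

lemma subgrp_prodset_normal:
  assumes "normal_in C N" "finite N" "subgrp N" "subgrp K" "K \<subseteq> N"
  shows "subgrp (prodset C K)"
proof (rule subgrp_prodset)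
  fix c k assume "c \<in> C" "k \<in> K"
  then have "k * c * inverse k \<in> C" using normal_inD[OF assms(1)] assms by blast
  then have "(k * c * inverse k) * k \<in> prodset C K" using \<open>k \<in> K\<close> by (rule prodsetI)
  then show "k * c \<in> prodset C K" by (simp add: mult.assoc)
qed (use assms normal_inD[OF assms(1)] finite_subset in auto)

lemma core_subset: "subgrp N \<Longrightarrow> core N H \<subseteq> H"
  by (auto simp: core_def dest: bspec[of _ _ 1])

lemma core_normal:
  assumes "subgrp N" "subgrp H" shows "normal_in (core N H) N"
proof -
  have "subgrp (core N H)"
  proof (rule subgrpI)
    fix a b assume ab: "a \<in> core N H" "b \<in> core N H"
    have "g * (a * b) * inverse g = (g * a * inverse g) * (g * b * inverse g)" for g
      by (simp add: mult.assoc)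
    then show "a * b \<in> core N H" using ab assms by (auto simp: core_def)
  next
    fix a assume a: "a \<in> core N H"
    have "g * inverse a * inverse g \<in> H" if "g \<in> N" for g
    proof -
      have "inverse (g * a * inverse g) \<in> H" using a that by (intro subgrpD(3)[OF assms(2)]) (auto simp: core_def)
      then show ?thesis by (simp add: mult.assoc)
    qed
    then show "inverse a \<in> core N H" using a assms by (auto simp: core_def)
  qed (use assms in \<open>auto simp: core_def\<close>)
  moreover have "h * k * inverse h \<in> core N H" if "h \<in> N" "k \<in> core N H" for h k
  proof -
    have "g * (h * k * inverse h) * inverse g \<in> H" if "g \<in> N" for g
    proof -
      have "(g * h) * k * inverse (g * h) \<in> H"
        using \<open>h \<in> N\<close> \<open>k \<in> core N H\<close> that assms(1) unfolding core_def by blast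
      then show ?thesis by (simp add: mult.assoc)
    qed
    then show ?thesis using that assms(1) by (auto simp: core_def)
  qed
  ultimately show ?thesis by (auto simp: normal_in_def core_def)
qed

subsection \<open>Hall subgroups\<close>

definition hall :: "nat set \<Rightarrow> 'g::group_mult set \<Rightarrow> 'g set \<Rightarrow> bool" where
  "hall S H N \<longleftrightarrow> subgrp H \<and> H \<subseteq> N \<and> pi_num S (card H) \<and> pi_num (- S) (card N div card H)"

text \<open>The index of H in K divides both \<open>card K\<close>, an S-number, and the index of H
  in N, which is prime to S.\<close>

lemma hall_max:
  assumes N: "finite N" "subgrp N" and H: "hall S H N" and K: "subgrp K" "H \<subseteq> K" "K \<subseteq> N" "pi_num S (card K)"
  shows "K = H"
proof -
  have h: "subgrp H" "H \<subseteq> N" "pi_num (- S) (card N div card H)" using H by (auto simp: hall_def)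
  have fK: "finite K" using N K finite_subset by blast
  have pos: "card H > 0" using h N finite_subset subgrp_card_pos by blast
  obtain j where j: "card K = card H * j" using subgrp_card_dvd[OF fK K(1) h(1) K(2)] by (auto simp: dvd_def)
  obtain i where i: "card N = card K * i" using subgrp_card_dvd[OF N K(1,3)] by (auto simp: dvd_def)
  have "card N div card H = j * i" using i j pos by (simp add: mult.assoc)
  then have "pi_num (- S) j" using h(3) pi_num_dvd by (metis dvd_triv_left)
  moreover have "pi_num S j" using K(4) j pi_num_dvd by (metis dvd_triv_right)
  ultimately have "j = 1" using pi_num_disjoint by blast
  then have "card K = card H" using j by simp
  then show ?thesis using card_subset_eq[OF fK K(2)] by simp
qed

text \<open>CH is a subgroup above H, and its order divides \<open>card C * card H\<close>, an
  S-number. Maximality of H gives CH = H.\<close>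

lemma normal_subset_hall:
  assumes N: "finite N" "subgrp N" and H: "hall S H N" and C: "normal_in C N" "pi_num S (card C)"
  shows "C \<subseteq> H"
proof -
  have h: "subgrp H" "H \<subseteq> N" "pi_num S (card H)" using H by (auto simp: hall_def)
  have c: "subgrp C" "C \<subseteq> N" using normal_inD C by blast+
  have fin: "finite C" "finite H" using N h c finite_subset by auto
  have "card (prodset C H) dvd card C * card H" using card_prodset[OF fin c(1) h(1)] by (metis dvd_triv_left)
  then have "pi_num S (card (prodset C H))" using C(2) h(3) pi_num_mult pi_num_dvd by blast
  then have "prodset C H = H"
    using hall_max[OF N H] subgrp_prodset_normal[OF C(1) N h(1,2)] prodset_sup2[OF c(1)]
      prodset_subset[OF N(2) c(2) h(2)] by blast
  then show ?thesis using prodset_sup1[OF h(1)] by blast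
qed

text \<open>The index of the intersection in C equals the index of H in CH, which divides the index
  of H in N.\<close>

lemma hall_normal:
  assumes N: "finite N" "subgrp N" and H: "hall S H N" and C: "normal_in C N"
  shows "hall S (C \<inter> H) C"
proof -
  have h: "subgrp H" "H \<subseteq> N" "pi_num S (card H)" "pi_num (- S) (card N div card H)" using H by (auto simp: hall_def)
  have c: "subgrp C" "C \<subseteq> N" using normal_inD C by blast+
  have fin: "finite C" "finite H" "finite (C \<inter> H)" using N h c finite_subset by blast+
  have s: "subgrp (C \<inter> H)" using c h subgrp_Int by blast
  have pos: "card H > 0" "card (C \<inter> H) > 0" using h s fin subgrp_card_pos by auto
  obtain j where j: "card C = card (C \<inter> H) * j" using subgrp_card_dvd[OF fin(1) c(1) s] by (auto simp: dvd_def)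
  have "card (prodset C H) = card H * j" using card_prodset[OF fin(1,2) c(1) h(1)] j pos by simp
  moreover have "card (prodset C H) dvd card N"
    using subgrp_card_dvd[OF N] subgrp_prodset_normal[OF C(1) N h(1,2)] prodset_subset[OF N(2) c(2) h(2)] by blast
  ultimately have "j dvd card N div card H" using pos by (auto simp: dvd_def mult.assoc)
  then have "pi_num (- S) j" using h(4) pi_num_dvd by blast
  moreover have "pi_num S (card (C \<inter> H))" using subgrp_card_dvd[OF fin(2) h(1) s] h(3) pi_num_dvd by blast
  ultimately show ?thesis using s j pos by (auto simp: hall_def)
qed

text \<open>By coprimality the index of H in N divides the index of the intersection in K, so HK has
  at least as many elements as N.\<close>

lemma prodset_coprime_index:
  assumes N: "finite N" "subgrp N" and H: "subgrp H" "H \<subseteq> N" and K: "subgrp K" "K \<subseteq> N"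
    and co: "coprime (card N div card H) (card N div card K)"
  shows "prodset H K = N"
proof -
  have fin: "finite H" "finite K" "finite (H \<inter> K)" using N H K finite_subset by blast+
  have s: "subgrp (H \<inter> K)" using H K subgrp_Int by blast
  obtain i where i: "card N = card H * i" using subgrp_card_dvd[OF N H] by (auto simp: dvd_def)
  obtain j where j: "card N = card K * j" using subgrp_card_dvd[OF N K] by (auto simp: dvd_def)
  obtain a where a: "card H = card (H \<inter> K) * a" using subgrp_card_dvd[OF fin(1) H(1) s] by (auto simp: dvd_def)
  obtain b where b: "card K = card (H \<inter> K) * b" using subgrp_card_dvd[OF fin(2) K(1) s] by (auto simp: dvd_def)
  have pos: "card (H \<inter> K) > 0" "card H > 0" "card K > 0" using s fin H K subgrp_card_pos by auto
  have "card N div card H = i" using i pos by simp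
  moreover have "card N div card K = j" using j pos by simp
  ultimately have "coprime i j" using co by simp
  moreover have "a * i = b * j" using i j a b pos by (simp add: mult.assoc)
  ultimately have "i dvd b" by (metis coprime_dvd_mult_left_iff dvd_triv_right)
  then have "i \<le> b" using pos b by (intro dvd_imp_le) auto
  have "card (prodset H K) = card (H \<inter> K) * a * b"
    using card_prodset[OF fin(1,2) H(1) K(1)] a b pos by (simp add: ac_simps)
  also have "\<dots> \<ge> card N" using \<open>i \<le> b\<close> i a by simp
  finally show ?thesis using prodset_subset[OF N(2) H(2) K(2)] N(1) card_seteq by blast
qed

text \<open>The C-orbit of x has as many points as the index of the stabiliser
  \<open>stb f N x\<close> in its product with C, and that product is a subgroup of N.\<close>

lemma card_orb_normal_dvd:
  assumes "acts N X f" "finite N" "subgrp N" "normal_in C N" "x \<in> X"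
  shows "card (orb f C x) dvd card (orb f N x)"
proof -
  have c: "subgrp C" "C \<subseteq> N" using normal_inD assms(4) by blast+
  have sN: "subgrp (stb f N x)" "stb f N x \<subseteq> N" using subgrp_stb assms by (auto simp: stb_def)
  have fin: "finite C" "finite (stb f N x)" using c sN assms(2) finite_subset by auto
  have int: "C \<inter> stb f N x = stb f C x" using c by (auto simp: stb_def)
  have pos: "card (stb f N x) > 0" "card (stb f C x) > 0"
    using sN fin subgrp_card_pos int subgrp_Int[OF c(1) sN(1)] finite_Int[of C "stb f N x"] by auto
  have "card (prodset C (stb f N x)) * card (stb f C x) = card C * card (stb f N x)"
    using card_prodset[OF fin c(1) sN(1)] int by simp
  also have "card C = card (orb f C x) * card (stb f C x)"
    using orbit_stabilizer[OF acts_subset[OF assms(1) c(2)] c(1) fin(1) assms(5)] .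
  finally have "card (prodset C (stb f N x)) = card (orb f C x) * card (stb f N x)" using pos by simp
  moreover have "card (prodset C (stb f N x)) dvd card N"
    using subgrp_card_dvd assms(2,3) subgrp_prodset_normal[OF assms(4,2,3) sN] prodset_subset[OF assms(3) c(2) sN(2)] by blast
  ultimately show ?thesis using orbit_stabilizer[OF assms(1,3,2,5)] pos by simp
qed

subsection \<open>Finite \<open>p\<close>-groups and groups of order \<open>p\<^sup>a q\<close>\<close>

text \<open>D permutes its cosets in P. Their number is a multiple of p, hence so is the number of
  fixed ones. D itself is fixed; for another fixed coset of some g, the inverse of g normalises
  D.\<close>

lemma p_group_normalizer_grows:
  assumes "finite P" "subgrp P" "prime p" "pi_num {p} (card P)" "subgrp D" "D \<subseteq> P" "D \<noteq> P"
  obtains g where "g \<in> P" "g \<notin> D" "\<And>d. d \<in> D \<Longrightarrow> g * d * inverse g \<in> D"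
proof -
  let ?C = "(\<lambda>g. lcos g D) ` P"
  let ?F = "{c \<in> ?C. \<forall>g\<in>D. lcos g c = c}"
  have cD: "finite D" using assms finite_subset by blast
  then have cD: "finite D" "card D > 0" using subgrp_card_pos[OF assms(5)] by simp_all
  have P: "card P = card ?C * card D" by (rule card_cosets[OF assms(1,2,5,6)])
  have "card ?C \<noteq> 1" using P assms card_subset_eq[of P D] by auto
  moreover have "pi_num {p} (card ?C)" using P assms(4) pi_num_dvd by (metis dvd_triv_left)
  ultimately have "p dvd card ?C" using pi_num_prime_dvd assms(3) by blast
  moreover have "card ?C mod p = card ?F mod p"
  proof (rule p_group_fixed_points[OF _ assms(5) cD(1) _ assms(3)])
    show "acts D ?C lcos" by (rule acts_subset[OF acts_lcos[OF assms(2)] assms(6)])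
    show "pi_num {p} (card D)" using subgrp_card_dvd[OF assms(1,2,5,6)] assms(4) pi_num_dvd by blast
  qed (use assms in auto)
  ultimately have "p dvd card ?F" by (simp only: dvd_eq_mod_eq_0)
  have "lcos g D = D" if "g \<in> D" for g using lcos_eq_iff[OF assms(5), of 1 g] that by simp
  then have "D \<in> ?F" using assms(2) by (auto intro!: image_eqI[of _ _ 1])
  have "?F \<noteq> {D}" using \<open>p dvd card ?F\<close> assms(3) not_prime_unit[of p] by auto
  then obtain c where "c \<in> ?F" "c \<noteq> D" using \<open>D \<in> ?F\<close> by blast
  then obtain g where g: "g \<in> P" "lcos g D \<noteq> D" "\<And>d. d \<in> D \<Longrightarrow> lcos d (lcos g D) = lcos g D" by auto
  have "inverse g * d * g \<in> D" if "d \<in> D" for d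
    using g(3)[OF that] lcos_eq_iff[OF assms(5), of g "d * g"] by (simp add: lcos_mult mult.assoc)
  moreover have "g \<notin> D" using g(2) \<open>\<And>g. g \<in> D \<Longrightarrow> lcos g D = D\<close> by blast
  ultimately show ?thesis using that[of "inverse g"] g(1) assms(2,5) by (metis group_inverse_inverse subgrpD(3))
qed

text \<open>A largest intersection \<open>D\<close> of \<open>P\<close> with another conjugate is trivial: otherwise either \<open>q\<close> divides
  the order of its normaliser and \<open>D\<close> lies in the core of \<open>P\<close>, or the normaliser is a \<open>p\<close>-group, lies
  in a conjugate of \<open>P\<close> and, as normalisers grow, contradicts maximality. Hence the conjugates of
  \<open>P\<close> leave room for exactly \<open>q\<close> elements, which form \<open>Q\<close>.\<close>

lemma normal_in_of_index_prime_pow: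
  fixes P Q N :: "'g::group_mult set"
  assumes N: "finite N" "subgrp N" and P: "subgrp P" "P \<subseteq> N" "pi_num {p} (card P)" and Q: "subgrp Q" "Q \<subseteq> N" "card Q = q"
    and pq: "prime p" "prime q" "p \<noteq> q" and card: "card N = q * card P" and core: "core N P = {1}"
  shows "normal_in Q N"
proof (cases "P = {1}")
  case True
  then have "Q = N" using card Q N card_subset_eq by auto
  then show ?thesis using N by (auto simp: normal_in_def)
next
  case False
  define Pc where "Pc g = (\<lambda>x. g * x * inverse g) ` P" for g
  have mem_Pc: "x \<in> Pc g \<longleftrightarrow> inverse g * x * g \<in> P" for x g
  proof
    assume "inverse g * x * g \<in> P"
    then show "x \<in> Pc g" unfolding Pc_def by (intro image_eqI[of _ _ "inverse g * x * g"]) (auto simp: mult.assoc)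
  qed (auto simp: Pc_def mult.assoc)
  have fP: "finite P" "card P > 0" using N P finite_subset subgrp_card_pos by auto
  have card_Pc [simp]: "card (Pc g) = card P" for g
    unfolding Pc_def by (rule card_image) (auto simp: inj_on_def)
  have Pc_sub: "Pc g \<subseteq> N" if "g \<in> N" for g using that P(2) N(2) by (auto simp: Pc_def)
  have Pc_subgrp: "subgrp (Pc g)" for g
  proof (rule subgrpI)
    fix a b assume "a \<in> Pc g" "b \<in> Pc g"
    then have "(inverse g * a * g) * (inverse g * b * g) \<in> P" unfolding mem_Pc using P(1) by blast
    then show "a * b \<in> Pc g" by (simp add: mem_Pc mult.assoc)
  next
    fix a assume "a \<in> Pc g"
    then have "inverse (inverse g * a * g) \<in> P" unfolding mem_Pc using P(1) by blast
    then show "inverse a \<in> Pc g" by (simp add: mem_Pc mult.assoc)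
  qed (use P(1) in \<open>simp add: mem_Pc subgrpD(1)\<close>)
  have Pc_fin: "finite (Pc g)" for g by (simp add: Pc_def fP)
  have Pc_mult: "Pc (g * h) = (\<lambda>x. g * x * inverse g) ` Pc h" for g h
    by (auto simp: Pc_def image_image mult.assoc)
  have Pc_1: "Pc 1 = P" by (auto simp: Pc_def)
  have Pc_eq: "Pc g = Pc h \<longleftrightarrow> Pc (inverse g * h) = P" for g h
  proof -
    have inj: "inj (\<lambda>x. g * x * inverse g)" by (auto simp: inj_on_def)
    have "Pc g = (\<lambda>x. g * x * inverse g) ` P" "Pc h = (\<lambda>x. g * x * inverse g) ` Pc (inverse g * h)"
      using Pc_mult[of g "inverse g * h"] by (auto simp: Pc_def)
    then show ?thesis using inj_image_eq_iff[OF inj] by metis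
  qed
  have not_normal: "\<not> (\<forall>g\<in>N. Pc g = P)"
  proof
    assume *: "\<forall>g\<in>N. Pc g = P"
    have "g * x * inverse g \<in> P" if "g \<in> N" "x \<in> P" for g x
      using * that by (auto simp: Pc_def)
    then have "P \<subseteq> core N P" using P(2) by (auto simp: core_def)
    then show False using core False P(1) by blast
  qed
  have ndvd: "\<not> q dvd card P" "\<not> p dvd q"
    using P(3) pq by (auto simp: pi_num_def dest: primes_dvd_imp_eq)
  have TI: "P \<inter> Pc g = {1}" if gg: "g \<in> N" "Pc g \<noteq> P" for g
  proof -
    let ?S = "(\<lambda>g. card (P \<inter> Pc g)) ` {g \<in> N. Pc g \<noteq> P}"
    have "finite ?S" using N(1) by simp
    then have "Max ?S \<in> ?S" using gg by (intro Max_in) auto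
    then obtain g0 where g0: "g0 \<in> N" "Pc g0 \<noteq> P" "card (P \<inter> Pc g0) = Max ?S" by force
    have max: "card (P \<inter> Pc h) \<le> card (P \<inter> Pc g0)" if "h \<in> N" "Pc h \<noteq> P" for h
      unfolding g0(3) using that \<open>finite ?S\<close> by (intro Max_ge) auto
    define D where "D = P \<inter> Pc g0"
    have sD: "subgrp D" "D \<subseteq> P" "D \<subseteq> Pc g0" using P(1) Pc_subgrp subgrp_Int by (auto simp: D_def)
    have "D = {1}"
    proof (rule ccontr)
      assume nD: "D \<noteq> {1}"
      define R where "R = {r \<in> N. \<forall>d\<in>D. r * d * inverse r \<in> D}"
      have sR: "subgrp R" "R \<subseteq> N" "finite R"
      proof -
        show fR: "finite R" using N by (simp add: R_def)
        show "subgrp R"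
        proof (rule subgrp_finiteI[OF fR])
          fix a b assume ab: "a \<in> R" "b \<in> R"
          have "(a * b) * d * inverse (a * b) = a * (b * d * inverse b) * inverse a" for d
            by (simp add: mult.assoc)
          then show "a * b \<in> R" using ab N(2) by (auto simp: R_def)
        qed (use N(2) in \<open>auto simp: R_def\<close>)
      qed (auto simp: R_def)
      show False
      proof (cases "q dvd card R")
        case True
        obtain i where i: "card N = card R * i" using subgrp_card_dvd[OF N sR(1,2)] by (auto simp: dvd_def)
        obtain m where m: "card R = q * m" using True by (auto simp: dvd_def)
        have "card P = m * i" using card i m pq(2) by (simp add: mult.assoc prime_gt_0_nat)
        then have "coprime q i" using ndvd(1) pq(2) by (metis dvd_mult prime_imp_coprime)
        moreover have "card N div card P = q" using card fP by simp
        moreover have "card N div card R = i" using i subgrp_card_pos[OF sR(1,3)] by simp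
        ultimately have NPR: "prodset P R = N" using prodset_coprime_index[OF N P(1,2) sR(1,2)] by simp
        \<comment> \<open>P has index q in N and R has index prime to q, so every g is u * r with u
          in P and r in R. Conjugation by r preserves D and conjugation by u preserves P.\<close>
        have "D \<subseteq> core N P"
        proof
          fix d assume d: "d \<in> D"
          have "g * d * inverse g \<in> P" if "g \<in> N" for g
          proof -
            have "g \<in> prodset P R" using NPR that by simp
            then obtain u r where ur: "g = u * r" "u \<in> P" "r \<in> R" by (auto simp: prodset_def)
            then have "r * d * inverse r \<in> P" using d sD by (auto simp: R_def)
            then have "u * (r * d * inverse r) * inverse u \<in> P" using ur P(1) by blast
            then show ?thesis using ur by (simp add: mult.assoc)
          qed
          then show "d \<in> core N P" using d sD P(2) by (auto simp: core_def)
        qed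
        then show False using core nD sD(1) by blast
      next
        case nq: False
        have "pi_num {p} (card R)" unfolding pi_num_def
        proof (intro conjI allI impI)
          fix l assume l: "prime l" "l dvd card R"
          then have "l dvd q * card P" using subgrp_card_dvd[OF N sR(1,2)] card by (metis dvd_trans)
          then show "l \<in> {p}" using l nq pq P(3)
            by (auto simp: prime_dvd_mult_iff pi_num_def dest: primes_dvd_imp_eq)
        qed (use sR subgrp_card_pos in auto)
        \<comment> \<open>R is a p-group permuting the q cosets of P, and q is prime to p. A fixed
          coset, that of h, means that R lies in \<open>Pc h\<close>.\<close>
        moreover define F where "F = {c \<in> (\<lambda>g. lcos g P) ` N. \<forall>r\<in>R. lcos r c = c}"
        ultimately have "card ((\<lambda>g. lcos g P) ` N) mod p = card F mod p"
          using p_group_fixed_points[OF acts_subset[OF acts_lcos[OF N(2)] sR(2)] sR(1,3) _ pq(1)] N(1) by blast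
        moreover have "card ((\<lambda>g. lcos g P) ` N) = q"
          using card_cosets[OF N P(1,2)] card fP(2) by (metis mult_cancel2 not_gr_zero)
        ultimately have "card F \<noteq> 0"
          using ndvd(2) by (intro notI) (simp add: dvd_eq_mod_eq_0)
        then obtain c where "c \<in> F" by fastforce
        then obtain h where h: "h \<in> N" "\<And>r. r \<in> R \<Longrightarrow> lcos r (lcos h P) = lcos h P" by (auto simp: F_def)
        have Rh: "R \<subseteq> Pc h"
        proof
          fix r assume "r \<in> R"
          then have "inverse h * (r * h) \<in> P"
            using h(2) lcos_eq_iff[OF P(1), of h "r * h"] by (simp add: lcos_mult)
          then show "r \<in> Pc h" by (simp add: mem_Pc mult.assoc)
        qed
        \<comment> \<open>D is proper in both P and \<open>Pc g0\<close>, so each contains a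
          normalising element outside D. The one in P makes \<open>P \<inter> Pc h\<close> larger
          than D, which forces \<open>Pc h = P\<close>; then the one in \<open>Pc g0\<close> lies in
          P as well, hence in D.\<close>
        have DP: "D \<noteq> P"
          using g0(2) card_subset_eq[OF Pc_fin, of P g0] by (auto simp: D_def)
        then obtain x where x: "x \<in> P" "x \<notin> D" "\<And>d. d \<in> D \<Longrightarrow> x * d * inverse x \<in> D"
          using p_group_normalizer_grows[OF fP(1) P(1) pq(1) P(3) sD(1,2)] by blast
        have DR: "D \<subseteq> R" using sD P(2) by (auto simp: R_def)
        have "x \<in> R" using x P(2) by (auto simp: R_def)
        then have "D \<subset> P \<inter> Pc h" using x DR Rh sD by auto
        then have "card D < card (P \<inter> Pc h)" using fP by (intro psubset_card_mono) auto
        then have Ph: "Pc h = P" using max[OF h(1)] by (fastforce simp: D_def)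
        have "D \<noteq> Pc g0" using g0(2) card_subset_eq[OF fP(1), of "Pc g0"] by (auto simp: D_def)
        moreover have "pi_num {p} (card (Pc g0))" using P(3) by simp
        ultimately obtain y where y: "y \<in> Pc g0" "y \<notin> D" "\<And>d. d \<in> D \<Longrightarrow> y * d * inverse y \<in> D"
          using p_group_normalizer_grows[OF Pc_fin Pc_subgrp pq(1) _ sD(1,3)] by blast
        then have "y \<in> R" using Pc_sub[OF g0(1)] by (auto simp: R_def)
        then show False using Rh Ph y by (auto simp: D_def)
      qed
    qed
    then have "card (P \<inter> Pc g) \<le> 1" using max[OF gg] by (simp add: D_def)
    moreover have s: "subgrp (P \<inter> Pc g)" using P(1) Pc_subgrp subgrp_Int by blast
    moreover have "card (P \<inter> Pc g) > 0" using subgrp_card_pos[OF s] fP by simp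
    ultimately have "card (P \<inter> Pc g) = 1" by linarith
    then show ?thesis using subgrp_card_eq_1[OF s] by blast
  qed
  \<comment> \<open>P has prime index and is not normal, so it is its own normaliser and has exactly
    q conjugates.\<close>
  define M where "M = {g \<in> N. Pc g = P}"
  have "M = P"
  proof -
    have fM: "finite M" using N by (simp add: M_def)
    have sM: "subgrp M"
    proof (rule subgrp_finiteI[OF fM])
      fix a b assume "a \<in> M" "b \<in> M"
      then show "a * b \<in> M" using Pc_mult[of a b] N(2) by (auto simp: M_def Pc_def)
    qed (use N(2) Pc_1 in \<open>auto simp: M_def\<close>)
    have PM: "P \<subseteq> M"
    proof
      fix x assume x: "x \<in> P"
      have "Pc x \<subseteq> P" using x P(1) by (auto simp: Pc_def)
      then have "Pc x = P" using fP card_subset_eq by (metis card_Pc)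
      then show "x \<in> M" using x P(2) by (auto simp: M_def)
    qed
    have "M \<noteq> N" using not_normal by (auto simp: M_def)
    then show ?thesis
      using subgrp_prime_index[OF N P(1) PM sM _ card pq(2)] by (auto simp: M_def)
  qed
  then have Pc_eq': "Pc g = Pc h \<longleftrightarrow> inverse g * h \<in> P" if "g \<in> N" "h \<in> N" for g h
    using Pc_eq[of g h] that N(2) by (auto simp: M_def)
  have "card N = card (Pc ` N) * card P"
    by (rule card_fibres[OF N P(1,2)]) (rule Pc_eq')
  then have cPc: "card (Pc ` N) = q" using card fP(2) by (metis mult_cancel2 not_gr_zero)
  have conj_1: "x = 1" if "inverse g * x * g = 1" for x g :: 'g
  proof -
    have "g * (inverse g * x * g) * inverse g = x" by (simp add: mult.assoc)
    then show ?thesis unfolding that by simp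
  qed
  \<comment> \<open>Of the \<open>q * card P\<close> elements of N, the nontrivial elements of the q
    conjugates account for \<open>q * (card P - 1)\<close>.\<close>
  define U where "U = (\<Union>c\<in>Pc ` N. c - {1})"
  have "card U = (\<Sum>c\<in>Pc ` N. card (c - {1}))"
    unfolding U_def
  proof (rule card_UN_disjoint)
    show "\<forall>c\<in>Pc ` N. \<forall>d\<in>Pc ` N. c \<noteq> d \<longrightarrow> (c - {1}) \<inter> (d - {1}) = {}"
    proof (intro ballI impI)
      fix c d assume "c \<in> Pc ` N" "d \<in> Pc ` N" and cd: "c \<noteq> d"
      then obtain g h where gh: "g \<in> N" "h \<in> N" "c = Pc g" "d = Pc h" by auto
      then have "P \<inter> Pc (inverse g * h) = {1}" using TI[of "inverse g * h"] Pc_eq cd N(2) by auto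
      moreover have "inverse g * x * g \<in> P \<inter> Pc (inverse g * h)" if "x \<in> c" "x \<in> d" for x
        using that gh by (simp add: mem_Pc mult.assoc)
      ultimately show "(c - {1}) \<inter> (d - {1}) = {}" using conj_1 by blast
    qed
  qed (use N Pc_fin in auto)
  also have "\<dots> = q * (card P - 1)"
    using Pc_fin Pc_subgrp cPc by (subst sum.cong [where h = "\<lambda>_. card P - 1"]) (auto simp: subgrpD(1))
  finally have cU: "card U = q * (card P - 1)" .
  have US: "U \<subseteq> N" using Pc_sub by (auto simp: U_def)
  have "card (N - U) = card N - card U" using US N(1) finite_subset by (intro card_Diff_subset) auto
  also have "\<dots> = q" using cU card fP by (cases "card P") auto
  finally have cNU: "card (N - U) = q" .
  have "Q \<subseteq> N - U"
  proof
    fix x assume x: "x \<in> Q"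
    have "x \<notin> U"
    proof
      assume "x \<in> U"
      then obtain g where g: "g \<in> N" "x \<in> Pc g" "x \<noteq> 1" by (auto simp: U_def)
      have s: "subgrp (Q \<inter> Pc g)" using Q Pc_subgrp subgrp_Int by blast
      have "card (Q \<inter> Pc g) dvd q" "card (Q \<inter> Pc g) dvd card P"
        using subgrp_card_dvd[OF _ Q(1) s] subgrp_card_dvd[OF Pc_fin Pc_subgrp s] Q(2,3) N(1) finite_subset by auto
      moreover have "coprime q (card P)" using ndvd(1) pq(2) prime_imp_coprime by blast
      ultimately have "card (Q \<inter> Pc g) = 1" by (metis coprime_common_divisor_nat)
      then show False using s subgrp_card_eq_1 x g by blast
    qed
    then show "x \<in> N - U" using x Q by auto
  qed
  then have QU: "Q = N - U" using card_subset_eq[of "N - U" Q] N(1) cNU Q(3) by auto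
  have conjU: "inverse g * x * g \<in> U" if gx: "g \<in> N" "x \<in> U" for g x
  proof -
    obtain h where h: "h \<in> N" "x \<in> Pc h" "x \<noteq> 1" using gx(2) by (auto simp: U_def)
    have "inverse g * x * g \<in> Pc (inverse g * h)" using h(2) by (simp add: mem_Pc mult.assoc)
    moreover have "inverse g * x * g \<noteq> 1" using h(3) conj_1 by blast
    moreover have "inverse g * h \<in> N" using gx(1) h(1) N(2) by blast
    ultimately show ?thesis unfolding U_def by blast
  qed
  have "g * c * inverse g \<in> Q" if "g \<in> N" "c \<in> Q" for g c
  proof -
    have "g * c * inverse g \<notin> U"
    proof
      assume "g * c * inverse g \<in> U"
      then have "inverse g * (g * c * inverse g) * g \<in> U" using conjU that by blast
      then have "c \<in> U" by (simp add: mult.assoc)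
      then show False using that QU by auto
    qed
    then show ?thesis using QU that N(2) Q(2) by auto
  qed
  then show ?thesis using Q by (auto simp: normal_in_def)
qed

subsection \<open>Hall families and square-free orbits\<close>

lemma finite_stb: "finite N \<Longrightarrow> finite (stb f N x)"
  by (simp add: stb_def)

lemma stb_mono: "H \<subseteq> N \<Longrightarrow> stb f H x \<subseteq> stb f N x"
  by (auto simp: stb_def)

text \<open>The stabiliser of y is a q-group acting on an orbit of length q. It fixes y, and the
  number of its fixed points there is a multiple of q, so it fixes the whole orbit.\<close>

lemma small_orbit_stabilizer:
  assumes "acts Q X f" "subgrp Q" "finite Q" "prime q" "pi_num {q} (card Q)" "y \<in> X"
    and "card (orb f Q y) = q" and z: "z \<in> orb f Q y"
  shows "stb f Q z = stb f Q y"
proof -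
  have *: "g \<in> stb f Q z" if y: "y \<in> X" "card (orb f Q y) = q" and z: "z \<in> orb f Q y" and g: "g \<in> stb f Q y" for y z g
  proof -
    let ?S = "stb f Q y"
    define F where "F = {z \<in> orb f Q y. \<forall>g\<in>?S. f g z = z}"
    have S: "subgrp ?S" "?S \<subseteq> Q" using subgrp_stb[OF assms(1,2) y(1)] by (auto simp: stb_def)
    have fin: "finite ?S" "finite (orb f Q y)" using S assms(3) finite_subset by (auto simp: orb_def)
    have "acts Q (orb f Q y) f" by (rule acts_orb[OF assms(1,2) y(1)])
    then have "acts ?S (orb f Q y) f" using acts_subset S(2) by blast
    moreover have "pi_num {q} (card ?S)" using subgrp_card_dvd[OF assms(3,2) S] assms(5) pi_num_dvd by blast
    ultimately have "card (orb f Q y) mod q = card F mod q"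
      unfolding F_def using S(1) fin assms(4) by (intro p_group_fixed_points)
    then have "q dvd card F" using y by (simp add: dvd_eq_mod_eq_0)
    moreover have "y \<in> F" using orb_self[OF assms(1,2) y(1)] by (auto simp: F_def stb_def)
    moreover have "finite F" using fin by (simp add: F_def)
    ultimately have "q \<le> card F" by (metis card_gt_0_iff dvd_imp_le empty_iff)
    then have "F = orb f Q y" using y fin by (intro card_seteq) (auto simp: F_def)
    then show ?thesis using z g by (auto simp: F_def stb_def)
  qed
  have zX: "z \<in> X" using z orb_subset[OF assms(1,6)] by blast
  have o: "orb f Q z = orb f Q y" using orb_eq[OF assms(1,2,6) z] .
  have "y \<in> orb f Q z" using o orb_self[OF assms(1,2,6)] by simp
  then show ?thesis using * [OF assms(6,7) z] * [OF zX, of y] o assms(7) by auto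
qed

lemma pi_num_two_primes:
  assumes "pi_num S n" "S \<inter> T \<subseteq> {q}" "pi_num T n" shows "pi_num {q} n"
  using assms by (auto simp: pi_num_def)

lemma pi_num_not_dvd: "pi_num S n \<Longrightarrow> prime q \<Longrightarrow> q \<notin> S \<Longrightarrow> \<not> q dvd n"
  by (auto simp: pi_num_def)

text \<open>In the main case the orbit has length \<open>p q\<close>. The points \<open>z\<close> of a \<open>P\<close>-orbit of length \<open>p\<close> share
  their stabiliser \<open>P0\<close> in \<open>P\<close>, and the stabiliser of \<open>z\<close> in \<open>N\<close> is the product of \<open>P0\<close> and the
  stabiliser of \<open>z\<close> in \<open>Q\<close>. If two of the latter differ, they generate \<open>Q\<close>, so \<open>P0 Q\<close> is a subgroup of
  index \<open>p < q\<close> and contains \<open>Q\<close> in its core; if they all agree, they act trivially.\<close>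

lemma sylow_card_of_simple:
  fixes N P Q :: "'g::group_mult set" and f :: "'g \<Rightarrow> 'x \<Rightarrow> 'x"
  assumes N: "finite N" "subgrp N" and P: "subgrp P" "P \<subseteq> N" "pi_num {p} (card P)"
    and Q: "subgrp Q" "Q \<subseteq> N" "pi_num {q} (card Q)" "Q \<noteq> {1}"
    and card: "card N = card P * card Q" and pq: "prime p" "prime q" "p < q"
    and simple: "\<And>C. normal_in C N \<Longrightarrow> C = {1} \<or> C = N"
    and X: "acts N X f" "\<And>g. g \<in> N \<Longrightarrow> \<forall>x\<in>X. f g x = x \<Longrightarrow> g = 1"
    and sqf: "\<And>x. x \<in> X \<Longrightarrow> squarefree (card (orb f N x))" "\<And>x. x \<in> X \<Longrightarrow> squarefree (card (orb f Q x))"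
  shows "card Q = q"
proof -
  have fin: "finite P" "finite Q" "card P > 0" "card Q > 0"
    using N P Q finite_subset by (blast, blast, auto simp: pi_num_def)
  have PQ1: "P \<inter> Q = {1}"
  proof -
    have s: "subgrp (P \<inter> Q)" using P(1) Q(1) subgrp_Int by blast
    have "pi_num {p} (card (P \<inter> Q))" "pi_num {q} (card (P \<inter> Q))"
      using subgrp_card_dvd[OF fin(1) P(1) s] subgrp_card_dvd[OF fin(2) Q(1) s] P(3) Q(3) pi_num_dvd by auto
    then have "card (P \<inter> Q) = 1" using pi_num_disjoint[of "{p}" _ "{q}"] pq(3) by auto
    then show ?thesis using subgrp_card_eq_1[OF s] by blast
  qed
  have NQP: "prodset Q P = N"
  proof (rule prodset_coprime_index[OF N Q(1,2) P(1,2)])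
    have "card N div card Q = card P" "card N div card P = card Q" using card fin by auto
    then show "coprime (card N div card Q) (card N div card P)"
      using pi_num_coprime[OF P(3) Q(3)] pq(3) by simp
  qed
  have sN: "pi_num {p, q} (card N)" 
    unfolding card by (intro pi_num_mult pi_num_mono[OF P(3)] pi_num_mono[OF Q(3)]) auto
  have nd: "\<not> q dvd card P" "\<not> p dvd card Q" using pi_num_not_dvd[OF P(3), of q] pi_num_not_dvd[OF Q(3), of p] pq by auto
  obtain a where a: "a \<in> Q" "a \<noteq> 1" using Q(1,4) by blast
  then obtain x where x: "x \<in> X" "f a x \<noteq> x" using X(2)[of a] Q(2) by blast
  define W where "W = orb f N x"
  have WX: "W \<subseteq> X" unfolding W_def by (rule orb_subset[OF X(1) x(1)])
  have fW: "finite W" using N by (simp add: W_def orb_def)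
  have orbW: "orb f N y = W" if "y \<in> W" for y using orb_eq[OF X(1) N(2) x(1)] that by (simp add: W_def)
  have actW: "acts N W f" unfolding W_def by (rule acts_orb[OF X(1) N(2) x(1)])
  have xW: "x \<in> W" unfolding W_def by (rule orb_self[OF X(1) N(2) x(1)])
  \<comment> \<open>The kernel of the action on W is normal and does not contain a, so simplicity
    makes it trivial.\<close>
  have faithful: "g = 1" if g: "g \<in> N" "\<forall>y\<in>W. f g y = y" for g
  proof -
    define K where "K = {g \<in> N. \<forall>y\<in>W. f g y = y}"
    have sK: "subgrp K"
    proof (rule subgrp_finiteI)
      fix a b assume "a \<in> K" "b \<in> K"
      then show "a * b \<in> K" using actsD(3)[OF actW] N(2) by (auto simp: K_def)
    qed (use N actsD(1)[OF actW] in \<open>auto simp: K_def\<close>)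
    have "normal_in K N" unfolding normal_in_def
    proof (intro conjI ballI sK)
      fix g k assume g: "g \<in> N" and k: "k \<in> K"
      have "f (g * k * inverse g) y = y" if y: "y \<in> W" for y
      proof -
        have "inverse g \<in> N" "k \<in> N" "g * k \<in> N" using g k N(2) by (auto simp: K_def)
        then have "f (g * k * inverse g) y = f g (f k (f (inverse g) y))"
          using actsD(2,3)[OF actW] y g by metis
        also have "f k (f (inverse g) y) = f (inverse g) y"
          using k actsD(2)[OF actW y] \<open>inverse g \<in> N\<close> by (auto simp: K_def)
        finally show ?thesis using acts_inverse(2)[OF actW N(2) y g] by simp
      qed
      then show "g * k * inverse g \<in> K" using g k N(2) by (auto simp: K_def)
    qed (auto simp: K_def)
    moreover have "a \<notin> K" using x(2) xW by (auto simp: K_def)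
    ultimately have "K = {1}" using simple a(1) Q(2) by blast
    then show ?thesis using g by (auto simp: K_def)
  qed
  have m: "squarefree (card W)" "card W dvd card N"
    using sqf(1) x(1) card_orb_dvd[OF X(1) N(2,1) x(1)] by (auto simp: W_def)
  have cardN: "card N = card W * card (stb f N y)" if "y \<in> W" for y
    using orbit_stabilizer[OF actW N(2,1) that] orbW[OF that] by simp
  note actP = acts_subset[OF actW P(2)] and actQ = acts_subset[OF actW Q(2)]
  have cQ: "card (orb f Q y) = 1 \<or> card (orb f Q y) = q" if "y \<in> W" for y
    using squarefree_prime_power[OF sqf(2)] that WX card_orb_dvd[OF actQ Q(1) fin(2) that] Q(3) pi_num_dvd pq(2) by blast
  have notriv: "\<exists>y\<in>W. card (orb f Q y) = q"
    using cQ card_orb_eq_1_iff[OF actQ Q(1)] a x(2) xW by blast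
  have Qz: "stb f Q z = stb f Q y" if "y \<in> W" "card (orb f Q y) = q" "z \<in> orb f Q y" for y z
    using small_orbit_stabilizer[OF actQ Q(1) fin(2) pq(2) Q(3)] that by blast
  \<comment> \<open>By faithfulness the stabiliser of y in Q is trivial, so Q has as many elements
    as the orbit of y.\<close>
  have finish: "card Q = q" if "y \<in> W" "card (orb f Q y) = q" "\<And>g z. g \<in> stb f Q y \<Longrightarrow> z \<in> W \<Longrightarrow> f g z = z" for y
  proof -
    have "stb f Q y = {1}" using that(3) faithful Q(2) subgrpD(1)[OF subgrp_stb[OF actQ Q(1) that(1)]] by (auto simp: stb_def)
    then show ?thesis using orbit_stabilizer[OF actQ Q(1) fin(2) that(1)] that(2) by simp
  qed
  show ?thesis
  proof (cases "p dvd card W")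
    case False
    \<comment> \<open>Without p, \<open>card W\<close> is a square-free power of q, so W is a single
      Q-orbit of length q.\<close>
    have "pi_num (- {p}) (card W)" using False m(2) N xW fW by (auto simp: pi_num_def card_gt_0_iff)
    then have "pi_num {q} (card W)"
      using pi_num_two_primes[of "{p, q}" "card W" "- {p}" q] pi_num_dvd[OF sN m(2)] by auto
    then have "card W = 1 \<or> card W = q" using squarefree_prime_power m(1) pq(2) by blast
    moreover obtain y where y: "y \<in> W" "card (orb f Q y) = q" using notriv by blast
    moreover have sub: "orb f Q y \<subseteq> W" using orb_subset[OF actQ y(1)] .
    moreover have "q \<le> card W" using card_mono[OF fW sub] y(2) by simp
    ultimately have "orb f Q y = W" using card_subset_eq[OF fW sub] pq(2) prime_gt_1_nat[of q] by auto
    then show ?thesis using finish[OF y] Qz[OF y] by (auto simp: stb_def)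
  next
    case True
    then obtain m' where m': "card W = p * m'" "\<not> p dvd m'" using squarefree_prime_mult m(1) pq(1) by blast
    have "m' > 0" using m' xW fW by (metis card_gt_0_iff empty_iff mult_is_0 gr0I)
    then have "pi_num (- {p}) m'" using m'(2) by (auto simp: pi_num_def)
    moreover have "pi_num {p, q} m'" using pi_num_dvd[OF sN] m(2) m'(1) by (metis dvd_mult_right)
    ultimately have "pi_num {q} m'" using pi_num_two_primes[of "{p, q}" m' "- {p}" q] by auto
    moreover have "squarefree m'" using m(1) m'(1) squarefree_mono[of m' "card W"] by simp
    ultimately have m'q: "m' = 1 \<or> m' = q" using squarefree_prime_power pq(2) by blast
    obtain y0 where y0: "y0 \<in> W" "card (orb f Q y0) = q" using notriv by blast
    have "q \<le> card W" using card_mono[OF fW orb_subset[OF actQ y0(1)]] y0(2) by simp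
    then have mq: "card W = p * q" using m'(1) m'q pq(3) by auto
    \<comment> \<open>\<open>card W\<close> is the index of the stabiliser of z, and this index
      divides k as soon as R lies in the stabiliser.\<close>
    have nofix: "l dvd k" if R: "subgrp R" "R \<subseteq> N" "card N = card R * k" "\<forall>g\<in>R. f g z = z" and z: "z \<in> W"
      and l: "l dvd card W" for R k l z
    proof -
      have "R \<subseteq> stb f N z" using R(2,4) by (auto simp: stb_def)
      then obtain j where "card (stb f N z) = card R * j"
        using subgrp_card_dvd[OF finite_stb[OF N(1)] subgrp_stb[OF actW N(2) z] R(1)] by (auto simp: dvd_def)
      then have "card R * k = card R * (card W * j)" using cardN[OF z] R(3) by (simp add: ac_simps)
      moreover have "card R \<noteq> 0" using R(1,2) N(1) subgrp_card_pos finite_subset by fastforce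
      ultimately have "k = card W * j" by simp
      then show ?thesis using l by simp
    qed
    have cQ': "card (orb f Q z) = q" if z: "z \<in> W" for z
    proof (rule ccontr)
      assume "card (orb f Q z) \<noteq> q"
      then have "\<forall>g\<in>Q. f g z = z" using cQ z card_orb_eq_1_iff[OF actQ Q(1) z] by blast
      then show False using nofix[OF Q(1,2) _ _ z, of "card P" q] card mq nd(1) by (simp add: mult.commute)
    qed
    have "\<exists>y\<in>W. card (orb f P y) = p"
    proof (rule exists_orbit_of_size_p[OF actP P(1) fin(1) fW pq(1) P(3) m(1)])
      fix y assume y: "y \<in> W"
      show "card (orb f P y) \<noteq> 1"
      proof
        assume "card (orb f P y) = 1"
        then have "\<forall>g\<in>P. f g y = y" using card_orb_eq_1_iff[OF actP P(1) y] by blast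
        then show False using nofix[OF P(1,2) card _ y, of p] mq nd(2) by simp
      qed
    qed
    then obtain y where y: "y \<in> W" "card (orb f P y) = p" by blast
    define P0 where "P0 = stb f P y"
    have P0: "subgrp P0" "P0 \<subseteq> P" "finite P0" using subgrp_stb[OF actP P(1) y(1)] fin(1) by (auto simp: P0_def stb_def)
    have cP: "card P = p * card P0" using orbit_stabilizer[OF actP P(1) fin(1) y(1)] y(2) by (simp add: P0_def)
    have zW: "z \<in> W" if "z \<in> orb f P y" for z using orb_subset[OF actP y(1)] that by blast
    have Pz: "stb f P z = P0" if z: "z \<in> orb f P y" for z
      unfolding P0_def using small_orbit_stabilizer[OF actP P(1) fin(1) pq(1) P(3) y z] .
    have sQ: "subgrp (stb f Q z)" "stb f Q z \<subseteq> Q" "finite (stb f Q z)" "card Q = q * card (stb f Q z)" if "z \<in> W" for z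
      using subgrp_stb[OF actQ Q(1) that] fin(2) orbit_stabilizer[OF actQ Q(1) fin(2) that] cQ' [OF that]
      by (auto simp: stb_def)
    have Nz: "stb f N z = prodset P0 (stb f Q z)" if z: "z \<in> orb f P y" for z
    proof -
      note zw = zW[OF z]
      note sq = sQ[OF zw]
      have sub: "prodset P0 (stb f Q z) \<subseteq> stb f N z"
        using prodset_subset[OF subgrp_stb[OF actW N(2) zw], of P0 "stb f Q z"] Pz[OF z] P(2) Q(2)
        by (auto simp: stb_def)
      have "P0 \<inter> stb f Q z = {1}" using PQ1 P0 sq by blast
      then have "card (prodset P0 (stb f Q z)) = card P0 * card (stb f Q z)"
        using card_prodset[OF P0(3) sq(3) P0(1) sq(1)] by simp
      moreover have "(p * q) * card (stb f N z) = (p * q) * (card P0 * card (stb f Q z))"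
        using cardN[OF zw] card cP sq(4) mq by (auto simp: ac_simps)
      then have "card (stb f N z) = card P0 * card (stb f Q z)" using pq(1,2) by (auto simp: prime_gt_0_nat)
      ultimately show ?thesis using card_subset_eq[OF _ sub] N(1) by (simp add: stb_def)
    qed
    show ?thesis
    proof (cases "\<forall>z\<in>orb f P y. stb f Q z = stb f Q y")
      case True
      show ?thesis
      proof (rule finish[OF y(1) cQ' [OF y(1)]])
        fix d w assume d: "d \<in> stb f Q y" and "w \<in> W"
        then obtain g where g: "g \<in> N" "w = f g y" using orbW[OF y(1)] by (auto simp: orb_def)
        then obtain b u where bu: "g = b * u" "b \<in> Q" "u \<in> P" using NQP by (auto simp: prodset_def)
        define z where "z = f u y"
        have z: "z \<in> orb f P y" using bu by (auto simp: z_def orb_def)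
        have "w = f b z" using g bu actsD(3)[OF actW y(1)] P(2) Q(2) by (auto simp: z_def)
        then have "w \<in> orb f Q z" using bu by (auto simp: orb_def)
        then have "stb f Q w = stb f Q z" using Qz cQ' zW[OF z] by blast
        then show "f d w = w" using d True z by (auto simp: stb_def)
      qed
    next
      case False
      then obtain z where z: "z \<in> orb f P y" and ne: "stb f Q z \<noteq> stb f Q y" by blast
      define D where "D = stb f Q y"
      define E where "E = stb f Q z"
      note sD = sQ[OF y(1), folded D_def] and sE = sQ[OF zW[OF z], folded E_def]
      have yy: "y \<in> orb f P y" using orb_self[OF actP P(1) y(1)] .
      have nD: "normal_in D Q" unfolding normal_in_def
      proof (intro conjI ballI sD(1,2))
        fix g d assume g: "g \<in> Q" and d: "d \<in> D"
        have ig: "inverse g \<in> Q" using g Q(1) by blast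
        then have "f (inverse g) y \<in> orb f Q y" by (auto simp: orb_def)
        then have "stb f Q (f (inverse g) y) = D" using Qz[OF y(1) cQ' [OF y(1)]] by (simp add: D_def)
        then have "f d (f (inverse g) y) = f (inverse g) y" using d by (auto simp: stb_def)
        moreover have "f (g * d * inverse g) y = f g (f d (f (inverse g) y))"
          using actsD(2,3)[OF actQ] y(1) g ig d sD(2) Q(1) by (metis subgrpD(2) subsetD)
        ultimately have "f (g * d * inverse g) y = y" using acts_inverse(2)[OF actQ Q(1) y(1) g] by simp
        then show "g * d * inverse g \<in> D" using g ig d sD(2) Q(1) by (auto simp: D_def stb_def)
      qed
      have DE: "prodset D E = Q"
      proof (rule ccontr)
        assume nQ: "prodset D E \<noteq> Q"
        have s: "subgrp (prodset D E)" "prodset D E \<subseteq> Q"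
          using subgrp_prodset_normal[OF nD fin(2) Q(1) sE(1,2)] prodset_subset[OF Q(1) sD(2) sE(2)] by auto
        have DsubE: "D \<subseteq> prodset D E" "E \<subseteq> prodset D E" using prodset_sup1[OF sE(1)] prodset_sup2[OF sD(1)] by blast+
        have "prodset D E = D"
          using subgrp_prime_index[OF fin(2) Q(1) sD(1) DsubE(1) s sD(4) pq(2)] nQ by blast
        then have "E \<subseteq> D" using DsubE(2) by simp
        moreover have "q * card E = q * card D" using sD(4) sE(4) by simp
        then have "card E = card D" using pq(2) by (simp add: prime_gt_0_nat)
        ultimately have "E = D" using card_subset_eq sD(3) by blast
        then show False using ne by (simp add: D_def E_def)
      qed
      define U where "U = prodset P0 Q"
      \<comment> \<open>The stabiliser of w in N is a group and equals the product of P0 and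
        \<open>stb f Q w\<close>, so these two factors may be interchanged. Doing this once for z
        and once for y moves an element of P0 across Q = DE.\<close>
      have comm: "k * h \<in> prodset P0 (stb f Q w)" if "w \<in> orb f P y" "h \<in> P0" "k \<in> stb f Q w" for w h k
      proof -
        have "h \<in> stb f N w" "k \<in> stb f N w" using that Pz[OF that(1)] P(2) Q(2) by (auto simp: stb_def)
        then have "k * h \<in> stb f N w" using subgrp_stb[OF actW N(2) zW[OF that(1)]] by blast
        then show ?thesis using Nz[OF that(1)] by simp
      qed
      have sU: "subgrp U" unfolding U_def
      proof (rule subgrp_prodset[OF P0(3) fin(2) P0(1) Q(1)])
        fix h k assume h: "h \<in> P0" and "k \<in> Q"
        then obtain d e where de: "k = d * e" "d \<in> D" "e \<in> E" using DE by (auto simp: prodset_def)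
        obtain h' e' where 1: "e * h = h' * e'" "h' \<in> P0" "e' \<in> E"
          using comm[OF z h, of e] de(3) by (auto simp: E_def prodset_def)
        obtain h'' d' where 2: "d * h' = h'' * d'" "h'' \<in> P0" "d' \<in> D"
          using comm[OF yy 1(2), of d] de(2) by (auto simp: D_def prodset_def)
        have "k * h = d * (e * h)" using de by (simp add: mult.assoc)
        also have "\<dots> = (d * h') * e'" using 1 by (simp add: mult.assoc)
        also have "\<dots> = h'' * (d' * e')" using 2 by (simp add: mult.assoc)
        finally show "k * h \<in> prodset P0 Q" using 2 1 sD(2) sE(2) Q(1) by (auto intro!: prodsetI)
      qed
      have UN: "U \<subseteq> N" "Q \<subseteq> U" using prodset_subset[OF N(2), of P0 Q] P0 P(2) Q(2) prodset_sup2[OF P0(1)] by (auto simp: U_def)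
      have "P0 \<inter> Q = {1}" using PQ1 P0 Q(1) by blast
      then have "card U = card P0 * card Q" using card_prodset[OF P0(3) fin(2) P0(1) Q(1)] by (simp add: U_def)
      then have cNU: "card N = p * card U" using card cP by simp
      have fU: "finite U" using UN N finite_subset by blast
      have "card N = card ((\<lambda>g. lcos g U) ` N) * card U" by (rule card_cosets[OF N sU UN(1)])
      then have cos: "card ((\<lambda>g. lcos g U) ` N) = p" using cNU subgrp_card_pos[OF sU fU] by (metis mult_cancel2 not_gr_zero)
      \<comment> \<open>A Q-orbit on the p cosets of U has length a power of q and at most p < q. So
        Q fixes every coset, which puts all conjugates of Q into U.\<close>
      have "Q \<subseteq> core N U"
      proof
        fix b assume b: "b \<in> Q"
        have "g * b * inverse g \<in> U" if g: "g \<in> N" for g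
        proof -
          have aQ: "acts Q ((\<lambda>g. lcos g U) ` N) lcos" by (rule acts_subset[OF acts_lcos[OF N(2)] Q(2)])
          have ig: "inverse g \<in> N" using g N(2) by blast
          then have mem: "lcos (inverse g) U \<in> (\<lambda>g. lcos g U) ` N" by blast
          have "card (orb lcos Q (lcos (inverse g) U)) \<le> p"
            using card_mono[OF _ orb_subset[OF aQ mem]] N(1) cos by simp
          moreover have "pi_num {q} (card (orb lcos Q (lcos (inverse g) U)))"
            using card_orb_dvd[OF aQ Q(1) fin(2) mem] Q(3) pi_num_dvd by blast
          ultimately have "card (orb lcos Q (lcos (inverse g) U)) = 1"
            using pi_num_prime_dvd[OF _ pq(2)] pq(3) by (metis dvd_imp_le le_trans linorder_not_le pi_num_def)
          then have "lcos b (lcos (inverse g) U) = lcos (inverse g) U"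
            using card_orb_eq_1_iff[OF aQ Q(1) mem] b by blast
          then have "inverse (inverse g) * (b * inverse g) \<in> U"
            using lcos_eq_iff[OF sU, of "inverse g" "b * inverse g"] by (simp add: lcos_mult)
          then show ?thesis by (simp add: mult.assoc)
        qed
        then show "b \<in> core N U" using b Q(2) by (auto simp: core_def)
      qed
      then have "core N U = N" using simple[OF core_normal[OF N(2) sU]] a by blast
      then have "U = N" using core_subset[OF N(2), of U] UN by auto
      then show ?thesis using cNU subgrp_card_pos[OF sU fU] prime_gt_1_nat[OF pq(1)] by simp
    qed
  qed
qed


section \<open>Groups with a compatible family of Hall subgroups\<close>

text \<open>The sets \<open>A S\<close> play the role of a Hall system; \<open>reduced N\<close> says that they all cut out Hall subgroups of \<open>N\<close>.\<close>

locale hall_family =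
  fixes A :: "nat set \<Rightarrow> 'g::group_mult set"
  assumes A_Int: "A (S \<inter> T) = A S \<inter> A T"
begin

definition reduced :: "'g set \<Rightarrow> bool" where
  "reduced N \<longleftrightarrow> finite N \<and> subgrp N \<and> (\<forall>S. hall S (N \<inter> A S) N)"

lemma A_mono: "S \<subseteq> T \<Longrightarrow> A S \<subseteq> A T"
  using A_Int[of S T] by (auto simp: Int_absorb2)

lemma reducedD:
  assumes "reduced N"
  shows "finite N" "subgrp N" "hall S (N \<inter> A S) N" "subgrp (N \<inter> A S)" "pi_num S (card (N \<inter> A S))"
    "pi_num (- S) (card N div card (N \<inter> A S))"
  using assms by (auto simp: reduced_def hall_def)

lemma reduced_index:
  assumes "reduced N" obtains i where "card N = card (N \<inter> A S) * i" "pi_num (- S) i"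
proof -
  have "card (N \<inter> A S) dvd card N" by (rule subgrp_card_dvd) (use reducedD[OF assms] in auto)
  then obtain i where i: "card N = card (N \<inter> A S) * i" by (auto simp: dvd_def)
  moreover have "card (N \<inter> A S) > 0" using reducedD(5)[OF assms] by (auto simp: pi_num_def)
  ultimately have "card N div card (N \<inter> A S) = i" by simp
  then show ?thesis using that[OF i] reducedD(6)[OF assms, of S] by metis
qed

lemma reduced_Int_dvd:
  assumes "reduced N" "prime p" "p \<in> S" "p dvd card N" shows "p dvd card (N \<inter> A S)"
proof -
  obtain i where i: "card N = card (N \<inter> A S) * i" "pi_num (- S) i" using reduced_index[OF assms(1)] .
  then have "\<not> p dvd i" using assms by (auto simp: pi_num_def)
  then show ?thesis using i assms by (simp add: prime_dvd_mult_iff)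
qed

lemma reduced_Int_eq:
  assumes "reduced N" "pi_num S (card N)" shows "N \<inter> A S = N"
  using hall_max[OF reducedD(1,2,3)[OF assms(1)] reducedD(2)[OF assms(1)]] assms by auto

lemma reduced_normal:
  assumes "reduced N" "normal_in C N" shows "reduced C"
proof -
  have "C \<subseteq> N" using assms(2) normal_inD by blast
  then have "C \<inter> (N \<inter> A S) = C \<inter> A S" for S by blast
  then show ?thesis
    using hall_normal[OF reducedD(1,2,3)[OF assms(1)] assms(2)] \<open>C \<subseteq> N\<close> reducedD(1)[OF assms(1)]
      normal_inD(1)[OF assms(2)] finite_subset by (auto simp: reduced_def)
qed

text \<open>The index of \<open>N \<inter> A (S \<inter> T)\<close> in \<open>N \<inter> A T\<close>
  is a T-number prime to \<open>S \<inter> T\<close>, hence prime to S.\<close>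

lemma reduced_Int:
  assumes "reduced N" shows "reduced (N \<inter> A T)"
  unfolding reduced_def
proof (intro conjI allI)
  fix S
  have eq: "N \<inter> A T \<inter> A S = N \<inter> A (S \<inter> T)" using A_Int[of S T] by blast
  obtain i where i: "card N = card (N \<inter> A (S \<inter> T)) * i" "pi_num (- (S \<inter> T)) i" using reduced_index[OF assms] .
  obtain j where j: "card N = card (N \<inter> A T) * j" "pi_num (- T) j" using reduced_index[OF assms] .
  note sub = reducedD(4)[OF assms]
  have "N \<inter> A (S \<inter> T) \<subseteq> N \<inter> A T" using A_mono[of "S \<inter> T" T] by blast
  then have "card (N \<inter> A (S \<inter> T)) dvd card (N \<inter> A T)"
    using subgrp_card_dvd[OF _ sub sub] reducedD(1)[OF assms] by blast
  then obtain k where k: "card (N \<inter> A T) = card (N \<inter> A (S \<inter> T)) * k" by (auto simp: dvd_def)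
  have pos: "card (N \<inter> A (S \<inter> T)) > 0" using reducedD(5)[OF assms] by (auto simp: pi_num_def)
  have "card (N \<inter> A (S \<inter> T)) * i = card (N \<inter> A (S \<inter> T)) * (k * j)" using i(1) j(1) k by (metis mult.assoc)
  then have "i = k * j" using pos by simp
  then have "pi_num (- (S \<inter> T)) k" using i(2) pi_num_dvd by (metis dvd_triv_left)
  moreover have "pi_num T k" using reducedD(5)[OF assms, of T] k pi_num_dvd by (metis dvd_triv_right)
  ultimately have "pi_num (- S) k" by (auto simp: pi_num_def)
  then have "pi_num (- S) (card (N \<inter> A T) div card (N \<inter> A (S \<inter> T)))" using k pos by simp
  moreover have "pi_num S (card (N \<inter> A (S \<inter> T)))" using pi_num_mono[OF reducedD(5)[OF assms]] by blast
  ultimately show "hall S (N \<inter> A T \<inter> A S) (N \<inter> A T)"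
    unfolding hall_def eq using sub \<open>N \<inter> A (S \<inter> T) \<subseteq> N \<inter> A T\<close> by blast
qed (use reducedD[OF assms] in auto)

lemma reduced_prodset:
  assumes "reduced N" "S \<union> T = UNIV" shows "prodset (N \<inter> A S) (N \<inter> A T) = N"
proof (rule prodset_coprime_index)
  have "- S \<inter> - T = {}" using assms(2) by blast
  then show "coprime (card N div card (N \<inter> A S)) (card N div card (N \<inter> A T))"
    by (rule pi_num_coprime[OF reducedD(6)[OF assms(1)] reducedD(6)[OF assms(1)]])
qed (use reducedD[OF assms(1)] in auto)

lemma reduced_disjoint:
  assumes "reduced N" "S \<inter> T = {}" shows "N \<inter> A S \<inter> A T = {1}"
proof -
  have "pi_num {} (card (N \<inter> A (S \<inter> T)))" using reducedD(5)[OF assms(1), of "S \<inter> T"] assms(2) by simp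
  then have "card (N \<inter> A (S \<inter> T)) = 1" using pi_num_disjoint[of "{}" _ "{}"] by blast
  then show ?thesis using subgrp_card_eq_1[OF reducedD(4)[OF assms(1)]] A_Int by (metis Int_assoc)
qed

lemma card_normal_subset:
  assumes "reduced N" "normal_in C N" "pi_num S (card C)" shows "C \<subseteq> N \<inter> A S"
  using normal_subset_hall[OF reducedD(1,2,3)[OF assms(1)] assms(2,3)] .

text \<open>A conjugate of \<open>core C (C \<inter> A S)\<close> under N is again normal in C, and
  its order is an S-number. Every such subgroup lies in the Hall subgroup
  \<open>C \<inter> A S\<close>.\<close>

lemma core_lift:
  assumes N: "reduced N" and C: "normal_in C N" and "core C (C \<inter> A S) \<noteq> {1}"
  shows "core N (N \<inter> A S) \<noteq> {1}"
proof -
  note c = normal_inD[OF C] and rC = reduced_normal[OF N C]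
  let ?T = "core C (C \<inter> A S)"
  have T: "normal_in ?T C" by (rule core_normal[OF c(1) reducedD(4)[OF rC]])
  note t = normal_inD[OF T]
  have fC: "finite C" "finite ?T" using rC reducedD t(2) finite_subset by blast+
  have "card ?T dvd card (C \<inter> A S)"
    using subgrp_card_dvd[OF _ reducedD(4)[OF rC] t(1) core_subset[OF c(1)]] fC by blast
  then have sT: "pi_num S (card ?T)" using reducedD(5)[OF rC] pi_num_dvd by blast
  have "?T \<subseteq> core N (N \<inter> A S)"
  proof
    fix k assume k: "k \<in> ?T"
    have "g * k * inverse g \<in> N \<inter> A S" if g: "g \<in> N" for g
    proof -
      let ?g = "\<lambda>x. g * x * inverse g"
      have ig: "inverse g \<in> N" using g reducedD(2)[OF N] by blast
      have "normal_in (?g ` ?T) C" unfolding normal_in_def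
      proof (intro conjI ballI)
        show "subgrp (?g ` ?T)"
        proof (rule subgrp_finiteI)
          fix a b assume "a \<in> ?g ` ?T" "b \<in> ?g ` ?T"
          then obtain x y where xy: "x \<in> ?T" "y \<in> ?T" "a = ?g x" "b = ?g y" by blast
          then have "a * b = ?g (x * y)" by (simp add: mult.assoc)
          moreover have "x * y \<in> ?T" using xy t(1) by blast
          ultimately show "a * b \<in> ?g ` ?T" by blast
        qed (use fC subgrpD(1)[OF t(1)] in \<open>auto intro: image_eqI[of _ _ 1]\<close>)
        show "?g ` ?T \<subseteq> C" using t(2) c(3) g by blast
      next
        fix d a assume d: "d \<in> C" and "a \<in> ?g ` ?T"
        then obtain x where x: "x \<in> ?T" "a = ?g x" by blast
        have "inverse g * d * inverse (inverse g) \<in> C" using c(3) ig d by blast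
        then have "(inverse g * d * g) * x * inverse (inverse g * d * g) \<in> ?T"
            using t(3)[OF _ x(1), of "inverse g * d * g"] by simp
        moreover have "d * a * inverse d = ?g ((inverse g * d * g) * x * inverse (inverse g * d * g))"
          using x by (simp add: mult.assoc)
        ultimately show "d * a * inverse d \<in> ?g ` ?T" by blast
      qed
      moreover have "card (?g ` ?T) = card ?T" by (rule card_image) (auto simp: inj_on_def)
      ultimately have "?g ` ?T \<subseteq> C \<inter> A S" using card_normal_subset[OF rC] sT by simp
      then show ?thesis using k c(2) by blast
    qed
    then show "k \<in> core N (N \<inter> A S)" using k t(2) c(2) by (auto simp: core_def)
  qed
  moreover have "1 \<in> ?T" using t(1) by blast
  ultimately show ?thesis using assms(3) by blast
qed

text \<open>Removing the smallest prime \<open>c\<close> divides an orbit length by \<open>c\<close> or leaves it unchanged: the excess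
  factor \<open>k\<close> below satisfies \<open>k \<le> c\<close> while all its prime divisors are greater than \<open>c\<close>.\<close>

lemma squarefree_orbits_ge:
  assumes N: "reduced N" "acts N X f" and sqf: "\<And>x. x \<in> X \<Longrightarrow> squarefree (card (orb f N x))" and x: "x \<in> X"
  shows "squarefree (card (orb f (N \<inter> A {c..}) x))"
proof (induction c)
  case 0
  have "pi_num {0..} (card N)" using reducedD[OF N(1)] subgrp_card_pos by (auto simp: pi_num_def)
  then show ?case using reduced_Int_eq[OF N(1)] sqf x by simp
next
  case (Suc c)
  let ?G = "N \<inter> A {c..}" and ?H = "N \<inter> A {Suc c..}"
  have "{Suc c..} \<inter> {c..} = {Suc c..}" by auto
  then have GH: "?G \<inter> A {Suc c..} = ?H" using A_Int[of "{Suc c..}" "{c..}"] by auto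
  have rG: "reduced ?G" by (rule reduced_Int[OF N(1)])
  obtain i where i: "card ?G = card ?H * i" "pi_num (- {Suc c..}) i"
    using reduced_index[OF rG, of "{Suc c..}"] unfolding GH .
  have "pi_num {c..} i" using reducedD(5)[OF N(1), of "{c..}"] i(1) pi_num_dvd by (metis dvd_triv_right)
  moreover have "- {Suc c..} \<inter> {c..} \<subseteq> {c}" by auto
  ultimately have ic: "pi_num {c} i" using pi_num_two_primes i(2) by blast
  have sub: "?H \<subseteq> ?G" using GH by blast
  note sG = reducedD(1,2)[OF rG] and sH = reducedD(1,2)[OF reduced_Int[OF N(1), of "{Suc c..}"]]
  have aG: "acts ?G X f" using acts_subset[OF N(2)] by blast
  have aH: "acts ?H X f" using acts_subset[OF N(2)] by blast
  show ?case
  proof (cases "prime c")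
    case False
    then have "i = 1" using ic by (metis (no_types, lifting) One_nat_def prime_factor_nat singletonD pi_num_def)
    then have "?H = ?G" using i(1) card_subset_eq[OF sG(1) sub] by simp
    then show ?thesis using Suc by simp
  next
    case True
    define m n where "m = card (orb f ?G x)" and "n = card (orb f ?H x)"
    have cG: "card ?G = m * card (stb f ?G x)" and cH: "card ?H = n * card (stb f ?H x)"
      unfolding m_def n_def using orbit_stabilizer[OF aG sG(2,1) x] orbit_stabilizer[OF aH sH(2,1) x] by auto
    have sS: "subgrp (stb f ?G x)" "subgrp (stb f ?H x)" using subgrp_stb[OF aG sG(2) x] subgrp_stb[OF aH sH(2) x] .
    have "card (stb f ?H x) dvd card (stb f ?G x)"
      by (rule subgrp_card_dvd[OF finite_stb[OF sG(1)] sS stb_mono[OF sub]])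
    then obtain e where e: "card (stb f ?G x) = card (stb f ?H x) * e" by (auto simp: dvd_def)
    have pos: "card (stb f ?H x) > 0" using subgrp_card_pos[OF sS(2) finite_stb[OF sH(1)]] .
    have "card (stb f ?H x) * (n * i) = card (stb f ?H x) * (m * e)" using cG cH e i(1) by (simp add: ac_simps)
    then have ni: "n * i = m * e" using pos by simp
    have "orb f ?H x \<subseteq> orb f ?G x" using orb_mono[OF sub] .
    then have nm: "n \<le> m" unfolding m_def n_def using sG(1) by (intro card_mono) (auto simp: orb_def)
    have "n > 0" unfolding n_def using orb_self[OF aH sH(2) x] sH(1) by (auto simp: card_gt_0_iff orb_def)
    have ndvd: "n dvd card ?H" using cH by simp
    \<comment> \<open>i is a power of c, so a divisor of \<open>n * i\<close> that is prime to c
      already divides n.\<close>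
    have co: "coprime l i" if "\<not> c dvd l" for l
      using pi_num_prime_power[OF ic True] that True by (metis coprime_commute coprime_power_left_iff prime_imp_coprime)
    have "squarefree m" using Suc by (simp add: m_def)
    show ?thesis
    proof (cases "c dvd m")
      case False
      then have "m dvd n" using co[OF False] ni by (metis coprime_dvd_mult_left_iff dvd_triv_left)
      then have "n = m" using nm \<open>n > 0\<close> by (meson dvd_imp_le le_antisym)
      then show ?thesis using Suc by (simp add: m_def n_def)
    next
      case dv: True
      then obtain m' where m': "m = c * m'" "\<not> c dvd m'" using squarefree_prime_mult \<open>squarefree m\<close> True by blast
      have "m' dvd n * i" using ni m'(1) by (simp add: mult.assoc)
      then have "m' dvd n" using co[OF m'(2)] coprime_dvd_mult_left_iff by blast
      then obtain k where k: "n = m' * k" by (auto simp: dvd_def)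
      have kpos: "k > 0" "m' > 0" using k \<open>n > 0\<close> by auto
      then have kc: "k \<le> c" using nm k m'(1) by (simp add: mult.commute)
      have "pi_num {Suc c..} k" using reducedD(5)[OF N(1), of "{Suc c..}"] ndvd k pi_num_dvd by (metis dvd_trans dvd_triv_right)
      then have "k = 1"
        using kc kpos prime_factor_nat[of k] by (metis (no_types, lifting) Suc_leD atLeast_iff dvd_imp_le le_trans not_less_eq_eq pi_num_def)
      then show ?thesis using k m'(1) \<open>squarefree m\<close> squarefree_mono[of m' m] by (simp add: n_def)
    qed
  qed
qed

text \<open>Let \<open>p < q\<close> be the two largest prime divisors of the order of \<open>N\<close>. If there are others, the
  \<open>{p, q}\<close>-Hall subgroup \<open>B\<close> is proper and by induction has a nontrivial core of an \<open>s\<close>-Sylow subgroup;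
  the \<open>N\<close>-conjugates of that core stay in the Hall subgroup omitting the prime of \<open>{p, q}\<close> other than \<open>s\<close>.\<close>

theorem exists_core_nontrivial:
  assumes "reduced N" "acts N X f" "\<And>g. g \<in> N \<Longrightarrow> \<forall>x\<in>X. f g x = x \<Longrightarrow> g = 1"
    and "\<And>x. x \<in> X \<Longrightarrow> squarefree (card (orb f N x))" "N \<noteq> {1}"
  shows "\<exists>p. prime p \<and> core N (N \<inter> A {p}) \<noteq> {1}"
  using assms
proof (induction "card N" arbitrary: N rule: less_induct)
  case less
  note N = reducedD[OF less.prems(1)] and act = less.prems(2) and faithful = less.prems(3) and sqf = less.prems(4)
  show ?case
  proof (rule ccontr)
    assume contra: "\<not> ?case"
    \<comment> \<open>By induction a proper nontrivial normal subgroup has a nontrivial core of a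
      Sylow subgroup, and \<open>core_lift\<close> would carry it to N.\<close>
    have simple: "C = {1} \<or> C = N" if C: "normal_in C N" for C
    proof (rule ccontr)
      assume no: "\<not> (C = {1} \<or> C = N)"
      note c = normal_inD[OF C]
      have "card C < card N" using no c(2) N(1) by (intro psubset_card_mono) auto
      moreover have "squarefree (card (orb f C x))" if "x \<in> X" for x
        using squarefree_mono[OF card_orb_normal_dvd[OF act N(1,2) C that]] sqf that by blast
      ultimately have "\<exists>p. prime p \<and> core C (C \<inter> A {p}) \<noteq> {1}"
        using less.hyps[of C] reduced_normal[OF less.prems(1) C] acts_subset[OF act c(2)] faithful c(2) no by blast
      then show False using contra core_lift[OF less.prems(1) C] by blast
    qed
    have coreN: "prime p \<Longrightarrow> core N (N \<inter> A {p}) = {1}" for p using contra by blast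
    have notp: "\<not> pi_num {p} (card N)" if p: "prime p" for p
    proof
      assume "pi_num {p} (card N)"
      then have "core N (N \<inter> A {p}) = core N N" using reduced_Int_eq[OF less.prems(1)] by simp
      also have "core N N = N" using N(2) by (auto simp: core_def)
      finally show False using coreN[OF p] less.prems(5) by simp
    qed
    have cN: "card N > 1" using subgrp_card_pos[OF N(2,1)] subgrp_card_eq_1[OF N(2)] less.prems(5) by linarith
    define F where "F = prime_factors (card N)"
    have fF: "finite F" by (simp add: F_def)
    have memF: "l \<in> F \<longleftrightarrow> prime l \<and> l dvd card N" for l using cN by (auto simp: F_def prime_factors_dvd)
    have "F \<noteq> {}" using prime_factor_nat[of "card N"] cN memF by auto
    define q where "q = Max F"
    have q: "prime q" "q dvd card N" using Max_in[OF fF \<open>F \<noteq> {}\<close>] memF by (auto simp: q_def)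
    have qmax: "l \<le> q" if "l \<in> F" for l using that fF by (simp add: q_def)
    have "F - {q} \<noteq> {}"
    proof
      assume "F - {q} = {}"
      then have "pi_num {q} (card N)" using memF cN by (auto simp: pi_num_def)
      then show False using notp q(1) by blast
    qed
    define p where "p = Max (F - {q})"
    have "p \<in> F - {q}" unfolding p_def using fF \<open>F - {q} \<noteq> {}\<close> by (intro Max_in) auto
    then have p: "prime p" "p dvd card N" "p < q" using memF qmax[of p] by auto
    have pq_only: "l = p \<or> l = q" if "l \<in> F" "p \<le> l" for l
    proof (cases "l = q")
      case False
      then have "l \<le> p" unfolding p_def using that fF by (intro Max_ge) auto
      then show ?thesis using that(2) by simp
    qed simp
    \<comment> \<open>The up-set \<open>{p..}\<close> is used instead of \<open>{p, q}\<close>: the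
      order of N has no other prime divisors in it, and \<open>squarefree_orbits_ge\<close> speaks
      of sets of this shape.\<close>
    define B where "B = N \<inter> A {p..}"
    have rB: "reduced B" unfolding B_def by (rule reduced_Int[OF less.prems(1)])
    note sB = reducedD[OF rB]
    show False
    proof (cases "B = N")
      case False
      then have "card B < card N" using N(1) by (intro psubset_card_mono) (auto simp: B_def)
      moreover have "squarefree (card (orb f B x))" if "x \<in> X" for x
        unfolding B_def by (rule squarefree_orbits_ge[OF less.prems(1) act sqf that])
      moreover have "B \<noteq> {1}"
      proof
        assume "B = {1}"
        then have "q dvd 1" using reduced_Int_dvd[OF less.prems(1) q(1) _ q(2), of "{p..}"] p(3) by (simp add: B_def)
        then show False using q(1) not_prime_unit by blast
      qed
      ultimately obtain s where s: "prime s" "core B (B \<inter> A {s}) \<noteq> {1}"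
        using less.hyps[of B] rB acts_subset[OF act, of B] faithful by (auto simp: B_def)
      let ?S = "core B (B \<inter> A {s})"
      have nS: "normal_in ?S B" by (rule core_normal[OF sB(2,4)])
      have "s dvd card B"
      proof (rule ccontr)
        assume "\<not> s dvd card B"
        then have "pi_num (- {s}) (card B)" using sB(1,2) subgrp_card_pos by (auto simp: pi_num_def)
        then have "B \<inter> A (- {s}) = B" using reduced_Int_eq[OF rB] by blast
        then have "B \<inter> A {s} = {1}" using reduced_disjoint[OF rB, of "- {s}" "{s}"] by auto
        then have "?S \<subseteq> {1}" using core_subset[OF sB(2), of "B \<inter> A {s}"] by simp
        then show False using s(2) normal_inD(1)[OF nS] by (auto simp: subgrp_def)
      qed
      then have "s dvd card N" "p \<le> s"
        using subgrp_card_dvd[OF N(1,2) sB(2)] reducedD(5)[OF less.prems(1), of "{p..}"] s(1)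
        by (auto simp: B_def pi_num_def intro: dvd_trans)
      then have spq: "s = p \<or> s = q" using pq_only memF s(1) by blast
      define t where "t = (if s = p then q else p)"
      have t: "prime t" "t dvd card N" "t \<noteq> s" "p \<le> t" using p q spq by (auto simp: t_def)
      \<comment> \<open>Every number lies in \<open>- {t}\<close> or in \<open>{p..}\<close>, so N =
        KB. For g = a * b, conjugation by b keeps the core inside \<open>A {s}\<close>, which is
        contained in \<open>A (- {t})\<close>, and conjugation by a then stays in K.\<close>
      define K where "K = N \<inter> A (- {t})"
      have KB: "prodset K B = N" unfolding K_def B_def
        by (rule reduced_prodset[OF less.prems(1)]) (use t(4) in auto)
      have sK: "subgrp K" using N(4) by (simp add: K_def)
      have "?S \<subseteq> core N K"
      proof
        fix k assume k: "k \<in> ?S"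
        have "g * k * inverse g \<in> K" if g: "g \<in> N" for g
        proof -
          have "g \<in> prodset K B" using g KB by simp
          then obtain a b where ab: "g = a * b" "a \<in> K" "b \<in> B" by (auto simp: prodset_def)
          have "b * k * inverse b \<in> B \<inter> A {s}" using k ab(3) by (auto simp: core_def)
          moreover have "A {s} \<subseteq> A (- {t})" using t(3) by (intro A_mono) auto
          ultimately have "b * k * inverse b \<in> K" by (auto simp: K_def B_def)
          then have "a * (b * k * inverse b) * inverse a \<in> K" using ab(2) sK by blast
          then show ?thesis using ab(1) by (simp add: mult.assoc)
        qed
        then show "k \<in> core N K" using k normal_inD(2)[OF nS] by (auto simp: core_def B_def)
      qed
      moreover have "1 \<in> ?S" using normal_inD(1)[OF nS] by blast
      ultimately have "core N K \<noteq> {1}" using s(2) by blast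
      then have "core N K = N" using simple[OF core_normal[OF N(2) sK]] by blast
      then have "K = N" using core_subset[OF N(2), of K] by (auto simp: K_def)
      then have "pi_num (- {t}) (card N)" using N(5)[of "- {t}"] by (simp add: K_def)
      then show False using t by (auto simp: pi_num_def)
    next
      case True
      have sN: "pi_num {p, q} (card N)"
      proof -
        have "pi_num {p..} (card N)" using N(5)[of "{p..}"] True by (simp add: B_def)
        then show ?thesis using pq_only memF by (auto simp: pi_num_def)
      qed
      define P Q where "P = N \<inter> A {p}" and "Q = N \<inter> A {q}"
      \<comment> \<open>Writing Q as the Hall subgroup of an up-set makes
        \<open>squarefree_orbits_ge\<close> applicable to it.\<close>
      have Q': "Q = N \<inter> A {Suc p..}"
      proof -
        have "card (N \<inter> A {Suc p..}) dvd card N" using subgrp_card_dvd[OF N(1,2,4)] by blast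
        then have "pi_num {q} (card (N \<inter> A {Suc p..}))"
          using pi_num_two_primes[OF pi_num_dvd[OF sN], of _ "{Suc p..}" q] N(5)[of "{Suc p..}"] by fastforce
        moreover have "Q \<subseteq> N \<inter> A {Suc p..}" unfolding Q_def using A_mono[of "{q}" "{Suc p..}"] p(3) by auto
        ultimately have "N \<inter> A {Suc p..} = Q"
          unfolding Q_def using hall_max[OF N(1,2,3) N(4)] by blast
        then show ?thesis by simp
      qed
      obtain i where i: "card N = card Q * i" "pi_num (- {q}) i" using reduced_index[OF less.prems(1)] unfolding Q_def .
      obtain j where j: "card N = card P * j" "pi_num (- {p}) j" using reduced_index[OF less.prems(1)] unfolding P_def .
      have PQ: "pi_num {p} (card P)" "pi_num {q} (card Q)" using N(5) by (auto simp: P_def Q_def)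
      have NPQ: "prodset P Q = N"
      proof (rule prodset_coprime_index[OF N(1,2)])
        have "pi_num {q} j"
          using pi_num_two_primes[of "{p, q}" j "- {p}" q] pi_num_dvd[OF sN, of j] j by auto
        then have "coprime j i" using pi_num_coprime i(2) by (metis Compl_disjoint)
        moreover have "card P > 0" "card Q > 0" using PQ by (auto simp: pi_num_def)
        ultimately show "coprime (card N div card P) (card N div card Q)"
          using i(1) j(1) by (metis nonzero_mult_div_cancel_left not_gr_zero)
      qed (use N in \<open>auto simp: P_def Q_def\<close>)
      have "P \<inter> Q = {1}" using reduced_disjoint[OF less.prems(1), of "{p}" "{q}"] p(3) by (auto simp: P_def Q_def)
      moreover have fPQ: "finite P" "finite Q" "subgrp P" "subgrp Q" "P \<subseteq> N" "Q \<subseteq> N" using N by (auto simp: P_def Q_def)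
      ultimately have card: "card N = card P * card Q" using card_prodset[OF fPQ(1-4)] NPQ by simp
      have Q1: "Q \<noteq> {1}"
      proof
        assume "Q = {1}"
        then have "q dvd 1" using reduced_Int_dvd[OF less.prems(1) q(1) _ q(2), of "{q}"] by (simp add: Q_def)
        then show False using q(1) not_prime_unit by blast
      qed
      have "squarefree (card (orb f Q x))" if "x \<in> X" for x
        unfolding Q' by (rule squarefree_orbits_ge[OF less.prems(1) act sqf that])
      then have cQ: "card Q = q"
        using sylow_card_of_simple[OF N(1,2) fPQ(3,5) PQ(1) fPQ(4,6) PQ(2) Q1 card p(1) q(1) p(3) simple act faithful sqf]
        by blast
      have "normal_in Q N"
        by (rule normal_in_of_index_prime_pow[OF N(1,2) fPQ(3,5) PQ(1) fPQ(4,6) cQ p(1) q(1)])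
          (use p(3) card cQ coreN[OF p(1)] in \<open>auto simp: P_def\<close>)
      then have "Q \<subseteq> core N Q" using fPQ(6) by (auto simp: core_def normal_in_def)
      then show False using coreN[OF q(1)] Q1 subgrpD(1)[OF fPQ(4)] by (auto simp: Q_def)
    qed
  qed
qed

end

subsection \<open>Finite left braces\<close>

text \<open>Cauchy's theorem, obtained from Sylow's: a prime divisor of the order is the order of
  some x, so it divides every exponent that kills x.\<close>

lemma pi_num_order_of_exponents:
  assumes M: "group M" "finite (carrier M)"
    and exps: "\<And>x. x \<in> carrier M \<Longrightarrow> \<exists>n. pi_num S n \<and> x [^]\<^bsub>M\<^esub> n = \<one>\<^bsub>M\<^esub>"
  shows "pi_num S (Coset.order M)"
  unfolding pi_num_def
proof (intro conjI allI impI)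
  interpret group M by (rule M)
  show "Coset.order M > 0" using M(2) by (simp add: order_gt_0_iff_finite)
  fix p assume p: "prime p" "p dvd Coset.order M"
  then obtain m where "Coset.order M = p ^ 1 * m" by (auto simp: dvd_def)
  then obtain H where H: "subgroup H M" "card H = p ^ 1" using sylow_thm[OF p(1) M(1) _ M(2)] by blast
  have "H \<noteq> {\<one>\<^bsub>M\<^esub>}" using H(2) p(1) by auto
  then obtain x where x: "x \<in> H" "x \<noteq> \<one>\<^bsub>M\<^esub>" using subgroup.one_closed[OF H(1)] by blast
  then have xM: "x \<in> carrier M" using subgroup.subset[OF H(1)] by blast
  interpret H: group "M\<lparr>carrier := H\<rparr>" by (rule subgroup.subgroup_is_group[OF H(1) M(1)])
  have "x [^]\<^bsub>M\<lparr>carrier := H\<rparr>\<^esub> Coset.order (M\<lparr>carrier := H\<rparr>) = \<one>\<^bsub>M\<lparr>carrier := H\<rparr>\<^esub>"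
    by (rule H.pow_order_eq_1) (use x in simp)
  then have "x [^]\<^bsub>M\<^esub> p = \<one>\<^bsub>M\<^esub>" using H(2) by (simp add: Coset.order_def nat_pow_def)
  then have "ord x dvd p" using pow_eq_id[OF xM] by simp
  then have "ord x = p" using p(1) x(2) ord_eq_1[OF xM] by (metis prime_nat_iff)
  moreover obtain n where n: "pi_num S n" "x [^]\<^bsub>M\<^esub> n = \<one>\<^bsub>M\<^esub>" using exps[OF xM] by blast
  ultimately have "p dvd n" using pow_eq_id[OF xM] by blast
  then show "p \<in> S" using n(1) p(1) by (auto simp: pi_num_def)
qed

text \<open>The group multiplication is the circle operation of the brace. The sum is recovered as
  \<open>a + b = a \<circ> \<lambda>\<^sub>a\<inverse>(b)\<close>, and the last two axioms express its commutativity and its invariance under \<open>\<lambda>\<close>.\<close>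

locale brace =
  fixes G :: "'g::group_mult set" and lam :: "'g \<Rightarrow> 'g \<Rightarrow> 'g"
  assumes finG: "finite G" and subG: "subgrp G"
    and lam_closed: "\<lbrakk>a \<in> G; b \<in> G\<rbrakk> \<Longrightarrow> lam a b \<in> G"
    and lam_one: "b \<in> G \<Longrightarrow> lam 1 b = b"
    and lam_mult: "\<lbrakk>a \<in> G; b \<in> G; c \<in> G\<rbrakk> \<Longrightarrow> lam (a * b) c = lam a (lam b c)"
    and sum_commute: "\<lbrakk>a \<in> G; b \<in> G\<rbrakk> \<Longrightarrow> a * lam (inverse a) b = b * lam (inverse b) a"
    and lam_distrib: "\<lbrakk>a \<in> G; b \<in> G; c \<in> G\<rbrakk> \<Longrightarrow>
      lam c (a * lam (inverse a) b) = lam c a * lam (inverse (lam c a)) (lam c b)"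
begin

definition bsum :: "'g \<Rightarrow> 'g \<Rightarrow> 'g" (infixl \<open>+\<^sub>b\<close> 65) where
  "a +\<^sub>b b = a * lam (inverse a) b"

lemma one_G: "1 \<in> G" and mult_G: "a \<in> G \<Longrightarrow> b \<in> G \<Longrightarrow> a * b \<in> G" and inverse_G: "a \<in> G \<Longrightarrow> inverse a \<in> G"
  using subG by auto

lemma acts_lam: "acts G G lam"
  using lam_closed lam_one lam_mult by (auto simp: acts_def)

lemma lam_inverse:
  assumes "a \<in> G" "b \<in> G" shows "lam (inverse a) (lam a b) = b" "lam a (lam (inverse a) b) = b"
  using acts_inverse[OF acts_lam subG assms(2,1)] .

text \<open>For x = \<open>lam a 1\<close>, distributivity gives x + x = x and commutativity gives x
  + 1 = x. So \<open>lam (inverse x)\<close> sends both x and 1 to 1, and it is injective.\<close>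

lemma lam_one_right: assumes "a \<in> G" shows "lam a 1 = 1"
proof -
  define x where "x = lam a 1"
  have x: "x \<in> G" "inverse x \<in> G" using lam_closed assms one_G inverse_G by (auto simp: x_def)
  have "x * lam (inverse x) x = x * 1"
    using lam_distrib[OF one_G one_G assms] by (simp add: lam_one one_G x_def)
  then have 1: "lam (inverse x) x = 1" by (simp only: group_left_cancel)
  have "x * lam (inverse x) 1 = x * 1"
    using sum_commute[OF one_G x(1)] by (simp add: lam_one x)
  then have 2: "lam (inverse x) 1 = 1" by (simp only: group_left_cancel)
  show ?thesis using lam_inverse(2)[OF x(1) x(1)] lam_inverse(2)[OF x(1) one_G] 1 2 by (simp add: x_def)
qed

lemma bsum_G: "a \<in> G \<Longrightarrow> b \<in> G \<Longrightarrow> a +\<^sub>b b \<in> G"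
  by (simp add: bsum_def mult_G lam_closed inverse_G)

lemma bsum_commute: "a \<in> G \<Longrightarrow> b \<in> G \<Longrightarrow> a +\<^sub>b b = b +\<^sub>b a"
  by (simp add: bsum_def sum_commute)

lemma lam_bsum: "a \<in> G \<Longrightarrow> b \<in> G \<Longrightarrow> c \<in> G \<Longrightarrow> lam c (a +\<^sub>b b) = lam c a +\<^sub>b lam c b"
  by (simp add: bsum_def lam_distrib)

lemma mult_eq_bsum: "a \<in> G \<Longrightarrow> b \<in> G \<Longrightarrow> a * b = a +\<^sub>b lam a b"
  by (simp add: bsum_def lam_inverse)

text \<open>Associativity is additivity of \<open>lam (inverse a)\<close>: both sides are a times
  the image of \<open>b +\<^sub>b c\<close> under this map.\<close>

lemma bsum_assoc:
  assumes "a \<in> G" "b \<in> G" "c \<in> G" shows "(a +\<^sub>b b) +\<^sub>b c = a +\<^sub>b (b +\<^sub>b c)"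
proof -
  let ?b = "lam (inverse a) b"
  have b: "?b \<in> G" "inverse a \<in> G" "inverse ?b \<in> G" using assms lam_closed inverse_G by auto
  have "(a +\<^sub>b b) +\<^sub>b c = a * (?b * lam (inverse ?b * inverse a) c)"
    by (simp add: bsum_def mult.assoc)
  also have "\<dots> = a * (?b * lam (inverse ?b) (lam (inverse a) c))"
    using lam_mult[OF b(3,2) assms(3)] by simp
  also have "\<dots> = a * (?b +\<^sub>b lam (inverse a) c)"
    by (simp add: bsum_def)
  also have "\<dots> = a * lam (inverse a) (b +\<^sub>b c)"
    using lam_bsum assms b by simp
  finally show ?thesis by (simp add: bsum_def)
qed

lemma bsum_one: "a \<in> G \<Longrightarrow> 1 +\<^sub>b a = a" "a \<in> G \<Longrightarrow> a +\<^sub>b 1 = a"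
  by (simp_all add: bsum_def lam_one lam_one_right inverse_G)

lemma bsum_left_cancel: "a \<in> G \<Longrightarrow> b \<in> G \<Longrightarrow> c \<in> G \<Longrightarrow> a +\<^sub>b b = a +\<^sub>b c \<longleftrightarrow> b = c"
  unfolding bsum_def by (metis group_left_cancel inverse_G lam_inverse(2))

lemma bsum_minus:
  assumes "a \<in> G" shows "lam a (inverse a) \<in> G" "lam a (inverse a) +\<^sub>b a = 1"
proof -
  show *: "lam a (inverse a) \<in> G" using assms lam_closed inverse_G by blast
  have "a +\<^sub>b lam a (inverse a) = a * inverse a" using mult_eq_bsum[OF assms inverse_G[OF assms]] by simp
  then show "lam a (inverse a) +\<^sub>b a = 1" using bsum_commute[OF assms *] by simp
qed

section \<open>The additive group and its primary parts\<close>

definition Ad :: "'g monoid" where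
  "Ad = \<lparr>carrier = G, monoid.mult = (+\<^sub>b), one = 1\<rparr>"

lemma Ad_simps [simp]: "carrier Ad = G" "a \<otimes>\<^bsub>Ad\<^esub> b = a +\<^sub>b b" "\<one>\<^bsub>Ad\<^esub> = 1"
  by (simp_all add: Ad_def)

sublocale Ad: comm_group Ad
proof (rule comm_groupI)
  fix a assume a: "a \<in> carrier Ad"
  show "\<exists>b\<in>carrier Ad. b \<otimes>\<^bsub>Ad\<^esub> a = \<one>\<^bsub>Ad\<^esub>" using bsum_minus[of a] a by auto
qed (auto simp: bsum_G bsum_assoc bsum_one one_G intro: bsum_commute)

lemma lam_pow: "a \<in> G \<Longrightarrow> b \<in> G \<Longrightarrow> lam a (b [^]\<^bsub>Ad\<^esub> (n::nat)) = lam a b [^]\<^bsub>Ad\<^esub> n"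
proof (induction n)
  case (Suc n)
  have "b [^]\<^bsub>Ad\<^esub> n \<in> G" using Ad.nat_pow_closed[of b n] Suc.prems by simp
  then show ?case using Suc by (simp add: lam_bsum)
qed (simp add: lam_one_right)

definition part :: "nat set \<Rightarrow> 'g set" where
  "part S = {a \<in> G. pi_num S (Ad.ord a)}"

lemma partI: "a \<in> G \<Longrightarrow> pi_num S n \<Longrightarrow> a [^]\<^bsub>Ad\<^esub> n = 1 \<Longrightarrow> a \<in> part S"
  using Ad.pow_eq_id[of a n] by (auto simp: part_def intro: pi_num_dvd)

lemma partE: assumes "a \<in> part S" obtains n where "a \<in> G" "pi_num S n" "a [^]\<^bsub>Ad\<^esub> n = 1"
  using assms that[of "Ad.ord a"] Ad.pow_ord_eq_1[of a] by (auto simp: part_def)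

lemma part_G: "part S \<subseteq> G" by (auto simp: part_def)

lemma one_part: "1 \<in> part S"
  by (rule partI[of _ _ 1]) (simp_all add: one_G bsum_one)

lemma bsum_part: assumes "a \<in> part S" "b \<in> part S" shows "a +\<^sub>b b \<in> part S"
proof -
  obtain m where m: "a \<in> G" "pi_num S m" "a [^]\<^bsub>Ad\<^esub> m = 1" using partE[OF assms(1)] .
  obtain n where n: "b \<in> G" "pi_num S n" "b [^]\<^bsub>Ad\<^esub> n = 1" using partE[OF assms(2)] .
  have "a [^]\<^bsub>Ad\<^esub> (m * n) = 1" using m Ad.nat_pow_pow[of a m n] Ad.nat_pow_one[of n] by simp
  moreover have "b [^]\<^bsub>Ad\<^esub> (m * n) = 1"
    using n Ad.nat_pow_pow[of b n m] Ad.nat_pow_one[of m] by (simp add: mult.commute)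
  ultimately have "(a +\<^sub>b b) [^]\<^bsub>Ad\<^esub> (m * n) = 1"
    using Ad.nat_pow_distrib[of a b "m * n"] m n bsum_one one_G by simp
  then show ?thesis using partI pi_num_mult m n bsum_G by blast
qed

lemma lam_part: assumes "g \<in> G" "a \<in> part S" shows "lam g a \<in> part S"
proof -
  obtain m where m: "a \<in> G" "pi_num S m" "a [^]\<^bsub>Ad\<^esub> m = 1" using partE[OF assms(2)] .
  then have "lam g a [^]\<^bsub>Ad\<^esub> m = 1" using lam_pow[OF assms(1) m(1), of m] lam_one_right assms(1) by simp
  then show ?thesis using partI m lam_closed assms(1) by blast
qed

lemma subgrp_part: "subgrp (part S)"
proof (rule subgrp_finiteI)
  fix a b assume "a \<in> part S" "b \<in> part S"
  then show "a * b \<in> part S" using mult_eq_bsum bsum_part lam_part part_G by (metis subsetD)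
qed (use one_part finite_subset[OF part_G finG] in auto)

lemma part_Int: "part (S \<inter> T) = part S \<inter> part T"
  by (auto simp: part_def pi_num_def)

sublocale hall_family part
  by unfold_locales (rule part_Int)

lemma pi_num_card_part: "pi_num S (card (part S))"
proof -
  have sub: "subgroup (part S) Ad"
  proof (rule Ad.subgroupI)
    fix a assume a: "a \<in> part S"
    then have "inv\<^bsub>Ad\<^esub> a = lam a (inverse a)"
      using part_G bsum_minus[of a] by (intro Ad.inv_equality) auto
    also have "\<dots> \<in> part S" using a subgrp_part lam_part part_G by blast
    finally show "inv\<^bsub>Ad\<^esub> a \<in> part S" .
  qed (use part_G[of S] one_part[of S] bsum_part[of _ S] in auto)
  have "pi_num S (Coset.order (Ad\<lparr>carrier := part S\<rparr>))"
  proof (rule pi_num_order_of_exponents[OF subgroup.subgroup_is_group[OF sub Ad.is_group]])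
    fix x assume "x \<in> carrier (Ad\<lparr>carrier := part S\<rparr>)"
    then obtain n where "pi_num S n" "x [^]\<^bsub>Ad\<^esub> n = 1" using partE[of x S] by auto
    then show "\<exists>n. pi_num S n \<and> x [^]\<^bsub>Ad\<lparr>carrier := part S\<rparr>\<^esub> n = \<one>\<^bsub>Ad\<lparr>carrier := part S\<rparr>\<^esub>"
      by (auto simp: nat_pow_def)
  qed (use finite_subset[OF part_G finG] in simp)
  then show ?thesis by (simp add: Coset.order_def)
qed

lemma part_decomp:
  assumes "a \<in> G" obtains b c where "b \<in> part S" "c \<in> part (- S)" "a = b +\<^sub>b c"
proof -
  have "Ad.ord a > 0" using Ad.ord_ge_1[of a] assms finG by simp
  then obtain u v where uv: "Ad.ord a = u * v" "pi_num S u" "pi_num (- S) v" using pi_num_split by blast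
  then have "u \<noteq> 0" "gcd u v = 1" using pi_num_coprime[OF uv(2,3)] by (auto simp: pi_num_def)
  then obtain x y where xy: "u * x = v * y + 1" using bezout_nat[of u v] by auto
  \<comment> \<open>Written additively, c = (u x) a = (v y) a + a = b + a, so a = c - b, where b is
    killed by u and c by v.\<close>
  define b c where "b = a [^]\<^bsub>Ad\<^esub> (v * y)" and "c = a [^]\<^bsub>Ad\<^esub> (u * x)"
  have bc: "b \<in> G" "c \<in> G" using Ad.nat_pow_closed[of a] assms by (auto simp: b_def c_def)
  have ca: "c = b +\<^sub>b a" using xy by (simp add: b_def c_def)
  have "b [^]\<^bsub>Ad\<^esub> u = a [^]\<^bsub>Ad\<^esub> (Ad.ord a * y)"
    using assms uv(1) by (simp add: b_def Ad.nat_pow_pow ac_simps)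
  also have "\<dots> = 1" using Ad.pow_eq_id[of a "Ad.ord a * y"] assms by simp
  finally have b: "b \<in> part S" using partI bc uv(2) by blast
  have "c [^]\<^bsub>Ad\<^esub> v = a [^]\<^bsub>Ad\<^esub> (Ad.ord a * x)"
    using assms uv(1) by (simp add: c_def Ad.nat_pow_pow ac_simps)
  also have "\<dots> = 1" using Ad.pow_eq_id[of a "Ad.ord a * x"] assms by simp
  finally have c: "c \<in> part (- S)" using partI bc uv(3) by blast
  define b' where "b' = lam b (inverse b)"
  have b': "b' \<in> part S" using b subgrp_part lam_part part_G unfolding b'_def by blast
  have "b' +\<^sub>b b = 1" "b' \<in> G" using bsum_minus[OF bc(1)] by (auto simp: b'_def)
  then have "a = b' +\<^sub>b c" using ca bsum_assoc[of b' b a] bc assms bsum_one by simp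
  then show ?thesis using that b' c by blast
qed

lemma prodset_part: "prodset (part S) (part (- S)) = G"
proof (intro equalityI subsetI)
  fix a assume "a \<in> G"
  then obtain b c where bc: "b \<in> part S" "c \<in> part (- S)" "a = b +\<^sub>b c" using part_decomp by blast
  moreover have "lam (inverse b) c \<in> part (- S)" using bc lam_part part_G inverse_G by blast
  ultimately show "a \<in> prodset (part S) (part (- S))" unfolding bsum_def by (auto intro: prodsetI)
qed (use prodset_subset[OF subG part_G part_G] in blast)

lemma part_disjoint: "part S \<inter> part (- S) = {1}"
proof -
  have "a = 1" if "a \<in> part S" "a \<in> part (- S)" for a
  proof -
    have "Ad.ord a = 1" using that pi_num_disjoint[of S _ "- S"] by (auto simp: part_def)
    then show ?thesis using Ad.ord_eq_1[of a] that part_G by auto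
  qed
  then show ?thesis using one_part by blast
qed

lemma reduced_G: "reduced G"
  unfolding reduced_def
proof (intro conjI allI finG subG)
  fix S
  have GS: "G \<inter> part S = part S" using part_G by blast
  have fin: "finite (part T)" for T using finite_subset[OF part_G finG] .
  have "card G = card (part S) * card (part (- S))"
    using card_prodset[OF fin fin subgrp_part subgrp_part, of S "- S"] by (simp add: prodset_part part_disjoint)
  moreover have "card (part S) > 0" using pi_num_card_part[of S] by (simp add: pi_num_def)
  ultimately have "card G div card (part S) = card (part (- S))" by simp
  then show "hall S (G \<inter> part S) G"
    unfolding hall_def GS using subgrp_part part_G pi_num_card_part[of S] pi_num_card_part[of "- S"] by simp
qed

lemma G_part: "G \<inter> part S = part S" using part_G by blast

lemma part_mult_unique:
  assumes "h * u = h' * u'" "h \<in> part S" "h' \<in> part S" "u \<in> part (- S)" "u' \<in> part (- S)"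
  shows "h = h'" "u = u'"
proof -
  have "inverse h' * (h * u) * inverse u = inverse h' * (h' * u') * inverse u" using assms(1) by simp
  then have "inverse h' * h = u' * inverse u" by (simp add: mult.assoc)
  moreover have "inverse h' * h \<in> part S" "u' * inverse u \<in> part (- S)" using assms(2-5) subgrp_part by blast+
  ultimately have "inverse h' * h = 1" using part_disjoint[of S] by auto
  then have "h' * (inverse h' * h) = h'" by simp
  then show "h = h'" by simp
  then show "u = u'" using assms(1) by simp
qed

lemma part_bsum_unique:
  assumes "h +\<^sub>b u = h' +\<^sub>b u'" "h \<in> part S" "h' \<in> part S" "u \<in> part (- S)" "u' \<in> part (- S)"
  shows "h = h'" "u = u'"
proof -
  have G: "h \<in> G" "h' \<in> G" "u \<in> G" "u' \<in> G" using assms part_G by blast+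
  have "h * lam (inverse h) u = h' * lam (inverse h') u'" using assms(1) by (simp add: bsum_def)
  then show "h = h'" by (rule part_mult_unique) (use assms G lam_part inverse_G in auto)
  then show "u = u'" using assms(1) bsum_left_cancel G by blast
qed

text \<open>Both sides are the sum of u and \<open>lam u h\<close>, expanded once from each
  summand.\<close>

lemma mult_swap:
  assumes "u \<in> G" "h \<in> G" shows "u * h = lam u h * lam (inverse (lam u h)) u"
  using mult_eq_bsum[OF assms] bsum_commute[OF assms(1) lam_closed[OF assms]] by (simp add: bsum_def)

text \<open>In other words, the fixed points of \<open>part S\<close> in \<open>part (- S)\<close> are exactly the elements normalising \<open>part S\<close>.\<close>

lemma lam_fix_iff:
  assumes u: "u \<in> part S" and h: "h \<in> part (- S)"
  shows "lam u h = h \<longleftrightarrow> inverse h * u * h \<in> part S"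
proof -
  have G: "u \<in> G" "h \<in> G" using assms part_G by blast+
  have lh: "lam u h \<in> part (- S)" using h lam_part G by blast
  then have lu: "lam (inverse (lam u h)) u \<in> part S" using u lam_part part_G inverse_G by blast
  have eq: "u * h = lam u h * lam (inverse (lam u h)) u" using mult_swap G by simp
  show ?thesis
  proof
    assume "lam u h = h"
    then have "inverse h * u * h = lam (inverse h) u" using eq by (simp add: mult.assoc)
    then show "inverse h * u * h \<in> part S" using lu \<open>lam u h = h\<close> by simp
  next
    assume *: "inverse h * u * h \<in> part S"
    have "h * (inverse h * u * h) = lam u h * lam (inverse (lam u h)) u" using eq by (simp add: mult.assoc)
    \<comment> \<open>The element \<open>u * h\<close> has only one factorisation with first factor
      in \<open>part (- S)\<close> and second factor in \<open>part S\<close>.\<close>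
    then have "h = lam u h" by (rule part_mult_unique(1) [where S = "- S"]) (use h lh * lu in auto)
    then show "lam u h = h" by simp
  qed
qed

text \<open>Normality keeps the conjugate of k in K, hence in \<open>part S\<close>, and
  \<open>lam_fix_iff\<close> applies.\<close>

lemma lam_fix_normal:
  assumes "normal_in K G" "K \<subseteq> part S" "k \<in> K" "h \<in> part (- S)" shows "lam k h = h"
  using lam_fix_iff[of k S h] normal_in_conj[OF assms(1) subG, of h k] assms part_G by blast

text \<open>This is the cycle set law for \<open>lam\<close>. By \<open>mult_swap\<close> the
  hypothesis on w says that \<open>a * b = lam a b * w\<close>.\<close>

lemma lam_sub_brace_relation:
  assumes "a \<in> G" "b \<in> G" "c \<in> G" "w \<in> G" "lam (lam a b) w = a"
  shows "lam a (lam b c) = lam (lam a b) (lam w c)"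
proof -
  have ab: "lam a b \<in> G" using lam_closed assms by blast
  have "w = lam (inverse (lam a b)) a" using lam_inverse(1)[OF ab assms(4)] assms(5) by simp
  then have "a * b = lam a b * w" using mult_swap assms by simp
  then show ?thesis using lam_mult[OF assms(1-3)] lam_mult[OF ab assms(4,3)] by simp
qed

end


subsection \<open>Braces acting transitively on sets of square-free cardinality\<close>

text \<open>Abstract form of the permutation brace of a solution, with \<open>emb x\<close> in the
  role of sigma_x. The assumption \<open>generate\<close> is additive generation by the
  \<open>emb x\<close>, stated as an induction principle; in a finite group sums without negatives
  suffice.\<close>

locale brace_set = brace G lam
  for G :: "'g::group_mult set" and lam +
  fixes X :: "'x set" and act :: "'g \<Rightarrow> 'x \<Rightarrow> 'x" and emb :: "'x \<Rightarrow> 'g"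
  assumes finX: "finite X" and act: "acts G X act"
    and emb_G: "x \<in> X \<Longrightarrow> emb x \<in> G"
    and emb_act: "g \<in> G \<Longrightarrow> x \<in> X \<Longrightarrow> emb (act g x) = lam g (emb x)"
    and generate: "V \<subseteq> G \<Longrightarrow> 1 \<in> V \<Longrightarrow> (\<And>a x. a \<in> V \<Longrightarrow> x \<in> X \<Longrightarrow> a +\<^sub>b emb x \<in> V) \<Longrightarrow> V = G"
    and transitive: "x \<in> X \<Longrightarrow> orb act G x = X"
    and faithful: "g \<in> G \<Longrightarrow> \<forall>x\<in>X. act g x = x \<Longrightarrow> g = 1"
    and X_ne: "X \<noteq> {}"
    and X_sqf: "squarefree (card X)"
begin

lemma fin_part: "finite (part S)" using finite_subset[OF part_G finG] .

lemma acts_part: "acts (part S) X act" by (rule acts_subset[OF act part_G])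

lemma obtain_fixed_component:
  assumes p: "prime p" and core: "core G (part {p}) \<noteq> {1}"
  obtains x h u where "x \<in> X" "h \<in> part (- {p})" "u \<in> part {p}" "emb x = h +\<^sub>b u"
    "\<And>w. w \<in> part {p} \<Longrightarrow> lam w h = h" "p dvd card X"
proof -
  let ?P = "part {p}"
  define K where "K = core G ?P"
  have K: "normal_in K G" "K \<subseteq> ?P"
    unfolding K_def using core_normal[OF subG subgrp_part] core_subset[OF subG] by auto
  note k = normal_inD[OF K(1)]
  have fK: "finite K" using K(2) fin_part finite_subset by blast
  have aK: "acts K X act" by (rule acts_subset[OF act k(2)])
  have "pi_num {p} (card K)"
    using subgrp_card_dvd[OF fin_part subgrp_part k(1) K(2)] pi_num_card_part pi_num_dvd by blast
  \<comment> \<open>Since K is normal and G is transitive, a single fixed point of K would make K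
    act trivially.\<close>
  have dvdK: "p dvd card (orb act K x)" if x: "x \<in> X" for x
  proof -
    have "card (orb act K x) \<noteq> 1"
    proof
      assume "card (orb act K x) = 1"
      then have fix_x: "\<forall>k\<in>K. act k x = x" using card_orb_eq_1_iff[OF aK k(1) x] by blast
      have "k = 1" if kK: "k \<in> K" for k
      proof (rule faithful)
        show "k \<in> G" using kK k(2) by blast
        show "\<forall>y\<in>X. act k y = y"
        proof
          fix y assume "y \<in> X"
          then obtain g where g: "g \<in> G" "y = act g x" using transitive[OF x] by (auto simp: orb_def)
          have "inverse g * k * g \<in> K" using normal_in_conj[OF K(1) subG g(1) kK] .
          then have "act (inverse g * k * g) x = x" using fix_x by blast
          moreover have "act (g * (inverse g * k * g)) x = act g (act (inverse g * k * g) x)"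
            using actsD(3)[OF act x] g(1) \<open>inverse g * k * g \<in> K\<close> k(2) by blast
          moreover have "g * (inverse g * k * g) = k * g" by (simp add: mult.assoc)
          ultimately have "act (k * g) x = act g x" by simp
          then show "act k y = y" using actsD(3)[OF act x] g kK k(2) by auto
        qed
      qed
      then show False using core k(1) unfolding K_def by (auto simp: subgrp_def)
    qed
    then show ?thesis
      using pi_num_prime_dvd[OF pi_num_dvd[OF \<open>pi_num {p} (card K)\<close> card_orb_dvd[OF aK k(1) fK x]] p] by blast
  qed
  obtain x0 where x0: "x0 \<in> X" using X_ne by blast
  have pX: "p dvd card X"
    using dvdK[OF x0] card_orb_normal_dvd[OF act finG subG K(1) x0] transitive[OF x0] by (metis dvd_trans)
  have sub: "orb act K x \<subseteq> orb act ?P x" for x using orb_mono[OF K(2)] .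
  have "\<exists>x\<in>X. card (orb act ?P x) = p"
  proof (rule exists_orbit_of_size_p[OF acts_part subgrp_part fin_part finX p pi_num_card_part X_sqf])
    fix y assume y: "y \<in> X"
    have "p \<le> card (orb act K y)"
      using dvdK[OF y] orb_self[OF aK k(1) y] fK by (intro dvd_imp_le) (auto simp: card_gt_0_iff orb_def)
    also have "\<dots> \<le> card (orb act ?P y)" using sub fin_part by (intro card_mono) (auto simp: orb_def)
    finally show "card (orb act ?P y) \<noteq> 1" using prime_gt_1_nat[OF p] by simp
  qed
  then obtain x where x: "x \<in> X" "card (orb act ?P x) = p" by blast
  have "finite (orb act ?P x)" using fin_part by (simp add: orb_def)
  moreover have "p \<le> card (orb act K x)"
    using dvdK[OF x(1)] orb_self[OF aK k(1) x(1)] fK by (intro dvd_imp_le) (auto simp: card_gt_0_iff orb_def)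
  ultimately have eq: "orb act K x = orb act ?P x" using sub x(2) by (intro card_seteq) auto
  obtain u h where uh: "u \<in> ?P" "h \<in> part (- {p})" "emb x = u +\<^sub>b h" using part_decomp[OF emb_G[OF x(1)]] by blast
  have uhG: "u \<in> G" "h \<in> G" using uh part_G by blast+
  have hu: "emb x = h +\<^sub>b u" using uh(3) bsum_commute[OF uhG] by simp
  \<comment> \<open>At x the element w acts like some l in K. Hence \<open>lam w\<close> and
    \<open>lam l\<close> agree on \<open>emb x\<close> and on its component h, which l fixes because
    K is normal.\<close>
  have "lam w h = h" if w: "w \<in> ?P" for w
  proof -
    have wG: "w \<in> G" using w part_G by blast
    have "act w x \<in> orb act K x" using eq w by (auto simp: orb_def)
    then obtain l where l: "l \<in> K" "act w x = act l x" by (auto simp: orb_def)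
    have lG: "l \<in> G" using l(1) k(2) by blast
    have "lam w (emb x) = lam l (emb x)" using emb_act[OF wG x(1)] emb_act[OF lG x(1)] l(2) by simp
    then have "lam w h +\<^sub>b lam w u = lam l h +\<^sub>b lam l u" using hu lam_bsum uhG wG lG by simp
    then have "lam w h = lam l h"
      by (rule part_bsum_unique(1) [where S = "- {p}"]) (use lam_part uh wG lG in auto)
    also have "\<dots> = h" by (rule lam_fix_normal[OF K l(1) uh(2)])
    finally show ?thesis .
  qed
  then show ?thesis using that x(1) uh(1,2) hu pX by blast
qed

lemma card_lam_orbit_dvd:
  assumes x: "x \<in> X" and h: "h \<in> G" and stb: "stb act G x \<subseteq> stb lam G h"
  shows "card (orb lam G h) dvd card X"
proof -
  have "card (stb act G x) dvd card (stb lam G h)"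
    by (rule subgrp_card_dvd[OF finite_stb[OF finG] subgrp_stb[OF acts_lam subG h] subgrp_stb[OF act subG x] stb])
  then obtain e where e: "card (stb lam G h) = card (stb act G x) * e" by (auto simp: dvd_def)
  have "card X * card (stb act G x) = card (orb lam G h) * card (stb lam G h)"
    using orbit_stabilizer[OF act subG finG x] orbit_stabilizer[OF acts_lam subG finG h] transitive[OF x] by simp
  then have "card (stb act G x) * card X = card (stb act G x) * (card (orb lam G h) * e)" using e by (simp add: ac_simps)
  then have "card X = card (orb lam G h) * e"
    using subgrp_card_pos[OF subgrp_stb[OF act subG x] finite_stb[OF finG]] by simp
  then show ?thesis by simp
qed

text \<open>An element fixing x fixes \<open>emb x\<close> and, the decomposition being unique, also
  its component h.\<close>

lemma card_component_orbit_dvd: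
  assumes x: "x \<in> X" and h: "h \<in> part S" and u: "u \<in> part (- S)" and hu: "emb x = h +\<^sub>b u"
  shows "card (orb lam G h) dvd card X"
proof -
  have G: "h \<in> G" "u \<in> G" using h u part_G by blast+
  have "stb act G x \<subseteq> stb lam G h"
  proof
    fix g assume "g \<in> stb act G x"
    then have g: "g \<in> G" "act g x = x" by (auto simp: stb_def)
    then have "lam g h +\<^sub>b lam g u = h +\<^sub>b u" using emb_act[OF g(1) x] hu lam_bsum G by simp
    then have "lam g h = h" by (rule part_bsum_unique(1) [where S = S]) (use lam_part h u g(1) in auto)
    then show "g \<in> stb lam G h" using g by (simp add: stb_def)
  qed
  then show ?thesis by (rule card_lam_orbit_dvd[OF x G(1)])
qed

lemma part_orbit:
  assumes h: "h \<in> part S" and fix_h: "\<And>w. w \<in> part (- S) \<Longrightarrow> lam w h = h"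
  shows "orb lam G h = orb lam (part S) h"
proof (intro equalityI subsetI)
  fix y assume "y \<in> orb lam G h"
  then obtain g where g: "g \<in> G" "y = lam g h" by (auto simp: orb_def)
  then have "g \<in> prodset (part S) (part (- S))" using prodset_part by simp
  then obtain a w where aw: "g = a * w" "a \<in> part S" "w \<in> part (- S)" by (auto simp: prodset_def)
  then have "y = lam a (lam w h)" using g lam_mult[of a w h] part_G h by blast
  then show "y \<in> orb lam (part S) h" using fix_h aw by (auto simp: orb_def)
qed (rule subsetD[OF orb_mono[OF part_G]])

text \<open>By transitivity every generator \<open>emb y\<close> is
  \<open>lam g h +\<^sub>b lam g u\<close> for some g, so the orbit of h is the projection of the
  generators to \<open>part S\<close>. The set \<open>V'\<close> below is the preimage of V under
  this projection.\<close>

lemma part_generate: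
  assumes x: "x \<in> X" and h: "h \<in> part S" and u: "u \<in> part (- S)" and hu: "emb x = h +\<^sub>b u"
    and V: "V \<subseteq> part S" "1 \<in> V" "\<And>a w. a \<in> V \<Longrightarrow> w \<in> orb lam G h \<Longrightarrow> a +\<^sub>b w \<in> V"
  shows "V = part S"
proof -
  define V' where "V' = {v +\<^sub>b u | v u. v \<in> V \<and> u \<in> part (- S)}"
  have "V' = G"
  proof (rule generate)
    show "V' \<subseteq> G" using V(1) part_G bsum_G unfolding V'_def by blast
    show "1 \<in> V'" unfolding V'_def using V(2) one_part bsum_one(1)[OF one_G] by force
    fix a y assume a: "a \<in> V'" and y: "y \<in> X"
    obtain v w where vw: "a = v +\<^sub>b w" "v \<in> V" "w \<in> part (- S)" using a by (auto simp: V'_def)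
    obtain g where g: "g \<in> G" "y = act g x" using y transitive[OF x] by (auto simp: orb_def)
    have G: "h \<in> G" "u \<in> G" "v \<in> G" "w \<in> G" using h u vw V(1) part_G by blast+
    have lG: "lam g h \<in> G" "lam g u \<in> G" using lam_closed g G by auto
    have "emb y = lam g h +\<^sub>b lam g u" using g emb_act[OF g(1) x] hu lam_bsum G by simp
    then have "a +\<^sub>b emb y = v +\<^sub>b (w +\<^sub>b (lam g h +\<^sub>b lam g u))"
      using vw(1) bsum_assoc G lG bsum_G by simp
    also have "w +\<^sub>b (lam g h +\<^sub>b lam g u) = lam g h +\<^sub>b (w +\<^sub>b lam g u)"
      using bsum_assoc[OF G(4) lG] bsum_assoc[OF lG(1) G(4) lG(2)] bsum_commute[OF G(4) lG(1)] by simp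
    also have "v +\<^sub>b (lam g h +\<^sub>b (w +\<^sub>b lam g u)) = (v +\<^sub>b lam g h) +\<^sub>b (w +\<^sub>b lam g u)"
      using bsum_assoc[OF G(3) lG(1)] bsum_G[OF G(4) lG(2)] by simp
    finally have "a +\<^sub>b emb y = (v +\<^sub>b lam g h) +\<^sub>b (w +\<^sub>b lam g u)" .
    moreover have "v +\<^sub>b lam g h \<in> V" using V(3) vw(2) g(1) by (auto simp: orb_def)
    moreover have "w +\<^sub>b lam g u \<in> part (- S)" using bsum_part vw(3) lam_part[OF g(1) u] by blast
    ultimately show "a +\<^sub>b emb y \<in> V'" unfolding V'_def by blast
  qed
  have "a \<in> V" if a: "a \<in> part S" for a
  proof -
    have "a \<in> V'" using a part_G \<open>V' = G\<close> by blast
    then obtain v w where vw: "a = v +\<^sub>b w" "v \<in> V" "w \<in> part (- S)" by (auto simp: V'_def)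
    then have "a +\<^sub>b 1 = v +\<^sub>b w" using bsum_one(2) a part_G by auto
    then have "a = v" by (rule part_bsum_unique(1) [where S = S]) (use a vw V(1) one_part in auto)
    then show ?thesis using vw by simp
  qed
  then show ?thesis using V(1) by blast
qed

lemma normal_part_of_one_generated:
  assumes x: "x \<in> X" and h: "h \<in> part (- {p})" and u: "u \<in> part {p}" and hu: "emb x = h +\<^sub>b u"
    and fix_h: "\<And>w. w \<in> part {p} \<Longrightarrow> lam w h = h"
    and one_gen: "\<And>W. W \<subseteq> orb lam G h \<Longrightarrow> W \<noteq> {} \<Longrightarrow> (\<And>w w'. w \<in> W \<Longrightarrow> w' \<in> W \<Longrightarrow> lam w w' \<in> W) \<Longrightarrow> W = orb lam G h"
  shows "normal_in (part {p}) G"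
proof -
  let ?P = "part {p}" and ?H = "part (- {p})" and ?O = "orb lam G h"
  have hG: "h \<in> G" using h part_G by blast
  have OH: "?O \<subseteq> ?H" using lam_part h by (auto simp: orb_def)
  define U where "U = {a \<in> ?H. \<forall>w\<in>?P. lam w a = a}"
  have lamU: "lam a b \<in> U" if a: "a \<in> U" and b: "b \<in> U" for a b
  proof -
    have G: "a \<in> G" "b \<in> G" using a b part_G by (auto simp: U_def)
    have "lam w (lam a b) = lam a b" if w: "w \<in> ?P" for w
    proof -
      have wG: "w \<in> G" using w part_G by blast
      \<comment> \<open>An element a fixed by \<open>part {p}\<close> normalises it, so w * a = a *
        w' with w' in \<open>part {p}\<close>, and w' fixes b.\<close>
      have w': "inverse a * w * a \<in> ?P" using lam_fix_iff[OF w, of a] a w by (auto simp: U_def)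
      have "lam w (lam a b) = lam (a * (inverse a * w * a)) b" using lam_mult[OF wG G] by (simp add: mult.assoc)
      also have "\<dots> = lam a (lam (inverse a * w * a) b)" using lam_mult[of a _ b] G w' part_G by blast
      finally show ?thesis using w' b by (simp add: U_def)
    qed
    then show ?thesis using a b lam_part G by (auto simp: U_def)
  qed
  have "h \<in> ?O" using orb_self[OF acts_lam subG hG] .
  then have "h \<in> U \<inter> ?O" using h fix_h by (auto simp: U_def)
  have "lam w w' \<in> ?O" if "w \<in> ?O" "w' \<in> ?O" for w w'
  proof -
    have "w \<in> G" using that(1) OH part_G by blast
    then have "lam w w' \<in> orb lam G w'" by (auto simp: orb_def)
    then show ?thesis using orb_eq[OF acts_lam subG hG that(2)] by simp
  qed
  then have "U \<inter> ?O = ?O" using one_gen[of "U \<inter> ?O"] lamU \<open>h \<in> U \<inter> ?O\<close> by blast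
  then have OU: "?O \<subseteq> U" by blast
  have "U = ?H"
  proof (rule part_generate[OF x h _ hu])
    show "1 \<in> U" using one_part lam_one_right part_G by (auto simp: U_def)
    fix a w assume a: "a \<in> U" and w: "w \<in> ?O"
    then have "w \<in> U" using OU by blast
    then show "a +\<^sub>b w \<in> U" using a lam_bsum bsum_part part_G unfolding U_def by (auto simp: subset_iff)
  qed (use u in \<open>auto simp: U_def\<close>)
  then have conj: "inverse a * w * a \<in> ?P" if "a \<in> ?H" "w \<in> ?P" for a w
    using lam_fix_iff[OF that(2,1)] that by (auto simp: U_def)
  show ?thesis unfolding normal_in_def
  proof (intro conjI ballI subgrp_part part_G)
    fix g c assume "g \<in> G" and c: "c \<in> ?P"
    then have "g \<in> prodset ?P ?H" using prodset_part[of "{p}"] by simp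
    then obtain v a where va: "g = v * a" "v \<in> ?P" "a \<in> ?H" by (auto simp: prodset_def)
    have "inverse a \<in> ?H" using va(3) subgrp_part by blast
    then have "a * c * inverse a \<in> ?P" using conj[of "inverse a" c] c by simp
    then have "v * (a * c * inverse a) * inverse v \<in> ?P" using va(2) subgrp_part by blast
    then show "g * c * inverse g \<in> ?P" using va by (simp add: mult.assoc)
  qed
qed

text \<open>By faithfulness it is enough to commute a and b on single orbits of
  \<open>part {p}\<close>. Their length divides the square-free \<open>card X\<close>, so it is 1 or
  p, and in an orbit of length p all points have the same stabiliser.\<close>

lemma part_abelian:
  assumes p: "prime p" and P: "normal_in (part {p}) G" and a: "a \<in> part {p}" and b: "b \<in> part {p}"
  shows "a * b = b * a"
proof -
  let ?P = "part {p}"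
  have G: "a \<in> G" "b \<in> G" using a b part_G by blast+
  have "act a (act b x) = act b (act a x)" if x: "x \<in> X" for x
  proof -
    have "card (orb act ?P x) dvd card X" using card_orb_normal_dvd[OF act finG subG P x] transitive[OF x] by simp
    then have "squarefree (card (orb act ?P x))" using X_sqf squarefree_mono by blast
    moreover have "pi_num {p} (card (orb act ?P x))"
      using card_orb_dvd[OF acts_part subgrp_part fin_part x] pi_num_card_part pi_num_dvd by blast
    ultimately consider "card (orb act ?P x) = 1" | "card (orb act ?P x) = p" using squarefree_prime_power p by blast
    then show ?thesis
    proof cases
      case 1
      then have "\<forall>g\<in>?P. act g x = x" using card_orb_eq_1_iff[OF acts_part subgrp_part x] by blast
      then show ?thesis using a b by simp
    next
      case 2
      have stb: "stb act ?P z = stb act ?P x" if "z \<in> orb act ?P x" for z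
        using small_orbit_stabilizer[OF acts_part subgrp_part fin_part p pi_num_card_part x 2 that] .
      have aO: "act a x \<in> orb act ?P x" "act b x \<in> orb act ?P x" using a b by (auto simp: orb_def)
      show ?thesis
      proof (cases "act a x = x")
        case True
        then have "a \<in> stb act ?P (act b x)" using stb[OF aO(2)] a by (simp add: stb_def)
        then show ?thesis using True by (simp add: stb_def)
      next
        case False
        \<comment> \<open>The centraliser of a moves x, so it is already transitive on the orbit of
          length p. Thus b agrees at x with some c commuting with a, and then at
          \<open>act a x\<close> too, since the stabilisers coincide.\<close>
        define C where "C = {c \<in> ?P. a * c = c * a}"
        have fC: "finite C" using fin_part by (simp add: C_def)
        have C: "subgrp C"
        proof (rule subgrp_finiteI[OF fC])
          fix c d assume "c \<in> C" "d \<in> C"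
          then show "c * d \<in> C" using subgrp_part by (auto simp: C_def mult.assoc) (metis mult.assoc)
        qed (use one_part in \<open>auto simp: C_def\<close>)
        have CP: "C \<subseteq> ?P" by (auto simp: C_def)
        have aC: "acts C X act" using acts_subset[OF acts_part CP] .
        have "a \<in> C" using a by (simp add: C_def)
        then have "card (orb act C x) \<noteq> 1" using card_orb_eq_1_iff[OF aC C x] False by blast
        moreover have "card (orb act C x) dvd card ?P"
          using card_orb_dvd[OF aC C fC x] subgrp_card_dvd[OF fin_part subgrp_part C CP] dvd_trans by blast
        then have "pi_num {p} (card (orb act C x))" using pi_num_card_part pi_num_dvd by blast
        ultimately have "p dvd card (orb act C x)" using pi_num_prime_dvd p by blast
        then have "p \<le> card (orb act C x)"
          using orb_self[OF aC C x] fC by (intro dvd_imp_le) (auto simp: card_gt_0_iff orb_def)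
        then have "orb act C x = orb act ?P x"
          using orb_mono[OF CP, of act x] 2 fin_part by (intro card_seteq) (simp_all add: orb_def)
        then obtain c where c: "c \<in> C" "act b x = act c x" using aO(2) by (auto simp: orb_def)
        have cP: "c \<in> ?P" "c \<in> G" using c(1) CP part_G by blast+
        have "inverse c * b \<in> stb act ?P x"
          using c(2) acts_eq_iff[OF acts_part subgrp_part x cP(1) b] cP(1) b subgrp_part by (auto simp: stb_def)
        then have "inverse c * b \<in> stb act ?P (act a x)" using stb[OF aO(1)] by simp
        then have "act c (act a x) = act b (act a x)"
          using acts_eq_iff[OF acts_part subgrp_part _ cP(1) b, of "act a x"] actsD(2)[OF act x G(1)] by (simp add: stb_def)
        moreover have "act c (act a x) = act a (act c x)"
          using actsD(3)[OF act x G(1) cP(2)] actsD(3)[OF act x cP(2) G(1)] c(1) by (simp add: C_def)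
        ultimately show ?thesis using c(2) by simp
      qed
    qed
  qed
  then have "\<forall>x\<in>X. act (a * b) x = act (b * a) x" using actsD(3)[OF act] G by simp
  then have "\<forall>x\<in>X. act (inverse (a * b) * (b * a)) x = x"
    using acts_eq_iff[OF act subG _ mult_G[OF G] mult_G[OF G(2,1)]] by blast
  then have "inverse (a * b) * (b * a) = 1" by (intro faithful) (use G mult_G inverse_G in auto)
  then have "inverse (a * b) * (b * a) = inverse (a * b) * (a * b)" by (simp only: group_left_inverse)
  then show ?thesis by (simp only: group_left_cancel)
qed

text \<open>A fixed point t of the p-group \<open>part {p}\<close> on itself exists by counting. For
  u in \<open>part {p}\<close>, t + \<open>lam t u\<close> = t * u = u * t = u + t, so
  \<open>lam t\<close> fixes u; on the complement it is the identity because \<open>part {p}\<close>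
  is normal.\<close>

lemma socle_of_normal_part:
  assumes p: "prime p" and P: "normal_in (part {p}) G" and ne: "part {p} \<noteq> {1}"
  obtains t where "t \<in> G" "t \<noteq> 1" "\<And>a. a \<in> G \<Longrightarrow> lam t a = a"
proof -
  let ?P = "part {p}"
  define F where "F = {t \<in> ?P. \<forall>u\<in>?P. lam u t = t}"
  have "acts ?P ?P lam" unfolding acts_def
    using lam_one lam_mult lam_part part_G by (auto simp: subset_iff)
  then have "card ?P mod p = card F mod p"
    unfolding F_def using p_group_fixed_points subgrp_part fin_part p pi_num_card_part by blast
  moreover have "p dvd card ?P"
    using pi_num_prime_dvd[OF pi_num_card_part p] ne subgrp_card_eq_1[OF subgrp_part] by blast
  ultimately have "p dvd card F" by (simp add: dvd_eq_mod_eq_0)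
  have "1 \<in> F" using one_part lam_one_right part_G by (auto simp: F_def)
  have "F \<noteq> {1}" using \<open>p dvd card F\<close> p not_prime_unit[of p] by auto
  then obtain t where t: "t \<in> F" "t \<noteq> 1" using \<open>1 \<in> F\<close> by blast
  have tP: "t \<in> ?P" "t \<in> G" using t part_G by (auto simp: F_def)
  have tu: "lam t u = u" if u: "u \<in> ?P" for u
  proof -
    have uG: "u \<in> G" using u part_G by blast
    have "t +\<^sub>b lam t u = t * u" using mult_eq_bsum tP uG by simp
    also have "\<dots> = u * t" by (rule part_abelian[OF p P tP(1) u])
    also have "\<dots> = u +\<^sub>b t" using mult_eq_bsum[OF uG tP(2)] t u by (simp add: F_def)
    also have "\<dots> = t +\<^sub>b u" by (rule bsum_commute[OF uG tP(2)])
    finally show ?thesis using bsum_left_cancel tP uG lam_closed by blast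
  qed
  have "lam t a = a" if a: "a \<in> G" for a
  proof -
    obtain u h where uh: "u \<in> ?P" "h \<in> part (- {p})" "a = u +\<^sub>b h" using part_decomp[OF a] by blast
    then show ?thesis
      using lam_bsum[of u h t] tu lam_fix_normal[OF P subset_refl tP(1) uh(2)] tP part_G by (metis subsetD)
  qed
  then show ?thesis using that t tP by blast
qed

end

notation "apply" (infixl \<open>\<langle>$\<rangle>\<close> 999)

instance Perm.perm :: (type) group_mult
  by standard (simp add: perm.left_inverse)

subsection \<open>Cycle sets\<close>

text \<open>The braid relation in terms of \<open>\<sigma>\<close> alone, without inverses: \<open>w\<close> stands for \<open>\<gamma>\<^sub>y(x)\<close>.\<close>

definition cycle_set :: "'a set \<Rightarrow> ('a \<Rightarrow> 'a \<Rightarrow> 'a) \<Rightarrow> bool" where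
  "cycle_set X s \<longleftrightarrow> finite X \<and> (\<forall>x\<in>X. bij_betw (s x) X X) \<and>
     (\<forall>x\<in>X. \<forall>y\<in>X. \<forall>w\<in>X. \<forall>z\<in>X. s (s x y) w = x \<longrightarrow> s x (s y z) = s (s x y) (s w z))"

text \<open>As \<open>X\<close> will be finite, invariance under the inverses of the \<open>\<sigma>\<^sub>x\<close> is automatic.\<close>

definition indec_cs :: "'a set \<Rightarrow> ('a \<Rightarrow> 'a \<Rightarrow> 'a) \<Rightarrow> bool" where
  "indec_cs X s \<longleftrightarrow> X \<noteq> {} \<and> (\<forall>Z\<subseteq>X. Z \<noteq> {} \<longrightarrow> (\<forall>x\<in>X. \<forall>z\<in>Z. s x z \<in> Z) \<longrightarrow> Z = X)"

text \<open>The relation \<open>ret_eq\<close> of the statement, for a binary operation that need not come from an \<open>r\<close>.\<close>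

fun ret_rel :: "'a set \<Rightarrow> ('a \<Rightarrow> 'a \<Rightarrow> 'a) \<Rightarrow> nat \<Rightarrow> 'a \<Rightarrow> 'a \<Rightarrow> bool" where
  "ret_rel X s 0 x y \<longleftrightarrow> x = y"
| "ret_rel X s (Suc k) x y \<longleftrightarrow> (\<forall>z\<in>X. ret_rel X s k (s x z) (s y z))"

definition multiperm_cs :: "'a set \<Rightarrow> ('a \<Rightarrow> 'a \<Rightarrow> 'a) \<Rightarrow> bool" where
  "multiperm_cs X s \<longleftrightarrow> (\<exists>k. \<forall>x\<in>X. \<forall>y\<in>X. ret_rel X s k x y)"

lemma cycle_setD:
  assumes "cycle_set X s"
  shows "finite X" "\<And>x. x \<in> X \<Longrightarrow> bij_betw (s x) X X" "\<And>x y. x \<in> X \<Longrightarrow> y \<in> X \<Longrightarrow> s x y \<in> X"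
    "\<And>x y w z. \<lbrakk>x \<in> X; y \<in> X; w \<in> X; z \<in> X; s (s x y) w = x\<rbrakk> \<Longrightarrow> s x (s y z) = s (s x y) (s w z)"
    "\<And>x y. x \<in> X \<Longrightarrow> y \<in> X \<Longrightarrow> \<exists>a\<in>X. s x a = y"
    "\<And>x y z. x \<in> X \<Longrightarrow> y \<in> X \<Longrightarrow> z \<in> X \<Longrightarrow> s x y = s x z \<longleftrightarrow> y = z"
proof -
  show b: "bij_betw (s x) X X" if "x \<in> X" for x using assms that by (auto simp: cycle_set_def)
  show "s x y \<in> X" if "x \<in> X" "y \<in> X" for x y using bij_betwE[OF b[OF that(1)]] that by blast
  show "\<exists>a\<in>X. s x a = y" if "x \<in> X" "y \<in> X" for x y
    using b[OF that(1)] that(2) by (metis bij_betw_imp_surj_on imageE)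
  show "s x y = s x z \<longleftrightarrow> y = z" if "x \<in> X" "y \<in> X" "z \<in> X" for x y z
    using b[OF that(1)] that by (metis bij_betw_imp_inj_on inj_on_eq_iff)
qed (use assms in \<open>auto simp: cycle_set_def\<close>)

lemma ret_rel_refl: "ret_rel X s k x x"
  by (induction k arbitrary: x) auto

lemma ret_rel_sym: "ret_rel X s k x y \<Longrightarrow> ret_rel X s k y x"
  by (induction k arbitrary: x y) auto

lemma ret_rel_trans: "ret_rel X s k x y \<Longrightarrow> ret_rel X s k y z \<Longrightarrow> ret_rel X s k x z"
  by (induction k arbitrary: x y z) auto

lemma ret_rel_Suc: "ret_rel X s k x y \<Longrightarrow> ret_rel X s (Suc k) x y"
proof (induction k arbitrary: x y)
  case 0 then show ?case by (simp add: ret_rel_refl)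
next
  case (Suc k)
  then have "\<forall>z\<in>X. ret_rel X s (Suc k) (s x z) (s y z)" by (metis ret_rel.simps(2))
  then show ?case by (metis ret_rel.simps(2))
qed

text \<open>T maps the finite set of related pairs injectively into itself, hence onto itself. So
  the inverse of T preserves R as well.\<close>

lemma finite_invariant_relation:
  assumes "finite X" "bij_betw T X X" "\<And>y y'. \<lbrakk>y \<in> X; y' \<in> X; R y y'\<rbrakk> \<Longrightarrow> R (T y) (T y')"
    and "y \<in> X" "y' \<in> X" "R (T y) (T y')"
  shows "R y y'"
proof -
  define D where "D = {(y, y'). y \<in> X \<and> y' \<in> X \<and> R y y'}"
  have inj: "inj_on T X" and TX: "T ` X = X" using assms(2) by (auto simp: bij_betw_def)
  have fD: "finite D" unfolding D_def by (rule finite_subset[of _ "X \<times> X"]) (use assms(1) in auto)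
  have sub: "map_prod T T ` D \<subseteq> D" using assms(3) TX by (auto simp: D_def)
  have "inj_on (map_prod T T) D" using inj by (auto simp: D_def inj_on_def)
  then have "map_prod T T ` D = D" using sub fD by (meson endo_inj_surj)
  moreover have "(T y, T y') \<in> D" using assms TX by (auto simp: D_def)
  ultimately have "(T y, T y') \<in> map_prod T T ` D" by simp
  then obtain z z' where z: "(z, z') \<in> D" "T z = T y" "T z' = T y'" by auto
  then have "z = y" "z' = y'" using inj_onD[OF inj] assms(4,5) by (auto simp: D_def)
  then show ?thesis using z(1) by (simp add: D_def)
qed

text \<open>Together with the definition, this makes \<open>ret_rel\<close> compatible with s in
  both arguments. In the induction step the braid law rewrites s x (s (T y) z), with T the inverse
  of s x, as s y (s b z) where s y b = x. This shows that T preserves the relation, and finiteness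
  transfers it to s x.\<close>

lemma ret_rel_right:
  assumes X: "cycle_set X s" and "x \<in> X" "y \<in> X" "y' \<in> X" "ret_rel X s k y y'"
  shows "ret_rel X s k (s x y) (s x y')"
  using assms(2-)
proof (induction k arbitrary: x y y')
  case (Suc k)
  note c = cycle_setD[OF X]
  have inj: "ret_rel X s k z z'" if "x \<in> X" "z \<in> X" "z' \<in> X" "ret_rel X s k (s x z) (s x z')" for x z z'
    using finite_invariant_relation[OF c(1) c(2)[OF that(1)], of "ret_rel X s k"] Suc.IH that by blast
  define T where "T = inv_into X (s x)"
  have T: "bij_betw T X X" unfolding T_def by (rule bij_betw_inv_into[OF c(2)[OF Suc.prems(1)]])
  have sT: "s x (T y) = y" "T (s x y) = y" "T y \<in> X" if "y \<in> X" for y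
    using c(2)[OF Suc.prems(1)] that
    by (auto simp: T_def bij_betw_inv_into_right bij_betw_inv_into_left bij_betwE[OF T [unfolded T_def]])
  have step: "ret_rel X s (Suc k) (T y) (T y')" if y: "y \<in> X" "y' \<in> X" "ret_rel X s (Suc k) y y'" for y y'
    unfolding ret_rel.simps
  proof
    fix z assume z: "z \<in> X"
    obtain b where b: "b \<in> X" "s y b = x" using c(5)[OF y(1) Suc.prems(1)] by blast
    obtain b' where b': "b' \<in> X" "s y' b' = x" using c(5)[OF y(2) Suc.prems(1)] by blast
    have 1: "s x (s (T y) z) = s y (s b z)"
      using c(4)[OF Suc.prems(1) sT(3)[OF y(1)] b(1) z] sT(1)[OF y(1)] b(2) by simp
    have 2: "s x (s (T y') z) = s y' (s b' z)"
      using c(4)[OF Suc.prems(1) sT(3)[OF y(2)] b'(1) z] sT(1)[OF y(2)] b'(2) by simp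
    have "ret_rel X s k (s y b') (s y' b')" using y(3) b'(1) by simp
    then have "ret_rel X s k (s y b') (s y b)" by (simp only: b(2) b'(2))
    then have "ret_rel X s k b' b" by (rule inj[OF y(1) b'(1) b(1)])
    then have "ret_rel X s k b b'" by (rule ret_rel_sym)
    then have "ret_rel X s (Suc k) b b'" by (rule ret_rel_Suc)
    then have "ret_rel X s k (s b z) (s b' z)" using z by simp
    then have "ret_rel X s k (s y (s b z)) (s y (s b' z))"
      by (rule Suc.IH[OF y(1) c(3)[OF b(1) z] c(3)[OF b'(1) z]])
    moreover have "ret_rel X s k (s y (s b' z)) (s y' (s b' z))" using y(3) c(3)[OF b'(1) z] by simp
    ultimately have "ret_rel X s k (s x (s (T y) z)) (s x (s (T y') z))" unfolding 1 2 by (rule ret_rel_trans)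
    then show "ret_rel X s k (s (T y) z) (s (T y') z)" 
      by (rule inj[OF Suc.prems(1) c(3)[OF sT(3)[OF y(1)] z] c(3)[OF sT(3)[OF y(2)] z]])
  qed
  show ?case
  proof (rule finite_invariant_relation[OF c(1) T, of "ret_rel X s (Suc k)"])
    show "ret_rel X s (Suc k) (T (s x y)) (T (s x y'))" using Suc.prems(2-4) sT(2) by simp
  qed (use step c(3) Suc.prems in auto)
qed simp

text \<open>If every point is equivalent at level \<open>k + 1\<close> to a point of \<open>W\<close>, then the points equivalent at level
  \<open>k\<close> to a point of \<open>W\<close> form an invariant set.\<close>

lemma one_generator:
  assumes X: "cycle_set X s" "indec_cs X s" "multiperm_cs X s"
    and W: "W \<subseteq> X" "W \<noteq> {}" "\<And>w w'. w \<in> W \<Longrightarrow> w' \<in> W \<Longrightarrow> s w w' \<in> W"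
  shows "W = X"
proof -
  obtain m where m: "\<And>x y. x \<in> X \<Longrightarrow> y \<in> X \<Longrightarrow> ret_rel X s m x y" using X(3) by (auto simp: multiperm_cs_def)
  \<comment> \<open>The level descends from m, where all points are related, to 0, where the
    relation is equality.\<close>
  have "\<forall>y\<in>X. \<exists>w\<in>W. ret_rel X s (m - k) y w" for k
  proof (induction k)
    case 0
    obtain w where "w \<in> W" using W(2) by blast
    then show ?case using m W(1) by auto
  next
    case (Suc k)
    show ?case
    proof (cases "k < m")
      case False then show ?thesis using Suc by simp
    next
      case True
      define j where "j = m - Suc k"
      have j: "m - k = Suc j" using True by (simp add: j_def)
      define Z where "Z = {z \<in> X. \<exists>w\<in>W. ret_rel X s j z w}"
      have "Z = X"
      proof -
        have "W \<subseteq> Z" using W(1) by (auto simp: Z_def intro: ret_rel_refl)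
        then have "Z \<noteq> {}" using W(2) by blast
        moreover have "s y z \<in> Z" if y: "y \<in> X" and z: "z \<in> Z" for y z
        proof -
          obtain w where w: "w \<in> W" "ret_rel X s (Suc j) y w" using Suc y j by auto
          obtain w' where w': "w' \<in> W" "ret_rel X s j z w'" "z \<in> X" using z by (auto simp: Z_def)
          have "ret_rel X s j (s y z) (s w z)" using w(2) w'(3) by simp
          moreover have "ret_rel X s j (s w z) (s w w')" using ret_rel_right[OF X(1)] w w' W(1) by blast
          ultimately have "ret_rel X s j (s y z) (s w w')" by (rule ret_rel_trans)
          then show ?thesis using W(3)[OF w(1) w'(1)] cycle_setD(3)[OF X(1) y w'(3)] by (auto simp: Z_def)
        qed
        ultimately show ?thesis using X(2) by (auto simp: indec_cs_def Z_def)
      qed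
      then show ?thesis unfolding j_def [symmetric] by (auto simp: Z_def)
    qed
  qed
  from this[of m] have "\<forall>y\<in>X. y \<in> W" by auto
  then show ?thesis using W(1) by blast
qed

text \<open>The induction hypothesis concerns cycle sets in the type of X, while the ones to be
  treated consist of permutations. A smaller one is copied onto a subset of X of the same
  cardinality.\<close>

lemma multiperm_cs_transport:
  fixes X :: "'a set" and Y :: "'b set"
  assumes IH: "\<And>(Z :: 'a set) s. \<lbrakk>card Z < card X; cycle_set Z s; indec_cs Z s; squarefree (card Z)\<rbrakk> \<Longrightarrow> multiperm_cs Z s"
    and Y: "cycle_set Y t" "indec_cs Y t" "squarefree (card Y)" "card Y < card X"
  shows "multiperm_cs Y t"
proof -
  note c = cycle_setD[OF Y(1)]
  obtain Z where Z: "Z \<subseteq> X" "card Z = card Y" "finite Z"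
    using obtain_subset_with_card_n[of "card Y" X] Y(4) by (metis less_imp_le)
  obtain \<rho> where \<rho>: "bij_betw \<rho> Z Y" using finite_same_card_bij[OF Z(3) c(1) Z(2)] by blast
  define \<tau> where "\<tau> = inv_into Z \<rho>"
  have \<tau>: "bij_betw \<tau> Y Z" unfolding \<tau>_def by (rule bij_betw_inv_into[OF \<rho>])
  have mem: "\<rho> z \<in> Y" if "z \<in> Z" for z using bij_betwE[OF \<rho>] that by blast
  have mem': "\<tau> y \<in> Z" if "y \<in> Y" for y using bij_betwE[OF \<tau>] that by blast
  have inv: "\<rho> (\<tau> y) = y" if "y \<in> Y" for y using bij_betw_inv_into_right[OF \<rho> that] by (simp add: \<tau>_def)
  have inv': "\<tau> (\<rho> z) = z" if "z \<in> Z" for z using bij_betw_inv_into_left[OF \<rho> that] by (simp add: \<tau>_def)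
  define s where "s y z = \<tau> (t (\<rho> y) (\<rho> z))" for y z
  have s: "\<rho> (s y z) = t (\<rho> y) (\<rho> z)" "s y z \<in> Z" if "y \<in> Z" "z \<in> Z" for y z
    using that mem c(3) inv mem' by (auto simp: s_def)
  have "cycle_set Z s" unfolding cycle_set_def
  proof (intro conjI ballI impI Z(3))
    fix x assume "x \<in> Z"
    then have "bij_betw (\<tau> \<circ> (t (\<rho> x) \<circ> \<rho>)) Z Z"
      using \<rho> \<tau> c(2)[OF mem] by (intro bij_betw_trans)
    then show "bij_betw (s x) Z Z" by (simp add: s_def [abs_def] comp_def)
  next
    fix x y w z assume xywz: "x \<in> Z" "y \<in> Z" "w \<in> Z" "z \<in> Z" and eq: "s (s x y) w = x"
    then have "t (t (\<rho> x) (\<rho> y)) (\<rho> w) = \<rho> x" using s by metis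
    then have "t (\<rho> x) (t (\<rho> y) (\<rho> z)) = t (t (\<rho> x) (\<rho> y)) (t (\<rho> w) (\<rho> z))"
      using c(4) mem xywz by blast
    then have "\<rho> (s x (s y z)) = \<rho> (s (s x y) (s w z))" using s xywz by simp
    then show "s x (s y z) = s (s x y) (s w z)" using inv' s xywz by metis
  qed
  moreover have "indec_cs Z s" unfolding indec_cs_def
  proof (intro conjI allI impI)
    show "Z \<noteq> {}" using Y(2) \<rho> by (auto simp: indec_cs_def bij_betw_def)
    fix V assume V: "V \<subseteq> Z" "V \<noteq> {}" "\<forall>x\<in>Z. \<forall>z\<in>V. s x z \<in> V"
    have "t y (\<rho> z) \<in> \<rho> ` V" if "y \<in> Y" "z \<in> V" for y z
    proof -
      have "\<rho> (s (\<tau> y) z) = t y (\<rho> z)" using s(1)[of "\<tau> y" z] mem' inv that V(1) by auto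
      moreover have "s (\<tau> y) z \<in> V" using V(3) mem' that by blast
      ultimately show ?thesis by (metis imageI)
    qed
    then have "\<forall>y\<in>Y. \<forall>v\<in>\<rho> ` V. t y v \<in> \<rho> ` V" by blast
    moreover have "\<rho> ` V \<subseteq> Y" "\<rho> ` V \<noteq> {}" using V(1,2) mem by auto
    ultimately have "\<rho> ` V = Y" using Y(2) unfolding indec_cs_def by blast
    then show "V = Z" using V(1) \<rho> by (metis bij_betw_def inj_on_image_eq_iff order_refl)
  qed
  ultimately have "multiperm_cs Z s" using IH Y(3,4) Z(2) by simp
  then obtain k where k: "\<And>x y. x \<in> Z \<Longrightarrow> y \<in> Z \<Longrightarrow> ret_rel Z s k x y" by (auto simp: multiperm_cs_def)
  have "ret_rel Y t j (\<rho> x) (\<rho> y)" if "ret_rel Z s j x y" "x \<in> Z" "y \<in> Z" for j x y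
    using that
  proof (induction j arbitrary: x y)
    case (Suc j)
    show ?case unfolding ret_rel.simps
    proof
      fix v assume v: "v \<in> Y"
      have "ret_rel Z s j (s x (\<tau> v)) (s y (\<tau> v))" using Suc.prems(1) mem' [OF v] by simp
      then have "ret_rel Y t j (\<rho> (s x (\<tau> v))) (\<rho> (s y (\<tau> v)))" using Suc s mem' v by blast
      then show "ret_rel Y t j (t (\<rho> x) v) (t (\<rho> y) v)" using s(1) mem' v Suc.prems inv by simp
    qed
  qed simp
  then have "ret_rel Y t k x y" if "x \<in> Y" "y \<in> Y" for x y
    using k mem' inv that by metis
  then show ?thesis by (auto simp: multiperm_cs_def)
qed

subsection \<open>The brace of a cycle set\<close>

locale cycle_set_perms =
  fixes X :: "'a set" and s :: "'a \<Rightarrow> 'a \<Rightarrow> 'a"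
  assumes X: "cycle_set X s"
begin

lemmas c = cycle_setD[OF X]

text \<open>Extended by the identity outside the finite set X, sigma_x becomes an element of
  \<open>perm\<close>, a type that is itself a group.\<close>

definition sig :: "'a \<Rightarrow> 'a perm" where
  "sig x = Perm (\<lambda>z. if z \<in> X then s x z else z)"

lemma apply_sig: assumes "x \<in> X" shows "sig x \<langle>$\<rangle> z = (if z \<in> X then s x z else z)"
proof -
  have "bij_betw (\<lambda>z. if z \<in> X then s x z else z) (X \<union> - X) (X \<union> - X)"
  proof (rule bij_betw_combine)
    show "bij_betw (\<lambda>z. if z \<in> X then s x z else z) X X"
      using c(2)[OF assms] by (subst bij_betw_cong [where g = "s x"]) auto
    show "bij_betw (\<lambda>z. if z \<in> X then s x z else z) (- X) (- X)"
      by (subst bij_betw_cong [where g = id]) auto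
  qed auto
  moreover have "finite {z. (if z \<in> X then s x z else z) \<noteq> z}"
    by (rule finite_subset[OF _ c(1)]) auto
  ultimately show ?thesis unfolding sig_def by (subst Perm_inverse) auto
qed

definition stab :: "'a perm \<Rightarrow> bool" where
  "stab g \<longleftrightarrow> (\<forall>z. z \<notin> X \<longrightarrow> g \<langle>$\<rangle> z = z)"

lemma stab_mem: assumes "stab g" shows "g \<langle>$\<rangle> z \<in> X \<longleftrightarrow> z \<in> X"
proof -
  have "g \<langle>$\<rangle> z \<notin> X \<Longrightarrow> z \<notin> X"
    using assms apply_inj[of g "g \<langle>$\<rangle> z" z] by (auto simp: stab_def)
  then show ?thesis using assms by (auto simp: stab_def)
qed

lemma stab_sig: "x \<in> X \<Longrightarrow> stab (sig x)"
  by (simp add: stab_def apply_sig)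

lemma stab_mult: "stab g \<Longrightarrow> stab h \<Longrightarrow> stab (g * h)"
  by (simp add: stab_def apply_times)

lemma inverse_apply [simp]: "inverse g \<langle>$\<rangle> (g \<langle>$\<rangle> z) = z" "g \<langle>$\<rangle> (inverse g \<langle>$\<rangle> z) = z" for g :: "'a perm"
  by (simp_all add: apply_sequence)

lemma stab_inverse: "stab g \<Longrightarrow> stab (inverse g)"
  unfolding stab_def by (metis inverse_apply(1))

text \<open>\<open>L [x\<^sub>1, \<dots>, x\<^sub>n]\<close> is the permutation given by the element \<open>x\<^sub>1 + \<dots> + x\<^sub>n\<close> of the structure brace.\<close>

fun L :: "'a list \<Rightarrow> 'a perm" where
  "L [] = 1"
| "L (x # xs) = sig x * L (map (apply (inverse (sig x))) xs)"

lemma map_stab: "stab g \<Longrightarrow> xs \<in> lists X \<Longrightarrow> map (apply g) xs \<in> lists X"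
  by (auto simp: stab_mem in_lists_conv_set)

lemma stab_L: "xs \<in> lists X \<Longrightarrow> stab (L xs)"
proof (induction xs rule: L.induct)
  case 1 then show ?case by (simp add: stab_def)
next
  case (2 x xs)
  then show ?case using map_stab stab_inverse stab_sig stab_mult by simp
qed

lemma L_append: "L (xs @ ys) = L xs * L (map (apply (inverse (L xs))) ys)"
proof (induction xs arbitrary: ys rule: L.induct)
  case (2 x xs)
  then show ?case by (simp add: mult.assoc apply_times comp_def)
qed (simp add: map_idI)

text \<open>For the points a and b with s x a = y and s y b = x, the cycle set law reads
  \<open>sig x * sig a = sig y * sig b\<close>.\<close>

lemma L_swap:
  assumes "x \<in> X" "y \<in> X" shows "L (x # y # zs) = L (y # x # zs)"
proof -
  define a b where "a = inverse (sig x) \<langle>$\<rangle> y" and "b = inverse (sig y) \<langle>$\<rangle> x"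
  have ab: "a \<in> X" "b \<in> X" using assms stab_mem[OF stab_inverse[OF stab_sig]] by (auto simp: a_def b_def)
  have "sig x \<langle>$\<rangle> a = y" "sig y \<langle>$\<rangle> b = x" by (simp_all add: a_def b_def)
  then have sab: "s x a = y" "s y b = x" using apply_sig assms ab by auto
  have eq: "sig x * sig a = sig y * sig b"
  proof (rule perm_eqI)
    fix z
    show "(sig x * sig a) \<langle>$\<rangle> z = (sig y * sig b) \<langle>$\<rangle> z"
      using c(4)[OF assms(1) ab, of z] sab assms ab c(3) by (auto simp: apply_times apply_sig)
  qed
  have "L (x # y # zs) = (sig x * sig a) * L (map (apply (inverse (sig x * sig a))) zs)"
    by (simp add: a_def mult.assoc apply_times comp_def)
  also have "\<dots> = L (y # x # zs)"
    unfolding eq by (simp add: b_def mult.assoc apply_times comp_def)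
  finally show ?thesis .
qed

lemma L_move: "xs \<in> lists X \<Longrightarrow> x \<in> X \<Longrightarrow> L (xs @ x # ys) = L (x # xs @ ys)"
proof (induction xs arbitrary: x ys rule: L.induct)
  case (2 a xs)
  let ?i = "inverse (sig a)"
  have i: "stab ?i" using 2 stab_inverse stab_sig by auto
  have "L ((a # xs) @ x # ys) = sig a * L (map (apply (?i)) xs @ (?i \<langle>$\<rangle> x) # map (apply (?i)) ys)" by simp
  also have "\<dots> = sig a * L ((?i \<langle>$\<rangle> x) # map (apply (?i)) xs @ map (apply (?i)) ys)"
    using 2 map_stab[OF i] stab_mem[OF i] by simp
  also have "\<dots> = L (a # x # xs @ ys)" by simp
  also have "\<dots> = L (x # a # xs @ ys)" using 2 by (intro L_swap) auto
  finally show ?case by simp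
qed simp

lemma L_commute: "xs \<in> lists X \<Longrightarrow> ys \<in> lists X \<Longrightarrow> L (xs @ ys) = L (ys @ xs)"
proof (induction xs arbitrary: ys rule: L.induct)
  case (2 a xs)
  let ?i = "inverse (sig a)"
  have i: "stab ?i" using 2 stab_inverse stab_sig by auto
  have "L ((a # xs) @ ys) = sig a * L (map (apply (?i)) xs @ map (apply (?i)) ys)" by simp
  also have "\<dots> = sig a * L (map (apply (?i)) ys @ map (apply (?i)) xs)"
    using 2 map_stab[OF i] by simp
  also have "\<dots> = L (a # ys @ xs)" by simp
  also have "\<dots> = L (ys @ a # xs)" using 2 by (intro L_move [symmetric]) auto
  finally show ?case .
qed simp

definition G :: "'a perm set" where
  "G = L ` lists X"

lemma stab_G: "g \<in> G \<Longrightarrow> stab g"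
  using stab_L by (auto simp: G_def)

lemma perm_eqI_stab: "stab g \<Longrightarrow> stab h \<Longrightarrow> (\<And>z. z \<in> X \<Longrightarrow> g \<langle>$\<rangle> z = h \<langle>$\<rangle> z) \<Longrightarrow> g = h"
  by (rule perm_eqI) (metis stab_def)

lemma finite_G: "finite G"
proof (rule inj_on_finite)
  show "inj_on (\<lambda>g. restrict (apply g) X) G"
  proof (rule inj_onI)
    fix g h assume "g \<in> G" "h \<in> G" "restrict (apply g) X = restrict (apply h) X"
    then show "g = h" using perm_eqI_stab stab_G by (metis restrict_apply')
  qed
  show "(\<lambda>g. restrict (apply g) X) ` G \<subseteq> X \<rightarrow>\<^sub>E X"
    using stab_mem stab_G by auto
  show "finite (X \<rightarrow>\<^sub>E X)" using c(1) by (simp add: finite_PiE)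
qed

lemma L_mult: "L xs * L ys = L (xs @ map (apply (L xs)) ys)"
  by (simp add: L_append comp_def)

lemma subgrp_G: "subgrp G"
proof (rule subgrp_finiteI[OF finite_G])
  show "1 \<in> G" unfolding G_def by (rule image_eqI[of _ _ "[]"]) auto
  fix a b assume "a \<in> G" "b \<in> G"
  then obtain xs ys where "xs \<in> lists X" "ys \<in> lists X" "a = L xs" "b = L ys" by (auto simp: G_def)
  then show "a * b \<in> G" unfolding G_def using L_mult map_stab[OF stab_L] by (auto intro!: image_eqI)
qed

definition lamG :: "'a perm \<Rightarrow> 'a perm \<Rightarrow> 'a perm" where
  "lamG g a = L (map (apply g) (SOME xs. xs \<in> lists X \<and> L xs = a))"

text \<open>The choice of the word does not matter: for a word us of the inverse of g, comparing
  \<open>L (us @ zs)\<close> with \<open>L (zs @ us)\<close> expresses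
  \<open>L (map (apply g) zs)\<close> through g, us and \<open>L zs\<close> alone.\<close>

lemma lamG_L:
  assumes g: "g \<in> G" and xs: "xs \<in> lists X"
  shows "lamG g (L xs) = L (map (apply g) xs)"
proof -
  define ys where "ys = (SOME ys. ys \<in> lists X \<and> L ys = L xs)"
  have ys: "ys \<in> lists X" "L ys = L xs"
    using someI[of "\<lambda>ys. ys \<in> lists X \<and> L ys = L xs" xs] xs by (auto simp: ys_def)
  obtain us where us: "us \<in> lists X" "L us = inverse g" using g subgrp_G by (metis G_def imageE subgrpD(3))
  have "inverse g * L (map (apply g) zs) = L zs * L (map (apply (inverse (L zs))) us)"
    if "zs \<in> lists X" for zs
    using L_commute[OF us(1) that] us(2) by (simp add: L_append)
  from this[OF xs] this[OF ys(1)]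
  have "inverse g * L (map (apply g) xs) = inverse g * L (map (apply g) ys)" using ys(2) by simp
  then show ?thesis unfolding lamG_def ys_def [symmetric] by simp
qed

lemma G_cases: assumes "a \<in> G" obtains xs where "xs \<in> lists X" "a = L xs"
  using assms by (auto simp: G_def)

lemma lamG_sum:
  assumes "xs \<in> lists X" "ys \<in> lists X"
  shows "L xs * lamG (inverse (L xs)) (L ys) = L (xs @ ys)"
proof -
  have "inverse (L xs) \<in> G" using assms subgrp_G by (auto simp: G_def)
  then show ?thesis using lamG_L assms by (simp add: L_append)
qed

lemma brace_G: "brace G lamG"
proof
  show "finite G" "subgrp G" by (rule finite_G subgrp_G)+
  fix a b assume a: "a \<in> G" and b: "b \<in> G"
  obtain xs where xs: "xs \<in> lists X" "a = L xs" using G_cases[OF a] .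
  obtain ys where ys: "ys \<in> lists X" "b = L ys" using G_cases[OF b] .
  show "lamG a b \<in> G" using lamG_L[OF a ys(1)] ys map_stab[OF stab_G[OF a]] by (auto simp: G_def)
  show "lamG 1 b = b" using lamG_L[OF subgrpD(1)[OF subgrp_G] ys(1)] ys by (simp add: map_idI)
  show "a * lamG (inverse a) b = b * lamG (inverse b) a" using lamG_sum L_commute xs ys by simp
  fix d assume d: "d \<in> G"
  obtain zs where zs: "zs \<in> lists X" "d = L zs" using G_cases[OF d] .
  have "a * b \<in> G" using a b subgrp_G by blast
  then show "lamG (a * b) d = lamG a (lamG b d)"
    using lamG_L a b zs map_stab[OF stab_G[OF b]] by (simp add: apply_times comp_def)
  show "lamG d (a * lamG (inverse a) b) = lamG d a * lamG (inverse (lamG d a)) (lamG d b)"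
    using lamG_sum xs ys lamG_L[OF d] map_stab[OF stab_G[OF d]] by simp
qed

lemma L_single: "L [x] = sig x" by simp

lemma sig_G: "x \<in> X \<Longrightarrow> sig x \<in> G"
  unfolding G_def using L_single[of x] by (metis Cons_in_lists_iff imageI lists.Nil)

lemma lamG_sig: "g \<in> G \<Longrightarrow> x \<in> X \<Longrightarrow> lamG g (sig x) = sig (g \<langle>$\<rangle> x)"
  using lamG_L[of g "[x]"] by (simp add: Cons_in_lists_iff)

lemma lamG_sig_sig: "x \<in> X \<Longrightarrow> y \<in> X \<Longrightarrow> lamG (sig x) (sig y) = sig (s x y)"
  using lamG_sig[OF sig_G] by (simp add: apply_sig)

lemma brace_set_G:
  assumes "indec_cs X s" "squarefree (card X)"
  shows "brace_set G lamG X apply sig"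
proof -
  interpret brace G lamG by (rule brace_G)
  have acts: "acts G X apply"
    using stab_mem stab_G by (auto simp: acts_def apply_times)
  show ?thesis
  proof
    show "finite X" by (rule c(1))
    show "acts G X apply" by (rule acts)
    show "X \<noteq> {}" "squarefree (card X)" using assms by (auto simp: indec_cs_def)
    fix x assume x: "x \<in> X"
    show "sig x \<in> G" by (rule sig_G[OF x])
    show "orb apply G x = X"
    proof -
      let ?Z = "orb apply G x"
      have "?Z \<subseteq> X" "?Z \<noteq> {}" using orb_subset[OF acts x] orb_self[OF acts subgrp_G x] by auto
      moreover have "s y z \<in> ?Z" if y: "y \<in> X" and z: "z \<in> ?Z" for y z
      proof -
        have "s y z = sig y \<langle>$\<rangle> z" using apply_sig[OF y] z \<open>?Z \<subseteq> X\<close> by auto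
        moreover obtain g where "g \<in> G" "z = g \<langle>$\<rangle> x" using z by (auto simp: orb_def)
        moreover have "sig y * g \<in> G" using sig_G[OF y] \<open>g \<in> G\<close> subgrp_G by blast
        ultimately show ?thesis unfolding orb_def by (intro image_eqI[of _ _ "sig y * g"]) (auto simp: apply_times)
      qed
      ultimately show ?thesis using assms(1) by (auto simp: indec_cs_def)
    qed
  next
    fix g x assume "g \<in> G" "x \<in> X"
    then show "sig (g \<langle>$\<rangle> x) = lamG g (sig x)" using lamG_sig by simp
  next
    fix g assume "g \<in> G" "\<forall>x\<in>X. g \<langle>$\<rangle> x = x"
    then show "g = 1" using perm_eqI_stab[of g 1] stab_G by (simp add: stab_def)
  next
    fix V assume V: "V \<subseteq> G" "1 \<in> V" and step: "\<And>a x. a \<in> V \<Longrightarrow> x \<in> X \<Longrightarrow> bsum a (sig x) \<in> V"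
    have "L xs \<in> V" if "xs \<in> lists X" for xs
      using that
    proof (induction xs rule: rev_induct)
      case (snoc x xs)
      then have xs: "xs \<in> lists X" "x \<in> X" by auto
      then have "bsum (L xs) (sig x) = L (xs @ [x])"
        using lamG_sum[OF xs(1), of "[x]"] by (simp add: bsum_def Cons_in_lists_iff)
      then show ?case using step[of "L xs" x] snoc xs by simp
    qed (use V in simp)
    then show "V = G" using V(1) by (auto simp: G_def)
  qed
qed

lemma multiperm_cs_of_image:
  assumes "multiperm_cs (sig ` X) lamG" shows "multiperm_cs X s"
proof -
  obtain k where k: "\<And>x y. x \<in> sig ` X \<Longrightarrow> y \<in> sig ` X \<Longrightarrow> ret_rel (sig ` X) lamG k x y" using assms by (auto simp: multiperm_cs_def)
  have "ret_rel X s (Suc j) x y" if "ret_rel (sig ` X) lamG j (sig x) (sig y)" "x \<in> X" "y \<in> X" for j x y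
    using that
  proof (induction j arbitrary: x y)
    case 0
    then have "sig x \<langle>$\<rangle> z = sig y \<langle>$\<rangle> z" for z by simp
    then show ?case using apply_sig 0 by (metis ret_rel.simps)
  next
    case (Suc j)
    have "ret_rel X s (Suc j) (s x z) (s y z)" if z: "z \<in> X" for z
    proof -
      have "ret_rel (sig ` X) lamG j (lamG (sig x) (sig z)) (lamG (sig y) (sig z))" using Suc.prems(1) z by simp
      then show ?thesis using Suc c(3) z by (simp only: lamG_sig_sig)
    qed
    then show ?case by (metis ret_rel.simps(2))
  qed
  then show ?thesis using k unfolding multiperm_cs_def by blast
qed

end


subsection \<open>Indecomposable cycle sets of square-free cardinality\<close>

context brace_set
begin

lemma orbit_cycle_set:
  assumes h: "h \<in> G" shows "cycle_set (orb lam G h) lam"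
proof -
  let ?O = "orb lam G h"
  have O: "?O \<subseteq> G" using orb_subset[OF acts_lam h] .
  have fO: "finite ?O" using O finG finite_subset by blast
  have closed: "lam a b \<in> ?O" if "a \<in> ?O" "b \<in> ?O" for a b
  proof -
    have "lam a b \<in> orb lam G b" using that O by (auto simp: orb_def)
    then show ?thesis using orb_eq[OF acts_lam subG h that(2)] by simp
  qed
  show ?thesis unfolding cycle_set_def
  proof (intro conjI ballI impI fO)
    fix a assume a: "a \<in> ?O"
    then have aG: "a \<in> G" using O by blast
    have "inj_on (lam a) ?O"
    proof (rule inj_onI)
      fix b d assume "b \<in> ?O" "d \<in> ?O" "lam a b = lam a d"
      then show "b = d" using lam_inverse(1)[OF aG] O by (metis subsetD)
    qed
    moreover have "lam a ` ?O \<subseteq> ?O" using closed a by blast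
    ultimately show "bij_betw (lam a) ?O ?O" using fO endo_inj_surj unfolding bij_betw_def by blast
  next
    fix a b w d assume "a \<in> ?O" "b \<in> ?O" "w \<in> ?O" "d \<in> ?O" "lam (lam a b) w = a"
    then show "lam a (lam b d) = lam (lam a b) (lam w d)"
      using O by (intro lam_sub_brace_relation) auto
  qed
qed

text \<open>The elements of \<open>part S\<close> that preserve Z are closed under adding a point w
  of the orbit, since \<open>a +\<^sub>b w\<close> is the product of a with another orbit point. By
  \<open>part_generate\<close> they are all of \<open>part S\<close>, which is transitive on the
  orbit because the complementary part fixes h.\<close>

lemma orbit_indec:
  assumes x: "x \<in> X" and h: "h \<in> part S" and u: "u \<in> part (- S)" and hu: "emb x = h +\<^sub>b u"
    and fix_h: "\<And>w. w \<in> part (- S) \<Longrightarrow> lam w h = h"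
  shows "indec_cs (orb lam G h) lam"
  unfolding indec_cs_def
proof (intro conjI allI impI)
  let ?O = "orb lam G h"
  have hG: "h \<in> G" using h part_G by blast
  have OG: "?O \<subseteq> G" using orb_subset[OF acts_lam hG] .
  show "?O \<noteq> {}" using orb_self[OF acts_lam subG hG] by blast
  fix Z assume Z: "Z \<subseteq> ?O" "Z \<noteq> {}" "\<forall>a\<in>?O. \<forall>z\<in>Z. lam a z \<in> Z"
  define V where "V = {a \<in> part S. \<forall>z\<in>Z. lam a z \<in> Z}"
  have "V = part S"
  proof (rule part_generate[OF x h u hu])
    show "1 \<in> V" using one_part lam_one Z(1) OG by (auto simp: V_def)
    fix a w assume a: "a \<in> V" and w: "w \<in> ?O"
    have aG: "a \<in> G" "inverse a \<in> G" using a part_G inverse_G by (auto simp: V_def)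
    have wS: "w \<in> part S" using w h lam_part by (auto simp: orb_def)
    define v where "v = lam (inverse a) w"
    have "v \<in> orb lam G w" using aG by (auto simp: v_def orb_def)
    then have v: "v \<in> ?O" using orb_eq[OF acts_lam subG hG w] by simp
    have "a +\<^sub>b w \<in> part S" using bsum_part a wS by (auto simp: V_def)
    moreover have "lam (a +\<^sub>b w) z \<in> Z" if z: "z \<in> Z" for z
    proof -
      have "lam (a +\<^sub>b w) z = lam a (lam v z)"
        unfolding bsum_def v_def [symmetric] using lam_mult[OF aG(1), of v z] v z Z(1) OG by blast
      then show ?thesis using Z(3) v z a by (auto simp: V_def)
    qed
    ultimately show "a +\<^sub>b w \<in> V" by (simp add: V_def)
  qed (auto simp: V_def)
  obtain z where z: "z \<in> Z" using Z(2) by blast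
  have "?O = orb lam G z" using orb_eq[OF acts_lam subG hG] z Z(1) by blast
  also have "\<dots> = orb lam (part S) z"
  proof -
    have OS: "?O = orb lam (part S) h" by (rule part_orbit[OF h fix_h])
    have "orb lam (part S) z = orb lam (part S) h"
      using orb_eq[OF acts_subset[OF acts_lam part_G] subgrp_part hG] z Z(1) OS by blast
    then show ?thesis using OS \<open>?O = orb lam G z\<close> by simp
  qed
  also have "\<dots> \<subseteq> Z" using \<open>V = part S\<close> z by (auto simp: orb_def V_def)
  finally show "Z = ?O" using Z(1) by blast
qed

lemma emb_not_injective:
  assumes IH: "\<And>Y. Y \<subseteq> G \<Longrightarrow> cycle_set Y lam \<Longrightarrow> indec_cs Y lam \<Longrightarrow> squarefree (card Y) \<Longrightarrow> card Y < card X \<Longrightarrow> multiperm_cs Y lam"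
    and card: "card X > 1"
  shows "\<not> inj_on emb X"
proof
  assume inj: "inj_on emb X"
  obtain x0 where x0: "x0 \<in> X" using X_ne by blast
  have "G \<noteq> {1}"
  proof
    assume "G = {1}"
    then have "X = {x0}" using transitive[OF x0] actsD(1)[OF act x0] by (auto simp: orb_def)
    then show False using card by simp
  qed
  moreover have "squarefree (card (orb act G x))" if "x \<in> X" for x using transitive[OF that] X_sqf by simp
  ultimately obtain p where p: "prime p" "core G (G \<inter> part {p}) \<noteq> {1}"
    using exists_core_nontrivial[OF reduced_G act faithful] by blast
  then have core: "core G (part {p}) \<noteq> {1}" by (simp add: G_part)
  obtain x h u where xhu: "x \<in> X" "h \<in> part (- {p})" "u \<in> part {p}" "emb x = h +\<^sub>b u"
    "\<And>w. w \<in> part {p} \<Longrightarrow> lam w h = h" and pX: "p dvd card X"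
    using obtain_fixed_component[OF p(1) core] by metis
  let ?O = "orb lam G h"
  have hG: "h \<in> G" using xhu(2) part_G by blast
  have O: "?O \<subseteq> G" using orb_subset[OF acts_lam hG] .
  have u': "u \<in> part (- (- {p}))" and fix': "\<And>w. w \<in> part (- (- {p})) \<Longrightarrow> lam w h = h" using xhu by auto
  have dvd: "card ?O dvd card X" by (rule card_component_orbit_dvd[OF xhu(1,2) u' xhu(4)])
  have OS: "?O = orb lam (part (- {p})) h" by (rule part_orbit[OF xhu(2) fix'])
  \<comment> \<open>The orbit length divides the order of \<open>part (- {p})\<close>, so it is
    prime to p, whereas p divides \<open>card X\<close>. Hence the orbit is strictly smaller than
    X.\<close>
  have "card ?O dvd card (part (- {p}))"
    unfolding OS using card_orb_dvd[OF acts_subset[OF acts_lam part_G] subgrp_part fin_part hG] .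
  then have "pi_num (- {p}) (card ?O)" using pi_num_card_part pi_num_dvd by blast
  then have "\<not> p dvd card ?O" using p(1) by (auto simp: pi_num_def)
  then have "card ?O \<noteq> card X" using pX by auto
  then have "card ?O < card X" using dvd card by (meson dvd_imp_le le_neq_implies_less less_trans zero_less_one)
  moreover have "squarefree (card ?O)" using squarefree_mono[OF dvd X_sqf] .
  moreover note cs = orbit_cycle_set[OF hG] and ind = orbit_indec[OF xhu(1,2) u' xhu(4) fix']
  ultimately have "multiperm_cs ?O lam" using IH O by blast
  then have normal: "normal_in (part {p}) G"
    using normal_part_of_one_generated[OF xhu(1-5)] one_generator[OF cs ind] by blast
  have "part {p} \<noteq> {1}"
  proof
    assume "part {p} = {1}"
    then have "core G (part {p}) \<subseteq> {1}" using core_subset[OF subG, of "part {p}"] by simp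
    then show False using core normal_inD(1)[OF core_normal[OF subG subgrp_part]] by (auto simp: subgrp_def)
  qed
  then obtain t where t: "t \<in> G" "t \<noteq> 1" "\<And>a. a \<in> G \<Longrightarrow> lam t a = a"
    using socle_of_normal_part[OF p(1) normal] by blast
  have "act t y = y" if y: "y \<in> X" for y
    using inj_onD[OF inj] emb_act[OF t(1) y] t(3)[OF emb_G[OF y]] actsD(2)[OF act y t(1)] y by simp
  then show False using faithful[OF t(1)] t(2) by blast
qed

text \<open>Keeps the cardinality of the retraction square-free. The image is a single
  \<open>lam\<close>-orbit, and the stabiliser of x fixes \<open>emb x\<close>.\<close>

lemma card_image_dvd: "card (emb ` X) dvd card X"
proof -
  obtain x where x: "x \<in> X" using X_ne by blast
  have im: "emb ` X = orb lam G (emb x)"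
    using emb_act[OF _ x] by (subst transitive[OF x, symmetric]) (auto simp: orb_def image_image)
  note xG = emb_G[OF x]
  have "stb act G x \<subseteq> stb lam G (emb x)" using emb_act[OF _ x] by (auto simp: stb_def) metis
  then show ?thesis unfolding im by (rule card_lam_orbit_dvd[OF x xG])
qed

end

theorem multiperm_cs_of_squarefree:
  fixes X :: "'a set"
  assumes "cycle_set X s" "indec_cs X s" "squarefree (card X)"
  shows "multiperm_cs X s"
  using assms
proof (induction "card X" arbitrary: X s rule: less_induct)
  case less
  interpret cycle_set_perms X s by unfold_locales (rule less.prems(1))
  interpret B: brace_set G lamG X "apply" sig by (rule brace_set_G[OF less.prems(2,3)])
  have IH: "multiperm_cs Y lamG" if "cycle_set Y lamG" "indec_cs Y lamG" "squarefree (card Y)" "card Y < card X" for Y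
    by (rule multiperm_cs_transport[OF _ that]) (use less.hyps in blast)
  show ?case
  proof (cases "card X > 1")
    case False
    moreover have "card X \<noteq> 0" using B.finX B.X_ne by simp
    ultimately have "card X = 1" by linarith
    then obtain x where "X = {x}" by (auto simp: card_1_singleton_iff)
    then show ?thesis by (auto simp: multiperm_cs_def ret_rel_refl)
  next
    case True
    have ninj: "\<not> inj_on sig X" by (rule B.emb_not_injective[OF IH True])
    obtain x where x: "x \<in> X" using B.X_ne by blast
    have im: "sig ` X = orb lamG G (sig x)"
      using B.emb_act[OF _ x] by (subst B.transitive[OF x, symmetric]) (auto simp: orb_def image_image)
    have "cycle_set (sig ` X) lamG" unfolding im by (rule B.orbit_cycle_set[OF sig_G[OF x]])
    moreover have "indec_cs (sig ` X) lamG" unfolding indec_cs_def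
    proof (intro conjI allI impI)
      fix Z assume Z: "Z \<subseteq> sig ` X" "Z \<noteq> {}" "\<forall>a\<in>sig ` X. \<forall>z\<in>Z. lamG a z \<in> Z"
      define V where "V = {v \<in> X. sig v \<in> Z}"
      have "V \<subseteq> X" "V \<noteq> {}" using Z by (auto simp: V_def)
      moreover have "s y v \<in> V" if y: "y \<in> X" and v: "v \<in> V" for y v
      proof -
        have "lamG (sig y) (sig v) \<in> Z" using Z(3) y v by (auto simp: V_def)
        then show ?thesis using lamG_sig_sig[OF y] y v c(3) by (simp add: V_def)
      qed
      ultimately have "V = X" using less.prems(2) by (auto simp: indec_cs_def)
      then show "Z = sig ` X" using Z(1) by (auto simp: V_def)
    qed (use x in auto)
    moreover have "squarefree (card (sig ` X))" using squarefree_mono[OF B.card_image_dvd less.prems(3)] .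
    moreover have "card (sig ` X) < card X"
      using ninj card_image_le[OF B.finX, of sig] eq_card_imp_inj_on[OF B.finX, of sig] by fastforce
    ultimately show ?thesis using multiperm_cs_of_image IH by blast
  qed
qed

subsection \<open>Solutions of the Yang--Baxter equation\<close>

lemma ret_eq_eq_req: "ret_eq X r k x y = ret_rel X (ybe_sigma r) k x y"
  by (induction k arbitrary: x y) auto

lemma bij_betw_of_surj: "finite Y \<Longrightarrow> f ` Y = Y \<Longrightarrow> bij_betw f Y Y"
  by (simp add: bij_betw_def eq_card_imp_inj_on)

lemma ybe_solutionD:
  assumes "ybe_solution X r" "x \<in> X" "y \<in> X"
  shows "ybe_sigma r x y \<in> X" "ybe_gamma r y x \<in> X"
    "ybe_sigma r (ybe_sigma r x y) (ybe_gamma r y x) = x" "ybe_gamma r (ybe_gamma r y x) (ybe_sigma r x y) = y"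
proof -
  have "r (x, y) \<in> X \<times> X" "r (r (x, y)) = (x, y)" using assms by (auto simp: ybe_solution_def)
  then show "ybe_sigma r x y \<in> X" "ybe_gamma r y x \<in> X"
    "ybe_sigma r (ybe_sigma r x y) (ybe_gamma r y x) = x" "ybe_gamma r (ybe_gamma r y x) (ybe_sigma r x y) = y"
    by (auto simp: ybe_sigma_def ybe_gamma_def)
qed

lemma cycle_set_of_solution:
  assumes r: "ybe_solution X r" and "finite X"
  shows "cycle_set X (ybe_sigma r)"
  unfolding cycle_set_def
proof (intro conjI ballI impI assms(2))
  let ?s = "ybe_sigma r" and ?g = "ybe_gamma r"
  have bij: "bij_betw (?s x) X X" if "x \<in> X" for x using r that by (simp add: ybe_solution_def)
  then show "bij_betw (?s x) X X" if "x \<in> X" for x using that .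
  fix x y w z assume x: "x \<in> X" and y: "y \<in> X" and w: "w \<in> X" and z: "z \<in> X" and eq: "?s (?s x y) w = x"
  note d = ybe_solutionD[OF r x y]
  have "?s (?s x y) w = ?s (?s x y) (?g y x)" using eq d(3) by simp
  then have "w = ?g y x" using bij_betw_imp_inj_on[OF bij[OF d(1)]] w d(2) by (auto dest: inj_onD)
  moreover have "r12 r (r23 r (r12 r (x, y, z))) = r23 r (r12 r (r23 r (x, y, z)))"
    using r x y z by (simp add: ybe_solution_def)
  then have "?s (?s x y) (?s (?g y x) z) = ?s x (?s y z)"
    by (auto simp: r12_def r23_def ybe_sigma_def ybe_gamma_def split: prod.splits)
  ultimately show "?s x (?s y z) = ?s (?s x y) (?s w z)" by simp
qed

lemma indec_cs_of_indecomposable: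
  assumes r: "ybe_solution X r" and fin: "finite X" and ind: "indecomposable X r"
  shows "indec_cs X (ybe_sigma r)"
  unfolding indec_cs_def
proof (intro conjI allI impI)
  show "X \<noteq> {}" using r by (simp add: ybe_solution_def)
  fix Z assume Z: "Z \<subseteq> X" "Z \<noteq> {}" "\<forall>x\<in>X. \<forall>z\<in>Z. ybe_sigma r x z \<in> Z"
  have pg: "\<forall>z\<in>Z. g z \<in> Z" if "g \<in> perm_group X r" for g
    using that
  proof induction
    case (pg_inv g x)
    have inj: "inj_on (ybe_sigma r x) X" using r pg_inv by (simp add: ybe_solution_def bij_betw_def)
    have "ybe_sigma r x ` Z = Z"
      using Z pg_inv inj fin by (intro endo_inj_surj) (auto intro: finite_subset inj_on_subset)
    then have "the_inv_into X (ybe_sigma r x) z \<in> Z" if "z \<in> Z" for z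
      using the_inv_into_f_f[OF inj] Z(1) that by (metis (no_types, lifting) imageE subsetD)
    then show ?case using pg_inv by simp
  qed (use Z(3) in auto)
  have "y \<in> Z" if y: "y \<in> X" for y
  proof -
    obtain z where z: "z \<in> Z" using Z(2) by blast
    then have "z \<in> X" using Z(1) by blast
    then have "\<exists>g\<in>perm_group X r. g z = y" using ind y by (simp add: indecomposable_def)
    then show ?thesis using pg z by auto
  qed
  then show "Z = X" using Z(1) by blast
qed

text \<open>The retraction is realised on chosen representatives inside X because
  \<open>simple_solution\<close> ranges over targets in the same type.\<close>

lemma retraction:
  assumes r: "ybe_solution X r" and fin: "finite X"
  obtains \<rho> s where "ybe_solution (\<rho> ` X) s" "ybe_epi X r (\<rho> ` X) s \<rho>" "\<rho> ` X \<subseteq> X"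
    "\<And>x y. x \<in> X \<Longrightarrow> y \<in> X \<Longrightarrow> \<rho> x = \<rho> y \<longleftrightarrow> (\<forall>z\<in>X. ybe_sigma r x z = ybe_sigma r y z)"
proof -
  let ?s = "ybe_sigma r" and ?g = "ybe_gamma r"
  note cs = cycle_set_of_solution[OF r fin] and d = ybe_solutionD[OF r]
  note c = cycle_setD[OF cs]
  define E where "E = ret_rel X ?s 1"
  have E: "E x y \<longleftrightarrow> (\<forall>z\<in>X. ?s x z = ?s y z)" for x y by (simp add: E_def)
  define \<rho> where "\<rho> x = (SOME y. y \<in> X \<and> E x y)" for x
  have \<rho>: "\<rho> x \<in> X" "E x (\<rho> x)" if "x \<in> X" for x
    using someI[of "\<lambda>y. y \<in> X \<and> E x y" x] that by (auto simp: \<rho>_def E)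
  have \<rho>_eq: "\<rho> x = \<rho> y" if "E x y" for x y
  proof -
    have "E x v \<longleftrightarrow> E y v" for v using that by (auto simp: E)
    then show ?thesis by (simp add: \<rho>_def)
  qed
  have \<rho>_iff: "\<rho> x = \<rho> y \<longleftrightarrow> E x y" if "x \<in> X" "y \<in> X" for x y
  proof
    assume "\<rho> x = \<rho> y"
    then have "E x (\<rho> y)" using \<rho>(2)[OF that(1)] by simp
    moreover have "E (\<rho> y) y" unfolding E_def by (rule ret_rel_sym) (use \<rho>(2)[OF that(2)] in \<open>simp only: E_def\<close>)
    ultimately show "E x y" unfolding E_def by (rule ret_rel_trans)
  qed (rule \<rho>_eq)
  have \<rho>_\<rho>: "\<rho> (\<rho> x) = \<rho> x" if "x \<in> X" for x using \<rho>_eq[OF \<rho>(2)[OF that]] by simp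
  have congs: "E (?s x y) (?s x' y')" if "x \<in> X" "x' \<in> X" "y \<in> X" "y' \<in> X" "E x x'" "E y y'" for x x' y y'
  proof -
    have "?s x' y' = ?s x y'" using that by (simp add: E)
    moreover have "E (?s x y) (?s x y')"
      unfolding E_def by (rule ret_rel_right[OF cs that(1,3,4) that(6) [unfolded E_def]])
    ultimately show ?thesis by simp
  qed
  \<comment> \<open>\<open>ybe_gamma r y x\<close> is the preimage of x under sigma at
    \<open>ybe_sigma r x y\<close>, and on a finite set this sigma may be cancelled from the
    relation.\<close>
  have congg: "E (?g y x) (?g y' x')" if xy: "x \<in> X" "x' \<in> X" "y \<in> X" "y' \<in> X" "E x x'" "E y y'" for x x' y y'
  proof -
    note d1 = d[OF xy(1,3)] and d2 = d[OF xy(2,4)]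
    have "?s (?s x y) (?g y' x') = ?s (?s x' y') (?g y' x')"
      using congs[OF xy] d2(2) by (auto simp: E)
    then have *: "E (?s (?s x y) (?g y x)) (?s (?s x y) (?g y' x'))" using d1(3) d2(3) xy(5) by simp
    show ?thesis
    proof (rule finite_invariant_relation[OF c(1) c(2)[OF d1(1)], of E, OF _ d1(2) d2(2) *])
      fix v v' assume "v \<in> X" "v' \<in> X" "E v v'"
      then show "E (?s (?s x y) v) (?s (?s x y) v')" unfolding E_def by (rule ret_rel_right[OF cs d1(1)])
    qed
  qed
  have ss: "\<rho> (?s (\<rho> x) (\<rho> y)) = \<rho> (?s x y)" and gg: "\<rho> (?g (\<rho> y) (\<rho> x)) = \<rho> (?g y x)" if "x \<in> X" "y \<in> X" for x y
    using \<rho>_eq[OF congs[of x "\<rho> x" y "\<rho> y"]] \<rho>_eq[OF congg[of x "\<rho> x" y "\<rho> y"]] \<rho> that by auto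
  define s where "s t = (case t of (x, y) \<Rightarrow> (\<rho> (?s x y), \<rho> (?g y x)))" for t
  let ?Y = "\<rho> ` X"
  have YX: "?Y \<subseteq> X" using \<rho> by blast
  have Yid: "\<rho> y = y" if "y \<in> ?Y" for y using that \<rho>_\<rho> by auto
  have fY: "finite ?Y" using fin by simp
  have sg: "ybe_sigma s x y = \<rho> (?s x y)" "ybe_gamma s y x = \<rho> (?g y x)" for x y
    by (auto simp: s_def ybe_sigma_def ybe_gamma_def)
  define R where "R t = (case t of (x, y, z) \<Rightarrow> (\<rho> x, \<rho> y, \<rho> z))" for t
  have 12: "r12 s (R t) = R (r12 r t)" "r12 r t \<in> X \<times> X \<times> X"
    and 23: "r23 s (R t) = R (r23 r t)" "r23 r t \<in> X \<times> X \<times> X" if t: "t \<in> X \<times> X \<times> X" for t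
  proof -
    obtain x y z where t_eq: "t = (x, y, z)" and xyz: "x \<in> X" "y \<in> X" "z \<in> X" using t by auto
    obtain u v where uv: "r (x, y) = (u, v)" by fastforce
    obtain u' v' where uv': "r (y, z) = (u', v')" by fastforce
    note facts = ss[OF xyz(1,2)] gg[OF xyz(1,2)] ss[OF xyz(2,3)] gg[OF xyz(2,3)]
      d(1,2)[OF xyz(1,2)] d(1,2)[OF xyz(2,3)]
    show "r12 s (R t) = R (r12 r t)" "r12 r t \<in> X \<times> X \<times> X"
      "r23 s (R t) = R (r23 r t)" "r23 r t \<in> X \<times> X \<times> X"
      using facts xyz by (simp_all add: r12_def r23_def R_def s_def t_eq uv uv' ybe_sigma_def ybe_gamma_def)
  qed
  have "ybe_solution ?Y s" unfolding ybe_solution_def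
  proof (intro conjI ballI)
    show "?Y \<noteq> {}" using r by (simp add: ybe_solution_def)
  next
    fix x y assume "x \<in> ?Y" "y \<in> ?Y"
    then have xy: "x \<in> X" "y \<in> X" using YX by auto
    show "s (x, y) \<in> ?Y \<times> ?Y" using d[OF xy] by (auto simp: s_def)
    have "s (s (x, y)) = (\<rho> (?s (\<rho> (?s x y)) (\<rho> (?g y x))), \<rho> (?g (\<rho> (?g y x)) (\<rho> (?s x y))))"
      by (simp add: s_def)
    also have "\<dots> = (\<rho> x, \<rho> y)" using d[OF xy] ss[OF d(1,2)[OF xy]] gg[OF d(1,2)[OF xy]] by simp
    finally show "s (s (x, y)) = (x, y)" using Yid[OF \<open>x \<in> ?Y\<close>] Yid[OF \<open>y \<in> ?Y\<close>] by simp
  next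
    fix x assume x: "x \<in> ?Y"
    then have xX: "x \<in> X" using YX by blast
    show "bij_betw (ybe_sigma s x) ?Y ?Y"
    proof (rule bij_betw_of_surj[OF fY])
      show "ybe_sigma s x ` ?Y = ?Y"
      proof (intro equalityI subsetI)
        fix v assume v: "v \<in> ?Y"
        then obtain u where u: "u \<in> X" "?s x u = v" using c(5)[OF xX] YX by blast
        have "\<rho> (?s (\<rho> x) (\<rho> u)) = \<rho> v" using ss[OF xX u(1)] u(2) by simp
        then have "ybe_sigma s x (\<rho> u) = v" using Yid[OF x] Yid[OF v] by (simp add: sg)
        then show "v \<in> ybe_sigma s x ` ?Y" using u(1) by blast
      qed (use d(1) xX YX sg in auto)
    qed
    have "bij_betw (?g x) X X" using r xX by (simp add: ybe_solution_def)
    then have gsurj: "?g x ` X = X" by (simp add: bij_betw_def)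
    show "bij_betw (ybe_gamma s x) ?Y ?Y"
    proof (rule bij_betw_of_surj[OF fY])
      show "ybe_gamma s x ` ?Y = ?Y"
      proof (intro equalityI subsetI)
        fix v assume v: "v \<in> ?Y"
        then obtain u where u: "u \<in> X" "?g x u = v" using gsurj YX by (metis imageE subsetD)
        have "\<rho> (?g (\<rho> x) (\<rho> u)) = \<rho> v" using gg[OF u(1) xX] u(2) by simp
        then have "ybe_gamma s x (\<rho> u) = v" using Yid[OF x] Yid[OF v] by (simp add: sg)
        then show "v \<in> ybe_gamma s x ` ?Y" using u(1) by blast
      qed (use d(2) xX YX sg in auto)
    qed
  next
    fix x y z assume xyz: "x \<in> ?Y" "y \<in> ?Y" "z \<in> ?Y"
    define t where "t = (x, y, z)"
    have xyzX: "x \<in> X" "y \<in> X" "z \<in> X" using xyz YX by blast+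
    have t: "t \<in> X \<times> X \<times> X" "R t = t"
      using xyzX Yid[OF xyz(1)] Yid[OF xyz(2)] Yid[OF xyz(3)] by (simp_all add: t_def R_def)
    have "r12 s (r23 s (r12 s (R t))) = R (r12 r (r23 r (r12 r t)))" using 12 23 t(1) by simp
    also have "r12 r (r23 r (r12 r t)) = r23 r (r12 r (r23 r t))"
      using r xyzX unfolding t_def by (simp add: ybe_solution_def)
    also have "R \<dots> = r23 s (r12 s (r23 s (R t)))" using 12 23 t(1) by simp
    finally show "r12 s (r23 s (r12 s (x, y, z))) = r23 s (r12 s (r23 s (x, y, z)))"
      using t(2) by (simp add: t_def)
  qed
  moreover have "ybe_epi X r ?Y s \<rho>"
    using ss by (auto simp: ybe_epi_def ybe_hom_def sg)
  ultimately show ?thesis using that YX \<rho>_iff E by blast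
qed

section \<open>Solutions in which all sigma_x coincide\<close>

lemma permutation_solution:
  assumes "bij_betw \<rho> Y Y" "Y \<noteq> {}"
  shows "ybe_solution Y (\<lambda>(x, y). (\<rho> y, inv_into Y \<rho> x))"
proof -
  note inv = bij_betw_inv_into[OF assms(1)] bij_betw_inv_into_left[OF assms(1)] bij_betw_inv_into_right[OF assms(1)]
  have "ybe_sigma (\<lambda>(x, y). (\<rho> y, inv_into Y \<rho> x)) x = \<rho>"
    "ybe_gamma (\<lambda>(x, y). (\<rho> y, inv_into Y \<rho> x)) x = inv_into Y \<rho>" for x
    by (auto simp: ybe_sigma_def ybe_gamma_def)
  then show ?thesis using assms inv bij_betwE[OF assms(1)] bij_betwE[OF inv(1)]
    by (auto simp: ybe_solution_def r12_def r23_def)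
qed

text \<open>Without proper invariant subsets, \<open>\<tau>\<close> is a single cycle; e identifies
  it with the successor map on residues modulo \<open>card X\<close>.\<close>

lemma cyclic_enumeration:
  assumes fin: "finite X" and bij: "bij_betw \<tau> X X" and x0: "x0 \<in> X"
    and gen: "\<And>Z. Z \<subseteq> X \<Longrightarrow> Z \<noteq> {} \<Longrightarrow> (\<And>z. z \<in> Z \<Longrightarrow> \<tau> z \<in> Z) \<Longrightarrow> Z = X"
  obtains e where "bij_betw e {..<card X} X" "\<And>i. i < card X \<Longrightarrow> \<tau> (e i) = e (Suc i mod card X)"
proof -
  define e where "e i = (\<tau> ^^ i) x0" for i
  have eX: "e i \<in> X" for i
    by (induction i) (use x0 bij_betwE[OF bij] in \<open>auto simp: e_def\<close>)
  have inj: "inj_on \<tau> X" using bij by (simp add: bij_betw_def)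
  have shift: "e j = e 0" if "e (i + j) = e i" for i j
    using that
  proof (induction i)
    case (Suc i)
    then have "\<tau> (e (i + j)) = \<tau> (e i)" by (simp add: e_def)
    then show ?case using Suc.IH inj_onD[OF inj] eX by blast
  qed simp
  have "\<not> inj e" using fin eX by (meson finite_imageD finite_subset image_subsetI infinite_UNIV_nat)
  then obtain i j where "i < j" "e i = e j" unfolding inj_def by (metis linorder_neqE_nat)
  then have ex: "\<exists>d>0. e d = e 0" using shift[of i "j - i"] by (intro exI[of _ "j - i"]) simp
  define d where "d = (LEAST d. d > 0 \<and> e d = e 0)"
  have d: "d > 0" "e d = e 0" using LeastI_ex[OF ex] by (auto simp: d_def)
  have least: "d \<le> k" if "k > 0" "e k = e 0" for k unfolding d_def using that by (intro Least_le) simp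
  have emod: "e (i mod d) = e i" for i
    using funpow_mod_eq[of d \<tau> x0 i] d(2) by (simp add: e_def)
  have injd: "inj_on e {..<d}"
  proof (rule linorder_inj_onI)
    fix i j assume "i < j" "i \<in> {..<d}" "j \<in> {..<d}"
    then show "e i \<noteq> e j" using shift[of i "j - i"] least[of "j - i"] by auto
  qed auto
  have "e ` {..<d} = X"
  proof (rule gen)
    fix z assume "z \<in> e ` {..<d}"
    then obtain i where "z = e i" by auto
    then have "\<tau> z = e (Suc i mod d)" using emod[of "Suc i"] by (simp add: e_def)
    then show "\<tau> z \<in> e ` {..<d}" using d(1) by auto
  qed (use eX d in auto)
  then have b: "bij_betw e {..<d} X" using injd by (simp add: bij_betw_def)
  then have "card X = d" using bij_betw_same_card by fastforce
  moreover have "\<tau> (e i) = e (Suc i mod d)" for i using emod[of "Suc i"] by (simp add: e_def)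
  ultimately show ?thesis using that b by blast
qed

text \<open>The common sigma is one cycle of length \<open>card X\<close>. Reducing positions modulo
  q maps it onto a cycle of length q, which has more than one point but fewer than X.\<close>

lemma permutation_solution_not_simple:
  assumes r: "ybe_solution X r" and fin: "finite X" and ind: "indec_cs X (ybe_sigma r)"
    and const: "\<And>x y z. \<lbrakk>x \<in> X; y \<in> X; z \<in> X\<rbrakk> \<Longrightarrow> ybe_sigma r x z = ybe_sigma r y z"
    and q: "q dvd card X" "1 < q" "q < card X"
  shows "\<not> simple_solution X r"
proof
  assume simple: "simple_solution X r"
  obtain x0 where x0: "x0 \<in> X" using r by (auto simp: ybe_solution_def)
  define \<tau> where "\<tau> = ybe_sigma r x0"
  have \<tau>: "ybe_sigma r x z = \<tau> z" if "x \<in> X" "z \<in> X" for x z 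
    unfolding \<tau>_def by (rule const[OF that(1) x0 that(2)])
  have bij: "bij_betw \<tau> X X" using r x0 by (simp add: ybe_solution_def \<tau>_def)
  have gen: "Z = X" if "Z \<subseteq> X" "Z \<noteq> {}" "\<And>z. z \<in> Z \<Longrightarrow> \<tau> z \<in> Z" for Z
  proof -
    have "\<forall>x\<in>X. \<forall>z\<in>Z. ybe_sigma r x z \<in> Z"
    proof (intro ballI)
      fix x z assume "x \<in> X" "z \<in> Z"
      then show "ybe_sigma r x z \<in> Z" using \<tau> [of x z] that by auto
    qed
    then show ?thesis using ind that(1,2) by (simp add: indec_cs_def)
  qed
  obtain e where e: "bij_betw e {..<card X} X" "\<And>i. i < card X \<Longrightarrow> \<tau> (e i) = e (Suc i mod card X)"
    using cyclic_enumeration[OF fin bij x0 gen] by blast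
  define idx where "idx = inv_into {..<card X} e"
  have idx: "idx (e i) = i" if "i < card X" for i using bij_betw_inv_into_left[OF e(1)] that by (simp add: idx_def)
  have X_e: "X = e ` {..<card X}" using e(1) by (simp add: bij_betw_def)
  define Y where "Y = e ` {..<q}"
  define \<rho> where "\<rho> y = e (Suc (idx y) mod q)" for y
  define g where "g x = e (idx x mod q)" for x
  have YX: "Y \<subseteq> X" using X_e q(3) by (auto simp: Y_def)
  have cY: "card Y = q"
    unfolding Y_def using q(3) card_image[OF inj_on_subset[OF bij_betw_imp_inj_on[OF e(1)]], of "{..<q}"] by auto
  have \<rho>e: "\<rho> (e i) = e (Suc i mod q)" if "i < q" for i using idx q(3) that by (simp add: \<rho>_def)
  have "\<rho> ` Y = Y"
  proof (intro equalityI subsetI)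
    fix y assume "y \<in> Y"
    then obtain j where j: "j < q" "y = e j" by (auto simp: Y_def)
    show "y \<in> \<rho> ` Y"
    proof (cases j)
      case 0
      then have "\<rho> (e (q - 1)) = y" using \<rho>e[of "q - 1"] j q(2) by simp
      moreover have "e (q - 1) \<in> Y" using q(2) by (auto simp: Y_def)
      ultimately show ?thesis by blast
    next
      case (Suc i)
      then have "\<rho> (e i) = y" using \<rho>e[of i] j by simp
      moreover have "e i \<in> Y" using j Suc by (auto simp: Y_def)
      ultimately show ?thesis by blast
    qed
  qed (use \<rho>e q in \<open>auto simp: Y_def\<close>)
  then have b: "bij_betw \<rho> Y Y" by (rule bij_betw_of_surj[OF finite_subset[OF YX fin]])
  let ?s = "\<lambda>(x, y). (\<rho> y, inv_into Y \<rho> x)"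
  have "Y \<noteq> {}" using cY q(2) by auto
  then have sol: "ybe_solution Y ?s" by (rule permutation_solution[OF b])
  have gX: "g ` X = Y"
  proof (intro equalityI subsetI)
    fix y assume "y \<in> Y"
    then obtain j where j: "j < q" "y = e j" by (auto simp: Y_def)
    then have "g (e j) = y" using idx q(3) by (simp add: g_def)
    then show "y \<in> g ` X" using j X_e q(3) by (metis imageI lessThan_iff less_trans)
  qed (use q(2) in \<open>auto simp: g_def Y_def\<close>)
  have "g (ybe_sigma r x y) = ybe_sigma ?s (g x) (g y)" if x: "x \<in> X" and y: "y \<in> X" for x y
  proof -
    obtain i where i: "i < card X" "y = e i" using y X_e by auto
    have "Suc i mod card X < card X" using i by (intro mod_less_divisor) auto
    then have "g (\<tau> y) = e (Suc i mod card X mod q)" using idx e(2) i by (simp add: g_def)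
    \<comment> \<open>Divisibility of \<open>card X\<close> by q makes the step from the last
      position back to 0 compatible with reduction modulo q.\<close>
    also have "\<dots> = e (Suc i mod q)" using q(1) by (simp add: mod_mod_cancel)
    also have "\<dots> = \<rho> (e (i mod q))" using \<rho>e[of "i mod q"] q(2) by (simp add: mod_Suc_eq)
    also have "e (i mod q) = g y" using idx i by (simp add: g_def)
    finally show ?thesis using \<tau> [OF x y] by (simp add: ybe_sigma_def)
  qed
  then have "ybe_epi X r Y ?s g" using gX by (auto simp: ybe_epi_def ybe_hom_def)
  then have "bij_betw g X Y \<or> (\<exists>c. Y = {c})" using simple sol by (auto simp: simple_solution_def)
  then show False using bij_betw_same_card cY q by fastforce
qed

theorem theorem4p5:
  fixes X :: "'a set" and r :: "'a \<times> 'a \<Rightarrow> 'a \<times> 'a"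
    and n :: nat and p :: "nat \<Rightarrow> nat"
  assumes "n \<ge> 1"
    and "\<forall>i<n. prime (p i)"
    and "inj_on p {..<n}"
    and "ybe_solution X r"
    and "indecomposable X r"
    and "finite X"
    and "card X = (\<Prod>i<n. p i)"
  shows "multipermutation X r \<and> (n > 1 \<longrightarrow> \<not> simple_solution X r)"
proof -
  let ?s = "ybe_sigma r"
  have "squarefree (\<Prod>i<n. p i)"
  proof (rule squarefree_prod_coprime)
    fix i j assume "i \<in> {..<n}" "j \<in> {..<n}" "i \<noteq> j"
    then show "coprime (p i) (p j)"
      using assms(2,3) by (intro primes_coprime) (auto dest: inj_onD)
  qed (use assms(2) squarefree_prime in auto)
  then have sqf: "squarefree (card X)" using assms(7) by simp
  have ind: "indec_cs X ?s" by (rule indec_cs_of_indecomposable[OF assms(4,6,5)])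
  have "multiperm_cs X ?s" by (rule multiperm_cs_of_squarefree[OF cycle_set_of_solution[OF assms(4,6)] ind sqf])
  then obtain k where k: "\<And>x y. x \<in> X \<Longrightarrow> y \<in> X \<Longrightarrow> ret_rel X ?s k x y" by (auto simp: multiperm_cs_def)
  \<comment> \<open>\<open>multipermutation\<close> asks for a level of at least 1, while k may be
    0.\<close>
  then have "\<forall>x\<in>X. \<forall>y\<in>X. ret_eq X r (Suc k) x y" using ret_rel_Suc by (metis ret_eq_eq_req)
  then have "multipermutation X r" unfolding multipermutation_def by (intro exI[of _ "Suc k"]) simp
  moreover have "\<not> simple_solution X r" if n: "n > 1"
  proof
    assume simple: "simple_solution X r"
    \<comment> \<open>This prime is a proper divisor because p 1 is a different prime divisor of
      \<open>card X\<close>.\<close>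
    define q where "q = p 0"
    have q: "prime q" "q dvd card X" using assms(2,7) n by (auto simp: q_def intro!: dvd_prodI)
    have "q \<noteq> card X"
    proof
      assume "q = card X"
      moreover have "p 1 dvd card X" using assms(7) n by (auto intro!: dvd_prodI)
      ultimately have "p 1 = p 0" 
        using assms(2) n q(1) primes_dvd_imp_eq[of "p 1" "p 0"] by (simp add: q_def)
      then show False using assms(3) n by (auto dest: inj_onD)
    qed
    moreover have "card X > 0" using sqf by (metis gr0I not_squarefree_0)
    ultimately have q': "1 < q" "q < card X" using q prime_gt_1_nat dvd_imp_le le_neq_implies_less by blast+
    obtain \<rho> s where \<rho>: "ybe_solution (\<rho> ` X) s" "ybe_epi X r (\<rho> ` X) s \<rho>" "\<rho> ` X \<subseteq> X"
      "\<And>x y. x \<in> X \<Longrightarrow> y \<in> X \<Longrightarrow> \<rho> x = \<rho> y \<longleftrightarrow> (\<forall>z\<in>X. ?s x z = ?s y z)"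
      by (rule retraction[OF assms(4,6)]) (rule that)
    have "bij_betw \<rho> X (\<rho> ` X) \<or> (\<exists>c. \<rho> ` X = {c})" using simple \<rho>(1,2) by (auto simp: simple_solution_def)
    then show False
    proof
      assume "bij_betw \<rho> X (\<rho> ` X)"
      then have inj: "x = y" if "x \<in> X" "y \<in> X" "\<forall>z\<in>X. ?s x z = ?s y z" for x y
        using that \<rho>(4) by (metis bij_betw_imp_inj_on inj_onD)
      have "x = y" if "ret_rel X ?s j x y" "x \<in> X" "y \<in> X" for j x y
        using that
      proof (induction j arbitrary: x y)
        case (Suc j)
        then have "?s x z = ?s y z" if "z \<in> X" for z
          using that ybe_solutionD(1)[OF assms(4)] by simp
        then show ?case using inj Suc.prems by blast
      qed simp
      then have "x = y" if "x \<in> X" "y \<in> X" for x y using k that by blast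
      then have "card X \<le> 1" using assms(6) by (metis card_le_Suc0_iff_eq One_nat_def)
      then show False using q' by simp
    next
      assume "\<exists>c. \<rho> ` X = {c}"
      then have "\<rho> x = \<rho> y" if "x \<in> X" "y \<in> X" for x y using that by (metis imageI singletonD)
      then have "?s x z = ?s y z" if "x \<in> X" "y \<in> X" "z \<in> X" for x y z using \<rho>(4) that by blast
      then show False
        using permutation_solution_not_simple[OF assms(4,6) ind _ q(2) q'] simple by blast
    qed
  qed
  ultimately show ?thesis by blast
qed

end
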